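(* Let $n\ge2$ and let $\beta$ be a finite union of $W(B_n)$-orbits in $(S_{\boldsymbol{\lambda}})^n$. Then the set $$\mathcal{D}:=\{\,y_1^{m_1}\cdots y_n^{m_n}\Psi_w e(\mathbf{i})\ \mid\ w\in W(D_n),\ (m_1,\dots,m_n)\in(\mathbb{Z}_{\ge0})^n,\ \mathbf{i}\in\beta\,\}$$ is a $K$-basis of $W^\beta_{\boldsymbol{\lambda}}$, and the algebra $W^\beta_{\boldsymbol{\lambda}}$ is isomorphic to the subalgebra of fixed points $\bigl(V^\beta_{\boldsymbol{\lambda}}\bigr)^{\rho}=\{x\in V^\beta_{\boldsymbol{\lambda}}\mid\rho(x)=x\}$ of $V^\beta_{\boldsymbol{\lambda}}$.
   Context: **Ground data.** $K$ is a field of characteristic different from $2$, and $q\in K\setminus\{0\}$ with $q^2\neq 1$. For $\lambda\in K\setminus\{0\}$ put $I_\lambda:=\{\lambda^{\epsilon}q^{2t}\mid \epsilon\in\{-1,1\},\ t\in\mathbb{Z}\}$. Fix a tuple $\boldsymbol{\lambda}=(\lambda_1,\dots,\lambda_l)$ of elements of $K\setminus\{0\}$ with $I_{\lambda_a}\cap I_{\lambda_b}=\emptyset$ for $a\neq b$, and put $S_{\boldsymbol{\lambda}}:=I_{\lambda_1}\cup\dots\cup I_{\lambda_l}$. For $i,j\in S_{\boldsymbol{\lambda}}$ write: $i\nleftrightarrow j$ if $i\neq j$ and $j\notin\{q^2i,q^{-2}i\}$; $i\rightarrow j$ if $j=q^2i\neq q^{-2}i$; $i\leftarrow j$ if $j=q^{-2}i\neq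 q^2i$; $i\leftrightarrow j$ if $j=q^2i=q^{-2}i$. **Weyl groups.** $W(B_n)$ is the Weyl group of type $B_n$ with Coxeter generators $r_0,\dots,r_{n-1}$ ($r_0$ and $r_1$ satisfying the braid relation of length 4; $r_1,\dots,r_{n-1}$ generating the symmetric group on $n$ letters). $W(D_n)$ is the Weyl group of type $D_n$ with Coxeter generators $s_0,\dots,s_{n-1}$, where $s_1,\dots,s_{n-1}$ generate the symmetric group and $s_0$ satisfies $s_0s_2s_0=s_2s_0s_2$ and commutes with $s_j$, $j\ne 0,2$. There is an injective homomorphism $\iota:W(D_n)\to W(B_n)$, $s_0\mapsto r_0r_1r_0$, $s_k\mapsto r_k$ for $k\ge1$. $W(B_n)$ acts on $(S_{\boldsymbol{\lambda}})^n$ by $r_0\cdot(i_1,\dots,i_n)=(i_1^{-1},i_2,\dots,i_n)$ and $r_k$ ($1\le k\le n-1$) exchanging the entries in positions $k,k+1$; $W(D_n)$ acts by $s_0\cdot(i_1,\dots,i_n)=(i_2^{-1},i_1^{-1},i_3,\dots,i_n)$ and $s_k$ exchanging the entries in positions $k,k+1$. So a finite union $\beta$ of $W(B_n)$-orbits is also a finite union of $W(D_n)$-orbits. **Algebra $V^\beta_{\boldsymbol{\lambda}}$.** It is the unital $K$-algebra generated by $\psi_0,\dots,\psi_{n-1}$, $y_1,\dots,y_n$ and $e(\mathbf{i})$, $\mathbf{i}\in\beta$, with the following relations, for all $\mathbf{i}=(i_1,\dots,i_n),\mathbf{j}\in\beta$, all $a\in\{0,\dots,n-1\}$, $b\in\{1,\dots,n-1\}$,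 $j,k\in\{1,\dots,n\}$ for which they make sense ($\pi_b$ is the transposition $(b,b+1)$): - $\sum_{\mathbf{i}\in\beta}e(\mathbf{i})=1$, $e(\mathbf{i})e(\mathbf{j})=\delta_{\mathbf{i},\mathbf{j}}e(\mathbf{i})$, $y_jy_k=y_ky_j$, $y_je(\mathbf{i})=e(\mathbf{i})y_j$, $\psi_ae(\mathbf{i})=e(r_a(\mathbf{i}))\psi_a$; - $(\psi_by_j-y_{\pi_b(j)}\psi_b)e(\mathbf{i})$ equals $-e(\mathbf{i})$ if $j=b$ and $i_b=i_{b+1}$; $e(\mathbf{i})$ if $j=b+1$ and $i_b=i_{b+1}$; $0$ otherwise; - $\psi_a\psi_b=\psi_b\psi_a$ if $|a-b|>1$; - $\psi_b^2e(\mathbf{i})$ equals $0$ if $i_b=i_{b+1}$; $e(\mathbf{i})$ if $i_b\nleftrightarrow i_{b+1}$; $(y_{b+1}-y_b)e(\mathbf{i})$ if $i_b\rightarrow i_{b+1}$; $(y_b-y_{b+1})e(\mathbf{i})$ if $i_b\leftarrow i_{b+1}$; $(y_{b+1}-y_b)(y_b-y_{b+1})e(\mathbf{i})$ if $i_b\leftrightarrow i_{b+1}$; - $(\psi_b\psi_{b+1}\psi_b-\psi_{b+1}\psi_b\psi_{b+1})e(\mathbf{i})$ equals $e(\mathbf{i})$ if $i_b=i_{b+2}\rightarrow i_{b+1}$; $-e(\mathbf{i})$ if $i_b=i_{b+2}\leftarrow i_{b+1}$; $(y_{b+2}-2y_{b+1}+y_b)e(\mathbf{i})$ if $i_b=i_{b+2}\leftrightarrow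 i_{b+1}$; $0$ otherwise; - $\psi_0y_1+y_1\psi_0=0$; $\psi_0y_j=y_j\psi_0$ if $j>1$; $\psi_0^2=1$; $(\psi_0\psi_1)^2=(\psi_1\psi_0)^2$. The involutive automorphism $\rho$ of $V^\beta_{\boldsymbol{\lambda}}$ is given by $\psi_0\mapsto-\psi_0$ and by fixing $\psi_1,\dots,\psi_{n-1}$, all $y_j$ and all $e(\mathbf{i})$. **Algebra $W^\beta_{\boldsymbol{\lambda}}$.** It is the unital $K$-algebra generated by $\Psi_0,\dots,\Psi_{n-1}$, $y_1,\dots,y_n$ and $e(\mathbf{i})$, $\mathbf{i}\in\beta$, with the following relations (same index conventions, $b,b'\in\{1,\dots,n-1\}$): - the relations $\sum_{\mathbf{i}\in\beta}e(\mathbf{i})=1$, $e(\mathbf{i})e(\mathbf{j})=\delta_{\mathbf{i},\mathbf{j}}e(\mathbf{i})$, $y_jy_k=y_ky_j$, $y_je(\mathbf{i})=e(\mathbf{i})y_j$, $\Psi_ae(\mathbf{i})=e(s_a(\mathbf{i}))\Psi_a$ for $a\in\{0,\dots,n-1\}$; - for $b,b'\ge1$: $\Psi_b\Psi_{b'}=\Psi_{b'}\Psi_b$ if $|b-b'|>1$, and the relations displayed above for $(\psi_by_j-y_{\pi_b(j)}\psi_b)e(\mathbf{i})$, $\psi_b^2e(\mathbf{i})$ and $(\psi_b\psi_{b+1}\psi_b-\psi_{b+1}\psi_b\psi_{b+1})e(\mathbf{i})$, with each $\psi$ replaced by $\Psi$; - $\Psi_0y_je(\mathbf{i})$ equals $(-y_{\pi_1(j)}\Psi_0+1)e(\mathbf{i})$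 if $j\in\{1,2\}$ and $i_1^{-1}=i_2$; $-y_{\pi_1(j)}\Psi_0e(\mathbf{i})$ if $j\in\{1,2\}$ and $i_1^{-1}\neq i_2$; $y_j\Psi_0e(\mathbf{i})$ otherwise; - $\Psi_0\Psi_b=\Psi_b\Psi_0$ if $b=1$ or $b>2$; - $\Psi_0^2e(\mathbf{i})$ equals $0$ if $i_1^{-1}=i_2$; $e(\mathbf{i})$ if $i_1^{-1}\nleftrightarrow i_2$; $(y_1+y_2)e(\mathbf{i})$ if $i_1^{-1}\rightarrow i_2$; $-(y_1+y_2)e(\mathbf{i})$ if $i_1^{-1}\leftarrow i_2$; $-(y_1+y_2)^2e(\mathbf{i})$ if $i_1^{-1}\leftrightarrow i_2$; - $(\Psi_0\Psi_2\Psi_0-\Psi_2\Psi_0\Psi_2)e(\mathbf{i})$ equals $e(\mathbf{i})$ if $i_1^{-1}=i_3\rightarrow i_2$; $-e(\mathbf{i})$ if $i_1^{-1}=i_3\leftarrow i_2$; $(y_3-2y_2-y_1)e(\mathbf{i})$ if $i_1^{-1}=i_3\leftrightarrow i_2$; $0$ otherwise. **Choice of reduced expressions and $\Psi_w$.** For every $w\in W(D_n)$ there is a reduced expression $w=s_{i_1}\cdots s_{i_k}$ such that the word in $r_0,\dots,r_{n-1}$ obtained by replacing each $s_0$ by $r_0r_1r_0$ and each $s_j$ ($j\ge1$) by $r_j$ is a reduced expression of $\iota(w)$ in $W(B_n)$. Fix one such reduced expression for each $w\in W(D_n)$ and put $\Psi_w:=\Psi_{i_1}\cdots\Psi_{i_k}\in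 W^\beta_{\boldsymbol{\lambda}}$. *)

theory Defs
  imports
    "HOL-Library.Poly_Mapping"
    "HOL-Library.FuncSet"
    "HOL-Combinatorics.Transposition"
    "HOL-Algebra.QuotRing"
    "HOL-Computational_Algebra.Computational_Algebra"
    "Jordan_Normal_Form.VS_Connect"
begin

section \<open>Algebras given by generators and relations\<close>

datatype 'g fmon = FMon (letters: "'g list")

instantiation fmon :: (type) monoid_add
begin

definition "0 = FMon []"

definition "u + v = FMon (letters u @ letters v)"

instance
  by standard (simp_all add: zero_fmon_def plus_fmon_def)

end

text \<open>Finitely supported functions on words; the multiplication provided by
  \<^type>\<open>poly_mapping\<close> is convolution with respect to concatenation.\<close>

type_synonym ('g, 'k) falg = "'g fmon \<Rightarrow>\<^sub>0 'k"

definition gen :: "'g \<Rightarrow> ('g, 'k::field) falg"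
  where "gen g = Poly_Mapping.single (FMon [g]) 1"

definition scal :: "'k \<Rightarrow> ('g, 'k::field) falg"
  where "scal c = Poly_Mapping.single 0 c"

text \<open>The free algebra on the set \<open>G\<close>, not on all of the type.\<close>

definition free_alg :: "'g set \<Rightarrow> ('g, 'k::field) falg ring"
  where "free_alg G =
    class_ring \<lparr>carrier := {p. \<forall>w\<in>Poly_Mapping.keys p. set (letters w) \<subseteq> G}\<rparr>"

definition rel_ideal ::
  "'g set \<Rightarrow> (('g, 'k::field) falg \<Rightarrow> ('g, 'k) falg \<Rightarrow> bool) \<Rightarrow> ('g, 'k) falg set"
  where "rel_ideal G rel = Idl\<^bsub>free_alg G\<^esub> {l - r | l r. rel l r}"

definition cls ::
  "'g set \<Rightarrow> (('g, 'k::field) falg \<Rightarrow> ('g, 'k) falg \<Rightarrow> bool) \<Rightarrow> ('g, 'k) falg \<Rightarrow> ('g, 'k) falg set"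
  where "cls G rel p = rel_ideal G rel +>\<^bsub>free_alg G\<^esub> p"

definition presented_alg ::
  "'g set \<Rightarrow> (('g, 'k::field) falg \<Rightarrow> ('g, 'k) falg \<Rightarrow> bool) \<Rightarrow> ('k, ('g, 'k) falg set) module"
  where "presented_alg G rel = (let Q = free_alg G Quot rel_ideal G rel in
    \<lparr>carrier = carrier Q, monoid.mult = monoid.mult Q, one = one Q, zero = zero Q, add = add Q,
     smult = (\<lambda>c X. cls G rel (scal c) \<otimes>\<^bsub>Q\<^esub> X)\<rparr>)"

text \<open>The algebra homomorphism between free algebras determined by the images of the generators.\<close>

definition free_hom :: "('g \<Rightarrow> ('h, 'k::field) falg) \<Rightarrow> ('g, 'k) falg \<Rightarrow> ('h, 'k) falg"
  where "free_hom f p =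
    (\<Sum>w\<in>Poly_Mapping.keys p. scal (Poly_Mapping.lookup p w) * prod_list (map f (letters w)))"


lemma plus_FMon: "FMon u + FMon v = FMon (u @ v)"
  by (simp add: plus_fmon_def)

lemma letters_zero [simp]: "letters 0 = []"
  by (simp add: zero_fmon_def)

lemma letters_plus [simp]: "letters (u + v) = letters u @ letters v"
  by (simp add: plus_fmon_def)

lemma free_hom_superset:
  assumes "finite S" "Poly_Mapping.keys p \<subseteq> S"
  shows "free_hom f p = (\<Sum>w\<in>S. scal (Poly_Mapping.lookup p w) * prod_list (map f (letters w)))"
  unfolding free_hom_def
  by (rule sum.mono_neutral_left) (use assms in \<open>auto simp: in_keys_iff scal_def\<close>)

lemma scal_add: "scal (a + b) = scal a + scal b"
  by (simp add: scal_def single_add)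

lemma free_hom_add: "free_hom f (p + r) = free_hom f p + free_hom f r"
proof -
  let ?S = "Poly_Mapping.keys p \<union> Poly_Mapping.keys r"
  have "finite ?S" by simp
  note * = free_hom_superset[OF this]
  show ?thesis
    by (subst (1 2 3) *)
      (use keys_add[of p r] in \<open>auto simp: lookup_add scal_add distrib_right sum.distrib\<close>)
qed

lemma free_hom_zero: "free_hom f 0 = 0"
  by (simp add: free_hom_def)

lemma free_hom_uminus: "free_hom f (- p) = - free_hom f p"
  using free_hom_add[of f p "- p"] by (simp add: free_hom_zero eq_neg_iff_add_eq_0 add.commute)

lemma free_hom_diff: "free_hom f (p - r) = free_hom f p - free_hom f r"
  using free_hom_add[of f p "- r"] by (simp add: free_hom_uminus)

lemma free_hom_single: "free_hom f (Poly_Mapping.single w c) = scal c * prod_list (map f (letters w))"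
  by (cases "c = 0") (simp_all add: free_hom_def scal_def)

lemma free_hom_gen [simp]: "free_hom f (gen g) = f g"
  by (simp add: gen_def free_hom_single scal_def)

lemma falg_induct [case_names zero single add]:
  assumes "P 0" "\<And>w c. P (Poly_Mapping.single w c)" "\<And>p r. P p \<Longrightarrow> P r \<Longrightarrow> P (p + r)"
  shows "P (p :: ('g, 'k::field) falg)"
proof -
  have P: "P (sum (\<lambda>w. Poly_Mapping.single w (g w)) S)" if "finite S" for S g
    using that by (induction S) (auto intro: assms)
  have "p = (\<Sum>w\<in>Poly_Mapping.keys p. Poly_Mapping.single w (Poly_Mapping.lookup p w))"
  proof (rule poly_mapping_eqI)
    fix k
    show "Poly_Mapping.lookup p k = Poly_Mapping.lookup (\<Sum>w\<in>Poly_Mapping.keys p. Poly_Mapping.single w (Poly_Mapping.lookup p w)) k"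
      by (simp add: lookup_sum lookup_single when_def in_keys_iff)
  qed
  then show ?thesis using P[of "Poly_Mapping.keys p" "Poly_Mapping.lookup p"] by simp
qed

lemma scal_comm: "scal c * p = p * scal c"
  by (induction p rule: falg_induct)
    (auto simp: scal_def mult_single mult.commute distrib_left distrib_right)

lemma scal_mult: "scal (a * b) = scal a * scal b"
  by (simp add: scal_def mult_single)

lemma free_hom_mult: "free_hom f (p * r) = free_hom f p * free_hom f r"
proof (induction p rule: falg_induct)
  case (single w c)
  show ?case
  proof (induction r rule: falg_induct)
    case (single v d)
    show ?case
      by (cases w; cases v)
       (simp add: mult_single free_hom_single plus_FMon scal_mult mult.assoc,
        metis mult.assoc scal_comm)
  qed (simp_all add: free_hom_zero free_hom_add distrib_left)
qed (simp_all add: free_hom_zero free_hom_add distrib_right)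

lemma free_hom_one: "free_hom f 1 = 1"
  using free_hom_single[of f 0 1] by (simp add: letters_zero scal_def)

lemma free_hom_scal: "free_hom f (scal c) = scal c"
  by (simp add: scal_def free_hom_single zero_fmon_def)


section \<open>The Weyl groups of types B and D\<close>

text \<open>Both groups are realised on the vectors $\pm\varepsilon_1, \dots, \pm\varepsilon_n$, with
  $\pm\varepsilon_k$ encoded as the integer $\pm k$. The generator \<open>genB 0\<close> is the reflection in
  $\varepsilon_1$, \<open>genD 0\<close> the one in $\varepsilon_1 + \varepsilon_2$, and \<open>genB k = genD k\<close>
  with $k \ge 1$ the one in $\varepsilon_k - \varepsilon_{k+1}$. With these realisations
  \<open>genD 0 = genB 0 \<circ> genB 1 \<circ> genB 0\<close>, so that $\iota$ is the inclusion.\<close>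

definition genB :: "nat \<Rightarrow> int \<Rightarrow> int"
  where "genB a = (if a = 0 then transpose 1 (-1)
    else transpose (int a) (int a + 1) \<circ> transpose (- int a) (- (int a + 1)))"

definition genD :: "nat \<Rightarrow> int \<Rightarrow> int"
  where "genD a = (if a = 0 then transpose 1 (-2) \<circ> transpose (-1) 2 else genB a)"

definition wprod :: "(nat \<Rightarrow> int \<Rightarrow> int) \<Rightarrow> nat list \<Rightarrow> int \<Rightarrow> int"
  where "wprod s ws = foldr (\<circ>) (map s ws) id"

definition weyl :: "(nat \<Rightarrow> int \<Rightarrow> int) \<Rightarrow> nat \<Rightarrow> (int \<Rightarrow> int) set"
  where "weyl s n = {wprod s ws | ws. set ws \<subseteq> {0..<n}}"

definition reduced_expr :: "(nat \<Rightarrow> int \<Rightarrow> int) \<Rightarrow> nat \<Rightarrow> (int \<Rightarrow> int) \<Rightarrow> nat list \<Rightarrow> bool"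
  where "reduced_expr s n w ws \<longleftrightarrow> set ws \<subseteq> {0..<n} \<and> wprod s ws = w \<and>
    (\<forall>vs. set vs \<subseteq> {0..<n} \<and> wprod s vs = w \<longrightarrow> length ws \<le> length vs)"

definition D_to_B :: "nat list \<Rightarrow> nat list"
  where "D_to_B ws = concat (map (\<lambda>a. if a = 0 then [0, 1, 0] else [a]) ws)"

lemma genD_0: "genD 0 = genB 0 \<circ> genB 1 \<circ> genB 0"
  by (auto simp: fun_eq_iff genD_def genB_def transpose_def)

lemma wprod_D_to_B: "wprod genB (D_to_B ws) = wprod genD ws"
proof (induction ws)
  case (Cons a ws)
  then show ?case
    by (cases "a = 0") (simp_all add: D_to_B_def wprod_def genD_0, simp_all add: genD_def comp_assoc)
qed (simp add: D_to_B_def wprod_def)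


section \<open>Index tuples\<close>

definition I_set :: "'k::field \<Rightarrow> 'k \<Rightarrow> 'k set"
  where "I_set q lam = {lam powi \<epsilon> * q powi (2 * t) | \<epsilon> t. \<epsilon> \<in> {-1, 1}}"

definition S_set :: "'k::field \<Rightarrow> 'k list \<Rightarrow> 'k set"
  where "S_set q lams = (\<Union>lam\<in>set lams. I_set q lam)"

definition no_edge :: "'k::field \<Rightarrow> 'k \<Rightarrow> 'k \<Rightarrow> bool"
  where "no_edge q i j \<longleftrightarrow> i \<noteq> j \<and> j \<notin> {q powi 2 * i, q powi (-2) * i}"

definition edge_right :: "'k::field \<Rightarrow> 'k \<Rightarrow> 'k \<Rightarrow> bool"
  where "edge_right q i j \<longleftrightarrow> j = q powi 2 * i \<and> q powi 2 * i \<noteq> q powi (-2) * i"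

definition edge_left :: "'k::field \<Rightarrow> 'k \<Rightarrow> 'k \<Rightarrow> bool"
  where "edge_left q i j \<longleftrightarrow> j = q powi (-2) * i \<and> q powi (-2) * i \<noteq> q powi 2 * i"

definition edge_both :: "'k::field \<Rightarrow> 'k \<Rightarrow> 'k \<Rightarrow> bool"
  where "edge_both q i j \<longleftrightarrow> j = q powi 2 * i \<and> q powi 2 * i = q powi (-2) * i"

text \<open>An $n$-tuple over \<open>S\<close> is an element of \<open>{1..n} \<rightarrow>\<^sub>E S\<close>.\<close>

definition actB :: "nat \<Rightarrow> (nat \<Rightarrow> 'k::field) \<Rightarrow> nat \<Rightarrow> 'k"
  where "actB a i = (if a = 0 then i(1 := inverse (i 1)) else i \<circ> transpose a (a + 1))"

definition actD :: "nat \<Rightarrow> (nat \<Rightarrow> 'k::field) \<Rightarrow> nat \<Rightarrow> 'k"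
  where "actD a i = (if a = 0 then i(1 := inverse (i 2), 2 := inverse (i 1))
    else i \<circ> transpose a (a + 1))"

definition orbitB :: "nat \<Rightarrow> (nat \<Rightarrow> 'k::field) \<Rightarrow> (nat \<Rightarrow> 'k) set"
  where "orbitB n i = {foldr actB ws i | ws. set ws \<subseteq> {0..<n}}"


section \<open>The algebras V and W\<close>

datatype 'k klr_gen = Psi nat | Y nat | E "nat \<Rightarrow> 'k"

type_synonym 'k klr = "('k klr_gen, 'k) falg"

definition klr_gens :: "nat \<Rightarrow> (nat \<Rightarrow> 'k) set \<Rightarrow> 'k klr_gen set"
  where "klr_gens n \<beta> = Psi ` {0..<n} \<union> Y ` {1..n} \<union> E ` \<beta>"

abbreviation psi :: "nat \<Rightarrow> 'k::field klr" where "psi a \<equiv> gen (Psi a)"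
abbreviation yy :: "nat \<Rightarrow> 'k::field klr" where "yy j \<equiv> gen (Y j)"
abbreviation ee :: "(nat \<Rightarrow> 'k) \<Rightarrow> 'k::field klr" where "ee i \<equiv> gen (E i)"

text \<open>The relations shared by the two algebras, which differ in the action \<open>act\<close> on tuples
  (through the generator with index 0).\<close>

inductive common_rel ::
  "(nat \<Rightarrow> (nat \<Rightarrow> 'k) \<Rightarrow> nat \<Rightarrow> 'k) \<Rightarrow> nat \<Rightarrow> 'k \<Rightarrow> (nat \<Rightarrow> 'k) set
    \<Rightarrow> 'k::field klr \<Rightarrow> 'k klr \<Rightarrow> bool"
  for act :: "nat \<Rightarrow> (nat \<Rightarrow> 'k) \<Rightarrow> nat \<Rightarrow> 'k" and n :: nat and q :: 'k and \<beta> :: "(nat \<Rightarrow> 'k) set"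
where
  sum_e: "common_rel act n q \<beta> (\<Sum>i\<in>\<beta>. ee i) 1"
| e_e: "\<lbrakk>i \<in> \<beta>; j \<in> \<beta>\<rbrakk> \<Longrightarrow>
    common_rel act n q \<beta> (ee i * ee j) (if i = j then ee i else 0)"
| y_y: "\<lbrakk>j \<in> {1..n}; k \<in> {1..n}\<rbrakk> \<Longrightarrow>
    common_rel act n q \<beta> (yy j * yy k) (yy k * yy j)"
| y_e: "\<lbrakk>j \<in> {1..n}; i \<in> \<beta>\<rbrakk> \<Longrightarrow>
    common_rel act n q \<beta> (yy j * ee i) (ee i * yy j)"
| psi_e: "\<lbrakk>a \<in> {0..<n}; i \<in> \<beta>\<rbrakk> \<Longrightarrow>
    common_rel act n q \<beta> (psi a * ee i) (ee (act a i) * psi a)"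
| psi_psi: "\<lbrakk>b \<in> {1..<n}; b' \<in> {1..<n}; \<bar>int b - int b'\<bar> > 1\<rbrakk> \<Longrightarrow>
    common_rel act n q \<beta> (psi b * psi b') (psi b' * psi b)"
| psi_y: "\<lbrakk>b \<in> {1..<n}; j \<in> {1..n}; i \<in> \<beta>\<rbrakk> \<Longrightarrow>
    common_rel act n q \<beta> ((psi b * yy j - yy (transpose b (b + 1) j) * psi b) * ee i)
      (if j = b \<and> i b = i (b + 1) then - ee i
       else if j = b + 1 \<and> i b = i (b + 1) then ee i
       else 0)"
| psi_sq_eq: "\<lbrakk>b \<in> {1..<n}; i \<in> \<beta>; i b = i (b + 1)\<rbrakk> \<Longrightarrow>
    common_rel act n q \<beta> (psi b ^ 2 * ee i) 0"
| psi_sq_no_edge: "\<lbrakk>b \<in> {1..<n}; i \<in> \<beta>; no_edge q (i b) (i (b + 1))\<rbrakk> \<Longrightarrow>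
    common_rel act n q \<beta> (psi b ^ 2 * ee i) (ee i)"
| psi_sq_right: "\<lbrakk>b \<in> {1..<n}; i \<in> \<beta>; edge_right q (i b) (i (b + 1))\<rbrakk> \<Longrightarrow>
    common_rel act n q \<beta> (psi b ^ 2 * ee i) ((yy (b + 1) - yy b) * ee i)"
| psi_sq_left: "\<lbrakk>b \<in> {1..<n}; i \<in> \<beta>; edge_left q (i b) (i (b + 1))\<rbrakk> \<Longrightarrow>
    common_rel act n q \<beta> (psi b ^ 2 * ee i) ((yy b - yy (b + 1)) * ee i)"
| psi_sq_both: "\<lbrakk>b \<in> {1..<n}; i \<in> \<beta>; edge_both q (i b) (i (b + 1))\<rbrakk> \<Longrightarrow>
    common_rel act n q \<beta> (psi b ^ 2 * ee i) ((yy (b + 1) - yy b) * (yy b - yy (b + 1)) * ee i)"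
| psi_braid: "\<lbrakk>b \<in> {1..<n}; b + 1 \<in> {1..<n}; i \<in> \<beta>\<rbrakk> \<Longrightarrow>
    common_rel act n q \<beta>
      ((psi b * psi (b + 1) * psi b - psi (b + 1) * psi b * psi (b + 1)) * ee i)
      (if i b = i (b + 2) \<and> edge_right q (i b) (i (b + 1)) then ee i
       else if i b = i (b + 2) \<and> edge_left q (i b) (i (b + 1)) then - ee i
       else if i b = i (b + 2) \<and> edge_both q (i b) (i (b + 1))
         then (yy (b + 2) - 2 * yy (b + 1) + yy b) * ee i
       else 0)"

inductive V_rel ::
  "nat \<Rightarrow> 'k \<Rightarrow> (nat \<Rightarrow> 'k) set \<Rightarrow> 'k::field klr \<Rightarrow> 'k klr \<Rightarrow> bool"
  for n :: nat and q :: 'k and \<beta> :: "(nat \<Rightarrow> 'k) set"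
where
  common: "common_rel actB n q \<beta> l r \<Longrightarrow> V_rel n q \<beta> l r"
| psi0_psi: "\<lbrakk>b \<in> {1..<n}; b > 1\<rbrakk> \<Longrightarrow> V_rel n q \<beta> (psi 0 * psi b) (psi b * psi 0)"
| psi0_y1: "V_rel n q \<beta> (psi 0 * yy 1 + yy 1 * psi 0) 0"
| psi0_y: "\<lbrakk>j \<in> {1..n}; j > 1\<rbrakk> \<Longrightarrow> V_rel n q \<beta> (psi 0 * yy j) (yy j * psi 0)"
| psi0_sq: "V_rel n q \<beta> (psi 0 ^ 2) 1"
| psi0_braid: "V_rel n q \<beta> ((psi 0 * psi 1) ^ 2) ((psi 1 * psi 0) ^ 2)"

inductive W_rel ::
  "nat \<Rightarrow> 'k \<Rightarrow> (nat \<Rightarrow> 'k) set \<Rightarrow> 'k::field klr \<Rightarrow> 'k klr \<Rightarrow> bool"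
  for n :: nat and q :: 'k and \<beta> :: "(nat \<Rightarrow> 'k) set"
where
  common: "common_rel actD n q \<beta> l r \<Longrightarrow> W_rel n q \<beta> l r"
| psi0_y: "\<lbrakk>j \<in> {1..n}; i \<in> \<beta>\<rbrakk> \<Longrightarrow>
    W_rel n q \<beta> (psi 0 * yy j * ee i)
      (if j \<in> {1, 2} \<and> inverse (i 1) = i 2 then (- yy (transpose 1 2 j) * psi 0 + 1) * ee i
       else if j \<in> {1, 2} \<and> inverse (i 1) \<noteq> i 2 then - yy (transpose 1 2 j) * psi 0 * ee i
       else yy j * psi 0 * ee i)"
| psi0_psi: "\<lbrakk>b \<in> {1..<n}; b = 1 \<or> b > 2\<rbrakk> \<Longrightarrow> W_rel n q \<beta> (psi 0 * psi b) (psi b * psi 0)"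
| psi0_sq_eq: "\<lbrakk>i \<in> \<beta>; inverse (i 1) = i 2\<rbrakk> \<Longrightarrow>
    W_rel n q \<beta> (psi 0 ^ 2 * ee i) 0"
| psi0_sq_no_edge: "\<lbrakk>i \<in> \<beta>; no_edge q (inverse (i 1)) (i 2)\<rbrakk> \<Longrightarrow>
    W_rel n q \<beta> (psi 0 ^ 2 * ee i) (ee i)"
| psi0_sq_right: "\<lbrakk>i \<in> \<beta>; edge_right q (inverse (i 1)) (i 2)\<rbrakk> \<Longrightarrow>
    W_rel n q \<beta> (psi 0 ^ 2 * ee i) ((yy 1 + yy 2) * ee i)"
| psi0_sq_left: "\<lbrakk>i \<in> \<beta>; edge_left q (inverse (i 1)) (i 2)\<rbrakk> \<Longrightarrow>
    W_rel n q \<beta> (psi 0 ^ 2 * ee i) (- (yy 1 + yy 2) * ee i)"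
| psi0_sq_both: "\<lbrakk>i \<in> \<beta>; edge_both q (inverse (i 1)) (i 2)\<rbrakk> \<Longrightarrow>
    W_rel n q \<beta> (psi 0 ^ 2 * ee i) (- ((yy 1 + yy 2) ^ 2) * ee i)"
| psi0_braid: "\<lbrakk>2 \<in> {1..<n}; i \<in> \<beta>\<rbrakk> \<Longrightarrow>
    W_rel n q \<beta> ((psi 0 * psi 2 * psi 0 - psi 2 * psi 0 * psi 2) * ee i)
      (if inverse (i 1) = i 3 \<and> edge_right q (inverse (i 1)) (i 2) then ee i
       else if inverse (i 1) = i 3 \<and> edge_left q (inverse (i 1)) (i 2) then - ee i
       else if inverse (i 1) = i 3 \<and> edge_both q (inverse (i 1)) (i 2)
         then (yy 3 - 2 * yy 2 - yy 1) * ee i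
       else 0)"

definition V_alg :: "nat \<Rightarrow> 'k::field \<Rightarrow> (nat \<Rightarrow> 'k) set \<Rightarrow> ('k, 'k klr set) module"
  where "V_alg n q \<beta> = presented_alg (klr_gens n \<beta>) (V_rel n q \<beta>)"

definition W_alg :: "nat \<Rightarrow> 'k::field \<Rightarrow> (nat \<Rightarrow> 'k) set \<Rightarrow> ('k, 'k klr set) module"
  where "W_alg n q \<beta> = presented_alg (klr_gens n \<beta>) (W_rel n q \<beta>)"

text \<open>An element of \<open>V\<close> is a coset, and \<open>rho\<close> takes its image under the automorphism of the free
  algebra with $\psi_0 \mapsto -\psi_0$ that fixes all other generators. The defining relations of
  \<open>V\<close> are preserved up to sign, so the image of the coset of \<open>p\<close> is the coset of
  \<open>rho_free p\<close>.\<close>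

definition rho_free :: "'k::field klr \<Rightarrow> 'k klr"
  where "rho_free = free_hom (\<lambda>g. if g = Psi 0 then - gen g else gen g)"

lemma rho_free_simps:
  "rho_free (p + r) = rho_free p + rho_free r" "rho_free (p * r) = rho_free p * rho_free r"
  "rho_free (scal c) = scal c" "rho_free (psi a) = (if a = 0 then - psi a else psi a)"
  "rho_free (yy j) = yy j" "rho_free (ee i) = ee i"
  by (simp_all add: rho_free_def free_hom_add free_hom_mult free_hom_scal)

definition rho :: "'k::field klr set \<Rightarrow> 'k klr set"
  where "rho X = rho_free ` X"

definition V_fixed :: "nat \<Rightarrow> 'k::field \<Rightarrow> (nat \<Rightarrow> 'k) set \<Rightarrow> ('k, 'k klr set) module"
  where "V_fixed n q \<beta> = (V_alg n q \<beta>) \<lparr>carrier := {x \<in> carrier (V_alg n q \<beta>). rho x = x}\<rparr>"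

definition W_basis ::
  "nat \<Rightarrow> 'k::field \<Rightarrow> (nat \<Rightarrow> 'k) set \<Rightarrow> ((int \<Rightarrow> int) \<Rightarrow> nat list) \<Rightarrow> 'k klr set set"
  where "W_basis n q \<beta> red =
    {cls (klr_gens n \<beta>) (W_rel n q \<beta>)
       (prod_list (map (\<lambda>j. yy j ^ m j) [1..<n + 1]) * prod_list (map psi (red w)) * ee i)
     | w m i. w \<in> weyl genD n \<and> i \<in> \<beta>}"

end

theory Submission
  imports Defs
begin

text \<open>Write $V$ and $W$ for the two algebras. Sending $\Psi_0$ to $\psi_0\psi_1\psi_0$ and every
  other generator of $W$ to its namesake defines a homomorphism \<open>phi\<close> from $W$ to $V$: as
  $\psi_0$ is an involution, conjugation by $\psi_0$ turns $\psi_1$ into the image of $\Psi_0$,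
  inverts $i_1$ and negates $y_1$, and it turns the relations for $\psi_1$ into the relations
  for $\Psi_0$ (\<open>phi_rel\<close>).

  The image $A$ of \<open>phi\<close> is stable under conjugation by $\psi_0$, so $A + A\psi_0$ is closed
  under left multiplication by all generators and equals $V$ (\<open>V_decomposition\<close>). The
  automorphism $\rho$ fixes $A$ and negates $A\psi_0$. As $2$ is invertible, the fixed points of
  $\rho$ are exactly $A$ (\<open>fixed_in_image\<close>).

  The set $\mathcal{D}$ spans $W$ (\<open>W_spanned\<close>). Filter $W$ by the number of letters $\Psi_a$.
  Modulo terms with fewer such letters, the $y_j$ and $e(\mathbf{i})$ move past the $\Psi_a$, the
  $\Psi_a$ satisfy the braid relations of type $D$, and their squares vanish. By Matsumoto's theorem
  (\<open>braid_equiv_reduced\<close>) two reduced words for one element therefore agree modulo lower terms,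
  and by the exchange condition a word that is not reduced is itself a lower term
  (\<open>nonreduced_low\<close>).

  The images of the elements of $\mathcal{D}$ under \<open>phi\<close> are linearly independent in $V$
  (\<open>basis_independent\<close>). To see this, $V$ acts on functions from $\beta$ to the field of
  rational functions in the $y_j$: $\psi_0$ acts by the substitution $y_1 \mapsto -y_1$, and
  $\psi_b$ acts by a divided difference or by a multiple of the exchange of $y_b$ and $y_{b+1}$
  (\<open>opr\<close>, \<open>act_V_rel\<close>). A product of $\psi_a$ along a reduced word of type $B$ acts by a nonzero
  multiple of the corresponding signed permutation of the variables, plus signed permutations of
  smaller length (\<open>opr_word_leading\<close>). Distinct signed permutations are distinct automorphisms of
  the field because $2 \neq 0$, so they are independent by Dedekind's theorem. This is where the
  reduced words are to stay reduced after $s_0$ is replaced by $r_0r_1r_0$.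

  Spanning in $W$ and independence of the images in $V$ together say that $\mathcal{D}$ is a basis
  of $W$ and that \<open>phi\<close> is injective (\<open>phi_injective\<close>), hence an isomorphism onto the fixed
  points of $\rho$.\<close>


section \<open>Reflections and roots of type D\<close>

text \<open>The vector $\varepsilon_k$ being encoded as the integer $k$, a root of type D is a sum of the
  vectors encoded by two nonzero integers \<open>x\<close> and \<open>y\<close> with \<open>x \<noteq> y\<close> and \<open>x \<noteq> - y\<close>. It is
  positive if and only if \<open>x + y > 0\<close>.\<close>

definition reflect :: "int \<Rightarrow> int \<Rightarrow> int \<Rightarrow> int"
  where "reflect x y = transpose x (- y) \<circ> transpose (- x) y"

lemma reflect_apply:
  assumes "x \<noteq> y" "x \<noteq> - y" "x \<noteq> 0" "y \<noteq> 0"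
  shows "reflect x y z = (if z = x then - y else if z = - y then x else if z = - x then y
    else if z = y then - x else z)"
  using assms by (auto simp: reflect_def transpose_def)

definition root_fst :: "nat \<Rightarrow> int"
  where "root_fst a = (if a = 0 then 1 else int a + 1)"

definition root_snd :: "nat \<Rightarrow> int"
  where "root_snd a = (if a = 0 then 2 else - int a)"

lemma simple_root: "root_fst a \<noteq> root_snd a" "root_fst a \<noteq> - root_snd a"
  "root_fst a \<noteq> 0" "root_snd a \<noteq> 0" "root_fst a + root_snd a > 0"
  by (auto simp: root_fst_def root_snd_def)

lemma genD_reflect: "genD a = reflect (root_fst a) (root_snd a)"
  by (cases "a = 0") (auto simp: genD_def genB_def reflect_def root_fst_def root_snd_def fun_eq_iff transpose_def)

lemma reflect_reflect: "\<lbrakk>x \<noteq> y; x \<noteq> - y; x \<noteq> 0; y \<noteq> 0\<rbrakk> \<Longrightarrow> reflect x y \<circ> reflect x y = id"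
  by (auto simp: fun_eq_iff reflect_apply)

lemma reflect_swap: "\<lbrakk>x \<noteq> y; x \<noteq> - y; x \<noteq> 0; y \<noteq> 0\<rbrakk> \<Longrightarrow> reflect y x = reflect x y"
  by (auto simp: fun_eq_iff reflect_apply)

lemma reflect_minus: "\<lbrakk>x \<noteq> y; x \<noteq> - y; x \<noteq> 0; y \<noteq> 0\<rbrakk> \<Longrightarrow> reflect (- x) (- y) = reflect x y"
  by (auto simp: fun_eq_iff reflect_apply)

definition signed_perm :: "(int \<Rightarrow> int) \<Rightarrow> bool"
  where "signed_perm w \<longleftrightarrow> inj w \<and> (\<forall>x. w (- x) = - w x)"

lemma signed_perm_comp: "\<lbrakk>signed_perm v; signed_perm w\<rbrakk> \<Longrightarrow> signed_perm (v \<circ> w)"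
  by (auto simp: signed_perm_def inj_compose)

lemma signed_perm_zero: "signed_perm w \<Longrightarrow> w x = 0 \<longleftrightarrow> x = 0"
  unfolding signed_perm_def inj_def by (metis add.inverse_neutral equal_neg_zero)

lemma signed_perm_eq: "signed_perm w \<Longrightarrow> w x = w y \<longleftrightarrow> x = y"
  by (auto simp: signed_perm_def inj_def)

lemma signed_perm_eq_minus: "signed_perm w \<Longrightarrow> w x = - w y \<longleftrightarrow> x = - y"
  unfolding signed_perm_def inj_def by metis

lemma reflect_conj:
  assumes w: "signed_perm w" and xy: "x \<noteq> y" "x \<noteq> - y" "x \<noteq> 0" "y \<noteq> 0"
  shows "w \<circ> reflect x y = reflect (w x) (w y) \<circ> w"
proof
  fix z
  have m: "w (- u) = - w u" for u using w by (simp add: signed_perm_def)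
  have "w x \<noteq> w y" "w x \<noteq> - w y" "w x \<noteq> 0" "w y \<noteq> 0"
    using xy by (simp_all add: signed_perm_eq[OF w] signed_perm_eq_minus[OF w] signed_perm_zero[OF w])
  then have R: "reflect (w x) (w y) u = (if u = w x then - w y else if u = - w y then w x
      else if u = - w x then w y else if u = w y then - w x else u)" for u
    by (rule reflect_apply)
  show "(w \<circ> reflect x y) z = (reflect (w x) (w y) \<circ> w) z"
    by (simp add: R reflect_apply[OF xy] signed_perm_eq[OF w] m[symmetric])
qed

lemma genD_invol: "genD a \<circ> genD a = id"
  unfolding genD_reflect using simple_root[of a] by (intro reflect_reflect) auto

lemma genD_invol_apply [simp]: "genD a (genD a x) = x"
  using genD_invol[of a] by (simp add: fun_eq_iff)

lemma signed_perm_genD: "signed_perm (genD a)"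
proof -
  have "inj (genD a)" by (metis genD_invol_apply injI)
  moreover have "genD a (- x) = - genD a x" for x
    unfolding genD_reflect using simple_root[of a] by (auto simp: reflect_apply)
  ultimately show ?thesis by (simp add: signed_perm_def)
qed

lemma genD_apply: "genD a z = (let x = root_fst a; y = root_snd a in
   if z = x then - y else if z = - y then x else if z = - x then y else if z = y then - x else z)"
  unfolding genD_reflect Let_def using simple_root[of a] by (intro reflect_apply) auto

text \<open>A simple reflection changes the height \<open>x + y\<close> of a root by a multiple of the height of its
  simple root. A case distinction over the four integers that it moves shows that it cannot carry the
  height of any other root across zero.\<close>

lemma only_simple_root_turns_negative:
  assumes "x \<noteq> y" "x \<noteq> - y" "x \<noteq> 0" "y \<noteq> 0" "x + y > 0" "genD a x + genD a y < 0"
  shows "{x, y} = {root_fst a, root_snd a}"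
  using assms
  by (auto simp: genD_apply Let_def root_fst_def root_snd_def split: if_splits)

lemma wprod_Nil [simp]: "wprod s [] = id"
  by (simp add: wprod_def)

lemma wprod_Cons [simp]: "wprod s (a # ws) = s a \<circ> wprod s ws"
  by (simp add: wprod_def)

lemma wprod_append [simp]: "wprod s (us @ vs) = wprod s us \<circ> wprod s vs"
  by (induction us) (simp_all add: comp_assoc)

lemma signed_perm_wprod: "signed_perm (wprod genD ws)"
proof (induction ws)
  case Nil show ?case by (simp add: signed_perm_def)
next
  case (Cons a ws) then show ?case unfolding wprod_Cons by (intro signed_perm_comp signed_perm_genD)
qed

lemma wprod_rev_left: "wprod genD (rev ws) (wprod genD ws x) = x"
  by (induction ws arbitrary: x) simp_all

lemma wprod_rev_right: "wprod genD ws (wprod genD (rev ws) x) = x"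
  using wprod_rev_left[of "rev ws"] by simp

lemma wprod_rev_cong: "wprod genD us = wprod genD vs \<Longrightarrow> wprod genD (rev us) = wprod genD (rev vs)"
  by (metis ext wprod_rev_left wprod_rev_right)

text \<open>Following a positive root through the letters of a word whose inverse makes it negative,
  the sign changes at some letter, and there the root is the simple root of that letter. So the
  reflection in the given root cancels that letter.\<close>

lemma reflection_cancels_letter:
  assumes "x \<noteq> y" "x \<noteq> - y" "x \<noteq> 0" "y \<noteq> 0" "x + y > 0"
    and "wprod genD (rev ws) x + wprod genD (rev ws) y < 0"
  shows "\<exists>us b vs. ws = us @ b # vs \<and> reflect x y \<circ> wprod genD ws = wprod genD (us @ vs)"
  using assms
proof (induction ws arbitrary: x y)
  case (Cons b ws)
  note xy = Cons.prems(1-4)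
  let ?x = "genD b x" and ?y = "genD b y"
  have s: "signed_perm (genD b)" by (rule signed_perm_genD)
  have ne: "?x \<noteq> ?y" "?x \<noteq> - ?y" "?x \<noteq> 0" "?y \<noteq> 0"
    using xy by (simp_all add: signed_perm_eq[OF s] signed_perm_eq_minus[OF s] signed_perm_zero[OF s])
  show ?case
  proof (cases "?x + ?y < 0")
    case True
    have "{x, y} = {root_fst b, root_snd b}"
      by (rule only_simple_root_turns_negative) (use Cons.prems True in auto)
    then have "reflect x y = genD b"
      using reflect_swap[OF xy] by (auto simp: genD_reflect doubleton_eq_iff)
    then have "reflect x y \<circ> wprod genD (b # ws) = wprod genD ([] @ ws)"
      by (simp add: fun_eq_iff)
    then show ?thesis by (metis append_Nil)
  next
    case False
    then have "?x + ?y > 0" using ne by linarith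
    moreover have "wprod genD (rev ws) ?x + wprod genD (rev ws) ?y < 0" using Cons.prems by simp
    ultimately obtain us c vs where ws: "ws = us @ c # vs"
      and eq: "reflect ?x ?y \<circ> wprod genD ws = wprod genD (us @ vs)"
      using Cons.IH[OF ne] by blast
    have "genD b \<circ> reflect ?x ?y = reflect x y \<circ> genD b"
      using reflect_conj[OF s ne] by simp
    then have "reflect x y \<circ> wprod genD (b # ws) = genD b \<circ> (reflect ?x ?y \<circ> wprod genD ws)"
      by (simp add: comp_assoc[symmetric])
    also have "\<dots> = wprod genD ((b # us) @ vs)" by (simp add: eq)
    finally show ?thesis using ws by (metis append_Cons)
  qed
qed simp


section \<open>Reduced words\<close>

definition reducedD :: "nat \<Rightarrow> nat list \<Rightarrow> bool"
  where "reducedD n ws \<longleftrightarrow> reduced_expr genD n (wprod genD ws) ws"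

lemma reducedD_iff: "reducedD n ws \<longleftrightarrow> set ws \<subseteq> {0..<n} \<and>
    (\<forall>vs. set vs \<subseteq> {0..<n} \<and> wprod genD vs = wprod genD ws \<longrightarrow> length ws \<le> length vs)"
  by (auto simp: reducedD_def reduced_expr_def)

lemma reducedD_cong:
  "\<lbrakk>reducedD n ws; set vs \<subseteq> {0..<n}; wprod genD vs = wprod genD ws; length vs = length ws\<rbrakk>
    \<Longrightarrow> reducedD n vs"
  by (simp add: reducedD_iff)

lemma reducedD_appendD:
  assumes "reducedD n (us @ vs)"
  shows "reducedD n us" "reducedD n vs"
proof -
  have "set (us @ vs) \<subseteq> {0..<n}" and min: "\<And>zs. set zs \<subseteq> {0..<n} \<Longrightarrow>
      wprod genD zs = wprod genD (us @ vs) \<Longrightarrow> length (us @ vs) \<le> length zs"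
    using assms by (auto simp: reducedD_iff)
  then have "length us \<le> length zs" if "set zs \<subseteq> {0..<n}" "wprod genD zs = wprod genD us" for zs
    using min[of "zs @ vs"] that by auto
  moreover have "length vs \<le> length zs" if "set zs \<subseteq> {0..<n}" "wprod genD zs = wprod genD vs" for zs
    using min[of "us @ zs"] that \<open>set (us @ vs) \<subseteq> {0..<n}\<close> by auto
  ultimately show "reducedD n us" "reducedD n vs"
    using \<open>set (us @ vs) \<subseteq> {0..<n}\<close> by (auto simp: reducedD_iff)
qed

lemma reducedD_ConsD: "reducedD n (a # ws) \<Longrightarrow> reducedD n ws"
  using reducedD_appendD(2)[of n "[a]" ws] by simp

lemma reducedD_length_eq:
  "\<lbrakk>reducedD n us; reducedD n vs; wprod genD us = wprod genD vs\<rbrakk> \<Longrightarrow> length us = length vs"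
  by (metis antisym reducedD_iff)

text \<open>If the word \<open>a # ws\<close> is not reduced, the inverse of \<open>wprod genD ws\<close> makes the simple root of
  \<open>a\<close> negative: otherwise that root would be made negative by the inverse of a word for
  \<open>a # ws\<close> that is no longer than \<open>ws\<close>, and cancelling a letter there would leave a word for
  \<open>wprod genD ws\<close> that is shorter than \<open>ws\<close>.\<close>

lemma exchange:
  assumes red: "reducedD n ws" and a: "a < n" and nonred: "\<not> reducedD n (a # ws)"
  obtains us b vs where "ws = us @ b # vs" "wprod genD (a # us @ vs) = wprod genD ws"
proof -
  let ?x = "root_fst a" and ?y = "root_snd a"
  note \<alpha> = simple_root[of a]
  let ?sum = "\<lambda>zs. wprod genD (rev zs) ?x + wprod genD (rev zs) ?y"
  have set: "set ws \<subseteq> {0..<n}" using red by (simp add: reducedD_iff)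
  have "?sum ws < 0"
  proof (rule ccontr)
    assume "\<not> ?sum ws < 0"
    moreover have "?sum ws \<noteq> 0"
      using signed_perm_eq_minus[OF signed_perm_wprod[of "rev ws"], of ?x ?y] \<alpha> by linarith
    ultimately have pos: "?sum ws > 0" by linarith
    obtain zs where zs: "set zs \<subseteq> {0..<n}" "wprod genD zs = wprod genD (a # ws)" "length zs \<le> length ws"
      using nonred set a by (auto simp: reducedD_iff not_le)
    have inv: "wprod genD (rev zs) = wprod genD (rev ws) \<circ> genD a"
      using wprod_rev_cong[OF zs(2)] by simp
    have "genD a ?x = - ?y" "genD a ?y = - ?x" using \<alpha> by (auto simp: genD_apply)
    moreover have "wprod genD (rev ws) (- z) = - wprod genD (rev ws) z" for z
      using signed_perm_wprod[of "rev ws"] by (simp add: signed_perm_def)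
    ultimately have "?sum zs < 0" using pos by (simp add: inv)
    then obtain us b vs where *: "zs = us @ b # vs" "genD a \<circ> wprod genD zs = wprod genD (us @ vs)"
      using reflection_cancels_letter[OF \<alpha>] by (metis genD_reflect)
    then have "wprod genD (us @ vs) = wprod genD ws"
      using zs(2) by (simp add: fun_eq_iff)
    moreover have "set (us @ vs) \<subseteq> {0..<n}" using zs * by auto
    ultimately have "length ws \<le> length (us @ vs)" using red unfolding reducedD_iff by blast
    then show False using zs(3) * by simp
  qed
  then obtain us b vs where *: "ws = us @ b # vs" "genD a \<circ> wprod genD ws = wprod genD (us @ vs)"
    using reflection_cancels_letter[OF \<alpha>] by (metis genD_reflect)
  have "wprod genD (a # us @ vs) = genD a \<circ> (genD a \<circ> wprod genD ws)"
    by (simp only: wprod_Cons *(2))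
  also have "\<dots> = wprod genD ws" by (simp add: fun_eq_iff)
  finally show thesis using that *(1) by blast
qed


section \<open>Braid moves connect reduced words\<close>

text \<open>The edges of the Dynkin diagram of type D.\<close>

definition adjD :: "nat \<Rightarrow> nat \<Rightarrow> bool"
  where "adjD a b \<longleftrightarrow> (1 \<le> a \<and> b = a + 1) \<or> (1 \<le> b \<and> a = b + 1) \<or> (a = 0 \<and> b = 2) \<or> (a = 2 \<and> b = 0)"

lemma adjD_sym: "adjD a b \<longleftrightarrow> adjD b a"
  by (auto simp: adjD_def)

lemma genD_conj: "genD a \<circ> genD b = reflect (genD a (root_fst b)) (genD a (root_snd b)) \<circ> genD a"
  using reflect_conj[OF signed_perm_genD[of a], of "root_fst b" "root_snd b"] simple_root[of b]
  by (simp add: genD_reflect)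

lemma genD_commute:
  assumes "a \<noteq> b" "\<not> adjD a b"
  shows "genD a \<circ> genD b = genD b \<circ> genD a"
proof -
  let ?x = "root_fst b" and ?y = "root_snd b"
  have "(a = 0 \<and> b = 1) \<or> (a = 1 \<and> b = 0) \<or> (a = 0 \<and> b \<ge> 3) \<or> (b = 0 \<and> a \<ge> 3)
    \<or> (a \<ge> 1 \<and> b \<ge> a + 2) \<or> (b \<ge> 1 \<and> a \<ge> b + 2)"
    using assms unfolding adjD_def by presburger
  then have "(genD a ?x = ?x \<and> genD a ?y = ?y) \<or> (genD a ?x = ?y \<and> genD a ?y = ?x)"
    by (elim disjE) (simp_all add: genD_apply Let_def root_fst_def root_snd_def)
  then have "reflect (genD a ?x) (genD a ?y) = reflect ?x ?y"
    using reflect_swap[of ?x ?y] simple_root[of b]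
    by (elim disjE conjE) simp_all
  then show ?thesis using genD_conj[of a b] by (simp add: genD_reflect[of b])
qed

lemma genD_braid:
  assumes "adjD a b"
  shows "genD a \<circ> genD b \<circ> genD a = genD b \<circ> genD a \<circ> genD b"
proof -
  let ?x = "root_fst b" and ?y = "root_snd b" and ?u = "root_fst a" and ?v = "root_snd a"
  have "(genD a ?x = genD b ?u \<and> genD a ?y = genD b ?v) \<or> (genD a ?x = genD b ?v \<and> genD a ?y = genD b ?u)
     \<or> (genD a ?x = - genD b ?u \<and> genD a ?y = - genD b ?v) \<or> (genD a ?x = - genD b ?v \<and> genD a ?y = - genD b ?u)"
    using assms by (auto simp: genD_apply Let_def root_fst_def root_snd_def adjD_def)
  moreover
  have s: "signed_perm (genD b)" by (rule signed_perm_genD)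
  have ne: "genD b ?u \<noteq> genD b ?v" "genD b ?u \<noteq> - genD b ?v" "genD b ?u \<noteq> 0" "genD b ?v \<noteq> 0"
    using simple_root[of a]
    by (simp_all add: signed_perm_eq[OF s] signed_perm_eq_minus[OF s] signed_perm_zero[OF s])
  ultimately have "reflect (genD a ?x) (genD a ?y) = reflect (genD b ?u) (genD b ?v)"
    using reflect_swap[of "genD b ?u" "genD b ?v"] reflect_minus[of "genD b ?u" "genD b ?v"]
      reflect_minus[of "genD b ?v" "genD b ?u"]
    by auto
  then have "reflect (genD a ?x) (genD a ?y) \<circ> genD a \<circ> genD a
      = reflect (genD b ?u) (genD b ?v) \<circ> genD b \<circ> genD b"
    by (simp add: comp_assoc genD_invol)
  then show ?thesis by (simp add: genD_conj[symmetric])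
qed

lemma genD_adj_not_commute:
  assumes "adjD a b"
  shows "genD a \<circ> genD b \<noteq> genD b \<circ> genD a"
proof
  assume "genD a \<circ> genD b = genD b \<circ> genD a"
  then have "genD a (genD b z) = genD b (genD a z)" for z by (simp add: fun_eq_iff)
  from this[of "root_fst a"] this[of "root_snd a"] this[of "root_fst b"] this[of "root_snd b"]
  show False
    using assms by (auto simp: genD_apply Let_def root_fst_def root_snd_def adjD_def)
qed

lemma genD_inject:
  assumes "genD a = genD b" shows "a = b"
proof -
  have "genD a z = genD b z" for z using assms by simp
  from this[of "root_fst a"] this[of "root_snd a"]
  show ?thesis
    by (cases "a = 0"; cases "b = 0")
      (auto simp: genD_apply Let_def root_fst_def root_snd_def split: if_splits)
qed

inductive braid_equiv :: "nat \<Rightarrow> nat list \<Rightarrow> nat list \<Rightarrow> bool" for n where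
  refl: "braid_equiv n us us"
| trans: "\<lbrakk>braid_equiv n us vs; braid_equiv n vs ws\<rbrakk> \<Longrightarrow> braid_equiv n us ws"
| in_context: "braid_equiv n us vs \<Longrightarrow> set xs \<union> set ys \<subseteq> {0..<n} \<Longrightarrow> braid_equiv n (xs @ us @ ys) (xs @ vs @ ys)"
| comm: "\<lbrakk>a < n; b < n; a \<noteq> b; \<not> adjD a b\<rbrakk> \<Longrightarrow> braid_equiv n [a, b] [b, a]"
| braid: "\<lbrakk>a < n; b < n; adjD a b\<rbrakk> \<Longrightarrow> braid_equiv n [a, b, a] [b, a, b]"

lemma braid_equiv_sym: "braid_equiv n us vs \<Longrightarrow> braid_equiv n vs us"
  by (induction rule: braid_equiv.induct) (auto intro: braid_equiv.intros simp: adjD_sym)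

lemma braid_equiv_Cons: "\<lbrakk>braid_equiv n us vs; a < n\<rbrakk> \<Longrightarrow> braid_equiv n (a # us) (a # vs)"
  using braid_equiv.in_context[of n us vs "[a]" "[]"] by simp

lemma braid_equiv_snoc: "\<lbrakk>braid_equiv n us vs; a < n\<rbrakk> \<Longrightarrow> braid_equiv n (us @ [a]) (vs @ [a])"
  using braid_equiv.in_context[of n us vs "[]" "[a]"] by simp

fun alternating :: "nat \<Rightarrow> nat \<Rightarrow> nat \<Rightarrow> nat list" where
  "alternating x y 0 = []"
| "alternating x y (Suc k) = x # alternating y x k"

lemma length_alternating [simp]: "length (alternating x y k) = k"
  by (induction k arbitrary: x y) auto

text \<open>Two generators of type D generate a dihedral group of order 4 or 6, so equal reduced
  alternating words are the two sides of a braid relation.\<close>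

lemma braid_equiv_alternating:
  assumes "x \<noteq> y" "x < n" "y < n" "k \<ge> 1"
    and red: "reducedD n (alternating x y k)"
    and eq: "wprod genD (alternating x y k) = wprod genD (alternating y x k)"
  shows "braid_equiv n (alternating x y k) (alternating y x k)"
proof -
  have short: "length us \<le> length vs" if "alternating x y k = us @ zs" "set vs \<subseteq> {x, y}"
      "wprod genD vs = wprod genD us" for us vs zs
  proof -
    have "reducedD n us" using red that(1) reducedD_appendD by metis
    moreover have "set vs \<subseteq> {0..<n}" using that(2) assms(2,3) by auto
    ultimately show ?thesis using that(3) unfolding reducedD_iff by blast
  qed
  consider "k = 1" | "k = 2" | "k = 3" | l where "k = Suc (Suc (Suc (Suc l)))"
    using assms(4) by (metis One_nat_def Suc_1 not0_implies_Suc not_one_le_zero numeral_3_eq_3)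
  then show ?thesis
  proof cases
    case 1 then show ?thesis using eq genD_inject[of x y] assms(1) by simp
  next
    case 2
    then have "genD x \<circ> genD y = genD y \<circ> genD x" using eq by (simp add: numeral_2_eq_2)
    then have "\<not> adjD x y" using genD_adj_not_commute[of x y] by blast
    then show ?thesis using 2 assms by (simp add: numeral_2_eq_2 braid_equiv.comm)
  next
    case 3
    show ?thesis
    proof (cases "adjD x y")
      case True then show ?thesis using 3 assms by (simp add: numeral_3_eq_3 braid_equiv.braid)
    next
      case False
      then have "genD x (genD y z) = genD y (genD x z)" for z
        using genD_commute[OF assms(1)] by (simp add: fun_eq_iff)
      then have "wprod genD [y] = wprod genD [x, y, x]" by (simp add: fun_eq_iff)
      then show ?thesis using short[of "[x, y, x]" "[]" "[y]"] 3 by (simp add: numeral_3_eq_3)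
    qed
  next
    case 4
    then have alt: "alternating x y k = [x, y, x, y] @ alternating x y l" by simp
    show ?thesis
    proof (cases "adjD x y")
      case True
      then have "genD x (genD y (genD x z)) = genD y (genD x (genD y z))" for z
        using genD_braid[OF True] by (simp add: fun_eq_iff)
      then have "wprod genD [y, x] = wprod genD [x, y, x, y]" by (simp add: fun_eq_iff)
      then show ?thesis using short[OF alt, of "[y, x]"] by simp
    next
      case False
      then have "genD x (genD y z) = genD y (genD x z)" for z
        using genD_commute[OF assms(1)] by (simp add: fun_eq_iff)
      then have "wprod genD [] = wprod genD [x, y, x, y]" by (simp add: fun_eq_iff)
      then show ?thesis using short[OF alt, of "[]"] by simp
    qed
  qed
qed

text \<open>Matsumoto's theorem. Two reduced words for one element with distinct first letters are
  compared by exchanging their first letters in turn at the front of one of them. As long as the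
  exchange drops a letter other than the last one, words with a common last letter are compared and
  the induction on the length applies; otherwise an alternating prefix grows until it is the whole
  word.\<close>

theorem braid_equiv_reduced:
  assumes "reducedD n us" "reducedD n vs" "wprod genD us = wprod genD vs"
  shows "braid_equiv n us vs"
  using assms
proof (induction "length us" arbitrary: us vs rule: less_induct)
  case less
  define k where "k = length us"
  have IH: "braid_equiv n ps qs" if "length ps < k" "reducedD n ps" "reducedD n qs"
      "wprod genD ps = wprod genD qs" for ps qs
    using less.hyps that by (simp add: k_def)
  have first: "braid_equiv n (a # ps) (a # qs)" if "length (a # ps) = k" "reducedD n (a # ps)"
     "reducedD n (a # qs)" "wprod genD (a # ps) = wprod genD (a # qs)" for a ps qs
  proof -
    have "wprod genD ps = wprod genD qs" using that(4) signed_perm_genD[of a]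
      by (auto simp: fun_eq_iff signed_perm_eq)
    then have "braid_equiv n ps qs" using that by (intro IH) (auto dest: reducedD_ConsD)
    then show ?thesis using that by (intro braid_equiv_Cons) (auto simp: reducedD_iff)
  qed
  have last: "braid_equiv n (ps @ [a]) (qs @ [a])" if "length (ps @ [a]) = k" "reducedD n (ps @ [a])"
     "reducedD n (qs @ [a])" "wprod genD (ps @ [a]) = wprod genD (qs @ [a])" for a ps qs
  proof -
    have "wprod genD ps (genD a z) = wprod genD qs (genD a z)" for z
      using that(4) by (simp add: fun_eq_iff)
    then have "wprod genD ps = wprod genD qs" by (metis ext genD_invol_apply)
    then have "braid_equiv n ps qs" using that by (intro IH) (auto dest: reducedD_appendD)
    then show ?thesis using that by (intro braid_equiv_snoc) (auto simp: reducedD_iff)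
  qed
  have key: "braid_equiv n (alternating x y j @ zs) (y # qs)"
    if "x \<noteq> y" "j \<ge> 1" "reducedD n (alternating x y j @ zs)" "reducedD n (y # qs)"
      "wprod genD (alternating x y j @ zs) = wprod genD (y # qs)" "j + length zs = k"
    for x y j zs qs
    using that
  proof (induction "length zs" arbitrary: x y j zs qs rule: less_induct)
    case (less zs x y j qs)
    define p where "p = alternating x y j @ zs"
    have red_p: "reducedD n p" and red_q: "reducedD n (y # qs)" and eq: "wprod genD p = wprod genD (y # qs)"
      using less.prems by (simp_all add: p_def)
    have len_p: "length p = k" using less.prems by (simp add: p_def)
    have xn: "x < n" and yn: "y < n" using less.prems by (auto simp: reducedD_iff neq0_conv gr0_conv_Suc Suc_le_eq)
    have len_q: "length (y # qs) = k" using reducedD_length_eq[OF red_p red_q eq] len_p by simp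
    have "wprod genD (y # p) = wprod genD qs" using eq by (simp add: fun_eq_iff)
    then have "\<not> reducedD n (y # p)"
      using len_p len_q red_q by (auto simp: reducedD_iff)
    then obtain us b vs where p_eq: "p = us @ b # vs" and "wprod genD (y # us @ vs) = wprod genD p"
      using exchange[OF red_p yn] by metis
    define p' where "p' = y # us @ vs"
    have eq': "wprod genD p' = wprod genD p" unfolding p'_def by fact
    have len': "length p' = k" using len_p by (simp add: p'_def p_eq)
    have red': "reducedD n p'"
      by (rule reducedD_cong[OF red_p _ eq']) (use red_p yn len' len_p in \<open>auto simp: reducedD_iff p'_def p_eq\<close>)
    have p'_q: "braid_equiv n p' (y # qs)"
      unfolding p'_def by (rule first) (use red' red_q eq eq' len' in \<open>simp_all add: p'_def\<close>)
    have "braid_equiv n p p'"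
    proof (cases "vs = []")
      case False
      then obtain vs' c where vs: "vs = vs' @ [c]" by (metis rev_exhaust)
      have "p = (us @ b # vs') @ [c]" "p' = (y # us @ vs') @ [c]" by (simp_all add: p_eq p'_def vs)
      then show ?thesis using last[of "us @ b # vs'" c "y # us @ vs'"] red_p red' eq' len_p by metis
    next
      case vs: True
      show ?thesis
      proof (cases zs rule: rev_exhaust)
        case Nil
        obtain j' where j': "j = Suc j'" using less.prems by (metis not0_implies_Suc not_one_le_zero)
        have snoc: "\<exists>c. alternating u v (Suc i) = alternating u v i @ [c]" for u v i
          by (induction i arbitrary: u v) auto
        obtain c where "alternating x y j = alternating x y j' @ [c]" using snoc j' by metis
        then have "us = alternating x y j'" using p_eq vs Nil by (simp add: p_def)
        then have p': "p' = alternating y x j" by (simp add: p'_def vs j')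
        have p: "p = alternating x y j" by (simp add: p_def Nil)
        show ?thesis unfolding p p'
          by (rule braid_equiv_alternating) (use less.prems xn yn red_p eq' p p' in auto)
      next
        case (snoc zs' c)
        then have "us = alternating x y j @ zs'" using p_eq vs by (simp add: p_def)
        then have p': "p' = alternating y x (Suc j) @ zs'" by (simp add: p'_def vs)
        obtain ps where ps: "p = x # ps"
          using less.prems by (cases j) (auto simp: p_def)
        have "braid_equiv n (alternating y x (Suc j) @ zs') (x # ps)"
          by (rule less.hyps) (use snoc less.prems red' red_p eq' ps in \<open>auto simp: p' simp del: alternating.simps\<close>)
        then show ?thesis using p' ps braid_equiv_sym by metis
      qed
    qed
    then show ?case using p'_q braid_equiv.trans p_def by metis
  qed
  show ?case
  proof (cases us)
    case Nil
    then have "vs = []" using reducedD_length_eq less.prems by (metis length_0_conv)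
    then show ?thesis using Nil by (simp add: braid_equiv.refl)
  next
    case (Cons a us')
    then obtain b vs' where vs: "vs = b # vs'"
      using reducedD_length_eq less.prems by (metis length_Suc_conv length_Cons)
    show ?thesis
    proof (cases "a = b")
      case True then show ?thesis using first[of a us' vs'] less.prems Cons vs by (simp add: k_def)
    next
      case False
      then show ?thesis using key[of a b 1 us' vs'] less.prems Cons vs by (simp add: k_def)
    qed
  qed
qed


section \<open>Working modulo the relations of a presented algebra\<close>

text \<open>The two-sided ideal generated by the relations in the whole free algebra, without
  restricting the letters. It meets the subalgebra on the generators in the ideal generated there
  (\<open>rel_ideal_eq\<close> below), and calculations modulo this larger ideal carry no side conditions.\<close>

inductive_set rel_span ::
  "(('g, 'k::field) falg \<Rightarrow> ('g, 'k) falg \<Rightarrow> bool) \<Rightarrow> ('g, 'k) falg set" for rel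
where
  zero: "0 \<in> rel_span rel"
| add: "\<lbrakk>p \<in> rel_span rel; r \<in> rel_span rel\<rbrakk> \<Longrightarrow> p + r \<in> rel_span rel"
| rel: "rel l r \<Longrightarrow> a * (l - r) * b \<in> rel_span rel"

lemma rel_span_mult_left: "p \<in> rel_span rel \<Longrightarrow> a * p \<in> rel_span rel"
  by (induction rule: rel_span.induct)
    (auto simp: distrib_left mult.assoc[symmetric] intro: rel_span.intros)

lemma rel_span_mult_right: "p \<in> rel_span rel \<Longrightarrow> p * a \<in> rel_span rel"
  by (induction rule: rel_span.induct)
    (auto simp: distrib_right mult.assoc intro: rel_span.intros rel_span.rel[unfolded mult.assoc])

lemma rel_span_uminus: "p \<in> rel_span rel \<Longrightarrow> - p \<in> rel_span rel"
  using rel_span_mult_left[of p rel "- 1"] by simp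

definition equ :: "(('g, 'k::field) falg \<Rightarrow> ('g, 'k) falg \<Rightarrow> bool) \<Rightarrow> ('g, 'k) falg \<Rightarrow> ('g, 'k) falg \<Rightarrow> bool"
  where "equ rel p r \<longleftrightarrow> p - r \<in> rel_span rel"

lemma equ_refl [simp, intro]: "equ rel p p"
  by (simp add: equ_def rel_span.zero)

lemma equ_rel: "rel l r \<Longrightarrow> equ rel l r"
  using rel_span.rel[of rel l r 1 1] by (simp add: equ_def)

lemma equ_sym: "equ rel p r \<Longrightarrow> equ rel r p"
  unfolding equ_def using rel_span_uminus by fastforce

lemma equ_trans [trans]: "\<lbrakk>equ rel p r; equ rel r s\<rbrakk> \<Longrightarrow> equ rel p s"
  unfolding equ_def using rel_span.add[of "p - r" rel "r - s"] by simp

lemma equ_add: "\<lbrakk>equ rel p r; equ rel p' r'\<rbrakk> \<Longrightarrow> equ rel (p + p') (r + r')"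
  unfolding equ_def using rel_span.add[of "p - r" rel "p' - r'"] by (simp add: algebra_simps)

lemma equ_uminus: "equ rel p r \<Longrightarrow> equ rel (- p) (- r)"
  unfolding equ_def using rel_span_uminus[of "p - r" rel] by simp

lemma equ_diff: "\<lbrakk>equ rel p r; equ rel p' r'\<rbrakk> \<Longrightarrow> equ rel (p - p') (r - r')"
  using equ_add[of rel p r "- p'" "- r'"] equ_uminus[of rel p' r'] by simp

lemma equ_mult_left: "equ rel p r \<Longrightarrow> equ rel (a * p) (a * r)"
  unfolding equ_def using rel_span_mult_left[of "p - r" rel a] by (simp add: algebra_simps)

lemma equ_mult_right: "equ rel p r \<Longrightarrow> equ rel (p * a) (r * a)"
  unfolding equ_def using rel_span_mult_right[of "p - r" rel a] by (simp add: algebra_simps)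

lemma equ_mult: "\<lbrakk>equ rel p r; equ rel p' r'\<rbrakk> \<Longrightarrow> equ rel (p * p') (r * r')"
  by (meson equ_mult_left equ_mult_right equ_trans)

lemma equ_diff_zero: "equ rel p r \<longleftrightarrow> equ rel (p - r) 0"
  by (simp add: equ_def)

lemma equ_by_eq: "\<lbrakk>equ rel p r; x - y = p - r\<rbrakk> \<Longrightarrow> equ rel x y"
  by (simp add: equ_def)

lemma equ_by_minus: "\<lbrakk>equ rel p r; x - y = r - p\<rbrakk> \<Longrightarrow> equ rel x y"
  using equ_by_eq equ_sym by blast

definition falg_on :: "'g set \<Rightarrow> ('g, 'k::field) falg set"
  where "falg_on G = {p. \<forall>w\<in>Poly_Mapping.keys p. set (letters w) \<subseteq> G}"

lemma falg_on_single: "set (letters w) \<subseteq> G \<Longrightarrow> Poly_Mapping.single w c \<in> falg_on G"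
  by (simp add: falg_on_def)

lemma falg_on_0 [intro, simp]: "0 \<in> falg_on G"
  by (simp add: falg_on_def)

lemma falg_on_1 [intro, simp]: "1 \<in> falg_on G"
  by (simp add: falg_on_def)

lemma falg_on_gen [intro, simp]: "g \<in> G \<Longrightarrow> gen g \<in> falg_on G"
  by (simp add: gen_def falg_on_single)

lemma falg_on_scal [intro, simp]: "scal c \<in> falg_on G"
  by (simp add: scal_def falg_on_single)

lemma falg_on_add [intro]: "\<lbrakk>p \<in> falg_on G; r \<in> falg_on G\<rbrakk> \<Longrightarrow> p + r \<in> falg_on G"
  unfolding falg_on_def using keys_add[of p r] by blast

lemma falg_on_mult [intro]:
  assumes "p \<in> falg_on G" "r \<in> falg_on G" shows "p * r \<in> falg_on G"
  unfolding falg_on_def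
proof (clarify)
  fix w x assume "w \<in> Poly_Mapping.keys (p * r)" "x \<in> set (letters w)"
  moreover obtain u v where "w = u + v" "u \<in> Poly_Mapping.keys p" "v \<in> Poly_Mapping.keys r"
    using keys_mult[of p r] calculation by blast
  ultimately show "x \<in> G" using assms by (auto simp: falg_on_def)
qed

lemma falg_on_uminus [intro]: "p \<in> falg_on G \<Longrightarrow> - p \<in> falg_on G"
  using falg_on_mult[OF falg_on_scal[of "- 1"], of p] by (simp add: scal_def single_uminus)

lemma falg_on_diff [intro]: "\<lbrakk>p \<in> falg_on G; r \<in> falg_on G\<rbrakk> \<Longrightarrow> p - r \<in> falg_on G"
  using falg_on_add[of p G "- r"] by auto

lemma falg_on_sum [intro]: "(\<And>x. x \<in> A \<Longrightarrow> f x \<in> falg_on G) \<Longrightarrow> sum f A \<in> falg_on G"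
  by (induction A rule: infinite_finite_induct) auto

lemma falg_on_power [intro]: "p \<in> falg_on G \<Longrightarrow> p ^ m \<in> falg_on G"
  by (induction m) auto

lemma falg_on_prod_list [intro]: "(\<And>x. x \<in> set xs \<Longrightarrow> x \<in> falg_on G) \<Longrightarrow> prod_list xs \<in> falg_on G"
  by (induction xs) auto

lemma falg_on_2 [intro, simp]: "2 \<in> falg_on G"
  using falg_on_add[OF falg_on_1 falg_on_1] by simp

lemma scal_1: "scal 1 = 1"
  by (simp add: scal_def)

lemma scal_0: "scal 0 = 0"
  by (simp add: scal_def)

lemma single_word: "Poly_Mapping.single w (c :: 'k::field) = scal c * prod_list (map gen (letters w))"
proof -
  have "prod_list (map gen u) = Poly_Mapping.single (FMon u) (1 :: 'k)" for u :: "'a list"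
    by (induction u) (simp_all add: gen_def mult_single plus_FMon zero_fmon_def flip: single_one)
  from this[of "letters w"] show ?thesis by (simp add: scal_def mult_single)
qed

lemma falg_on_induct [consumes 1, case_names zero word add]:
  assumes "p \<in> falg_on G" "P 0"
    and "\<And>u c. set u \<subseteq> G \<Longrightarrow> P (scal c * prod_list (map gen u))"
    and "\<And>p r. \<lbrakk>P p; P r\<rbrakk> \<Longrightarrow> P (p + r)"
  shows "P p"
proof -
  have *: "P (\<Sum>w\<in>S. Poly_Mapping.single w (Poly_Mapping.lookup p w))"
    if "finite S" "S \<subseteq> Poly_Mapping.keys p" for S
    using that by (induction S) (use assms in \<open>auto simp: single_word falg_on_def\<close>)
  have "p = (\<Sum>w\<in>Poly_Mapping.keys p. Poly_Mapping.single w (Poly_Mapping.lookup p w))"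
    by (rule poly_mapping_eqI) (simp add: lookup_sum lookup_single when_def in_keys_iff)
  then show ?thesis using *[of "Poly_Mapping.keys p"] by simp
qed

lemma free_hom_prod_list: "free_hom f (prod_list xs) = prod_list (map (free_hom f) xs)"
  by (induction xs) (simp_all add: free_hom_one free_hom_mult)

lemma free_hom_word: "free_hom f (prod_list (map gen u)) = prod_list (map f u)"
  by (simp add: free_hom_prod_list o_def)

lemma free_hom_closed:
  assumes "p \<in> falg_on G" "\<And>g. g \<in> G \<Longrightarrow> f g \<in> falg_on H"
  shows "free_hom f p \<in> falg_on H"
  using assms(1)
  by (induction rule: falg_on_induct)
    (auto simp: free_hom_zero free_hom_add free_hom_mult free_hom_scal free_hom_word
      intro!: falg_on_mult falg_on_prod_list assms(2))

lemma free_hom_cong_on: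
  assumes "p \<in> falg_on G" "\<And>g. g \<in> G \<Longrightarrow> f g = f' g"
  shows "free_hom f p = free_hom f' p"
  using assms(1)
proof (induction rule: falg_on_induct)
  case (word u c)
  then have "map f u = map f' u" using assms(2) by auto
  then show ?case by (simp only: free_hom_mult free_hom_scal free_hom_word)
qed (simp_all add: free_hom_zero free_hom_add)

lemma free_hom_ident: "free_hom gen p = p"
  by (induction p rule: falg_induct)
    (simp_all add: free_hom_zero free_hom_add free_hom_single single_word[symmetric])

lemma free_hom_sum: "free_hom f (sum g A) = (\<Sum>x\<in>A. free_hom f (g x))"
  by (induction A rule: infinite_finite_induct) (simp_all add: free_hom_zero free_hom_add)

lemma free_hom_rel_span:
  assumes "p \<in> rel_span rel" "\<And>l r. rel l r \<Longrightarrow> equ rel' (free_hom f l) (free_hom f r)"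
  shows "free_hom f p \<in> rel_span rel'"
  using assms(1)
  by (induction rule: rel_span.induct)
    (use assms(2) in \<open>auto simp: free_hom_zero free_hom_add free_hom_mult free_hom_diff equ_def
      intro: rel_span.intros rel_span_mult_left rel_span_mult_right\<close>)

lemma free_hom_equ:
  assumes "equ rel p r" "\<And>l r. rel l r \<Longrightarrow> equ rel' (free_hom f l) (free_hom f r)"
  shows "equ rel' (free_hom f p) (free_hom f r)"
  using free_hom_rel_span[of "p - r" rel rel' f] assms by (simp add: equ_def free_hom_diff)

lemma free_alg_simps [simp]:
  "carrier (free_alg G) = falg_on G" "monoid.mult (free_alg G) = (*)" "one (free_alg G) = 1"
  "zero (free_alg G) = 0" "add (free_alg G) = (+)"
  by (simp_all add: free_alg_def falg_on_def)

lemma ring_free_alg: "ring (free_alg G)"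
proof (rule ringI)
  show "abelian_group (free_alg G)"
    by (rule abelian_groupI) (auto simp: algebra_simps intro: falg_on_uminus bexI[of _ "- x" for x])
  show "monoid (free_alg G)"
    by (rule monoidI) (auto simp: algebra_simps)
qed (auto simp: algebra_simps)

locale presentation =
  fixes G :: "'g set" and rel :: "('g, 'k::field) falg \<Rightarrow> ('g, 'k) falg \<Rightarrow> bool"
  assumes rel_closed: "rel l r \<Longrightarrow> l \<in> falg_on G \<and> r \<in> falg_on G"
begin

lemma rel_gens: "{l - r | l r. rel l r} \<subseteq> carrier (free_alg G)"
  using rel_closed by auto

lemma ideal_rel_ideal: "ideal (rel_ideal G rel) (free_alg G)"
  unfolding rel_ideal_def by (rule ring.genideal_ideal[OF ring_free_alg rel_gens])

text \<open>Killing the letters outside \<open>G\<close> is a retraction of the whole free algebra onto the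
  subalgebra which fixes the relations, so it maps the larger ideal into the smaller one.\<close>

lemma rel_ideal_eq: "rel_ideal G rel = rel_span rel \<inter> falg_on G"
proof
  have "ideal (rel_span rel \<inter> falg_on G) (free_alg G)"
  proof (rule idealI)
    show "subgroup (rel_span rel \<inter> falg_on G) (add_monoid (free_alg G))"
    proof (rule group.subgroupI)
      show "group (add_monoid (free_alg G))"
        using abelian_group.a_group[OF ring.is_abelian_group[OF ring_free_alg]] .
      fix a assume a: "a \<in> rel_span rel \<inter> falg_on G"
      have "inv\<^bsub>add_monoid (free_alg G)\<^esub> a = - a"
        by (rule group.inv_equality[OF abelian_group.a_group[OF ring.is_abelian_group[OF ring_free_alg]]])
          (use a in auto)
      then show "inv\<^bsub>add_monoid (free_alg G)\<^esub> a \<in> rel_span rel \<inter> falg_on G"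
        using a rel_span_uminus by auto
    qed (auto intro: rel_span.zero rel_span.add)
  qed (auto intro: ring_free_alg rel_span_mult_left rel_span_mult_right)
  moreover have "{l - r | l r. rel l r} \<subseteq> rel_span rel \<inter> falg_on G"
    using rel_gens equ_rel by (auto simp: equ_def)
  ultimately show "rel_ideal G rel \<subseteq> rel_span rel \<inter> falg_on G"
    unfolding rel_ideal_def by (rule ring.genideal_minimal[OF ring_free_alg])
next
  interpret I: ideal "rel_ideal G rel" "free_alg G" by (rule ideal_rel_ideal)
  define ret :: "('g, 'k) falg \<Rightarrow> ('g, 'k) falg" where "ret = free_hom (\<lambda>g. if g \<in> G then gen g else 0)"
  have ret_on: "ret p \<in> falg_on G" for p
    unfolding ret_def
    by (induction p rule: falg_induct)
      (auto simp: free_hom_zero free_hom_add free_hom_single intro!: falg_on_mult falg_on_prod_list)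
  have ret_id: "ret p = p" if "p \<in> falg_on G" for p
    unfolding ret_def using free_hom_cong_on[OF that, of _ gen] free_hom_ident[of p] by auto
  have "ret p \<in> rel_ideal G rel" if "p \<in> rel_span rel" for p
    using that
  proof (induction rule: rel_span.induct)
    case zero
    show ?case using additive_subgroup.zero_closed[OF I.is_additive_subgroup] by (simp add: ret_def free_hom_zero)
  next
    case (add p r)
    then show ?case using additive_subgroup.a_closed[OF I.is_additive_subgroup] by (simp add: ret_def free_hom_add)
  next
    case (rel l r a b)
    then have "l - r \<in> rel_ideal G rel"
      unfolding rel_ideal_def using ring.genideal_self[OF ring_free_alg rel_gens] by blast
    then have "ret a * (l - r) * ret b \<in> rel_ideal G rel"
      using I.I_l_closed[of "l - r" "ret a"] I.I_r_closed[of "ret a * (l - r)" "ret b"] ret_on by simp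
    moreover have "ret (a * (l - r) * b) = ret a * (l - r) * ret b"
      using ret_id[OF falg_on_diff, of l r] rel_closed[OF rel] by (simp add: ret_def free_hom_mult)
    ultimately show ?case by simp
  qed
  then show "rel_span rel \<inter> falg_on G \<subseteq> rel_ideal G rel" using ret_id by force
qed

lemma cls_eq_iff:
  assumes "p \<in> falg_on G" "r \<in> falg_on G"
  shows "cls G rel p = cls G rel r \<longleftrightarrow> equ rel p r"
proof -
  have *: "cls G rel x = (\<lambda>i. i + x) ` rel_ideal G rel" for x
    by (auto simp: cls_def a_r_coset_def')
  show ?thesis
  proof
    assume "cls G rel p = cls G rel r"
    moreover have "p \<in> cls G rel p"
      unfolding * by (rule image_eqI[of _ _ 0]) (auto simp: rel_ideal_eq rel_span.zero)
    ultimately obtain i where "i \<in> rel_span rel" "p = i + r" by (auto simp: * rel_ideal_eq)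
    then show "equ rel p r" by (simp add: equ_def)
  next
    have sub: "cls G rel x \<subseteq> cls G rel y" if "x \<in> falg_on G" "y \<in> falg_on G" "equ rel x y" for x y
    proof
      fix z assume "z \<in> cls G rel x"
      then obtain i where i: "i \<in> rel_ideal G rel" "z = i + x" by (auto simp: *)
      then have "i + (x - y) \<in> rel_ideal G rel" "z = (i + (x - y)) + y"
        using that by (auto simp: rel_ideal_eq equ_def intro: rel_span.add)
      then show "z \<in> cls G rel y" unfolding * by (metis image_eqI)
    qed
    assume "equ rel p r"
    then show "cls G rel p = cls G rel r" using sub assms equ_sym by blast
  qed
qed

lemma in_cls_iff: "p \<in> falg_on G \<Longrightarrow> r \<in> cls G rel p \<longleftrightarrow> r \<in> falg_on G \<and> equ rel r p"
proof -
  assume p: "p \<in> falg_on G"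
  have "r \<in> cls G rel p \<longleftrightarrow> (\<exists>i\<in>rel_ideal G rel. r = i + p)"
    by (auto simp: cls_def a_r_coset_def')
  also have "\<dots> \<longleftrightarrow> r - p \<in> rel_ideal G rel"
    by (metis add_diff_cancel_right' diff_add_cancel)
  also have "\<dots> \<longleftrightarrow> r \<in> falg_on G \<and> equ rel r p"
    using p falg_on_add[of "r - p" G p] by (auto simp: rel_ideal_eq equ_def)
  finally show ?thesis .
qed

abbreviation "P \<equiv> presented_alg G rel"

lemma carrier_P: "carrier P = cls G rel ` falg_on G"
  by (auto simp: presented_alg_def Let_def FactRing_def A_RCOSETS_def' cls_def)

lemma mult_P: "\<lbrakk>p \<in> falg_on G; r \<in> falg_on G\<rbrakk> \<Longrightarrow> cls G rel p \<otimes>\<^bsub>P\<^esub> cls G rel r = cls G rel (p * r)"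
  using ideal.rcoset_mult_add[OF ideal_rel_ideal, of p r]
  by (simp add: presented_alg_def Let_def FactRing_def cls_def)

lemma add_P: "\<lbrakk>p \<in> falg_on G; r \<in> falg_on G\<rbrakk> \<Longrightarrow> cls G rel p \<oplus>\<^bsub>P\<^esub> cls G rel r = cls G rel (p + r)"
proof -
  interpret I: ideal "rel_ideal G rel" "free_alg G" by (rule ideal_rel_ideal)
  show "\<lbrakk>p \<in> falg_on G; r \<in> falg_on G\<rbrakk> \<Longrightarrow> ?thesis"
    using I.a_rcos_sum[of p r] by (simp add: presented_alg_def Let_def FactRing_def cls_def)
qed

lemma one_P: "\<one>\<^bsub>P\<^esub> = cls G rel 1"
  by (simp add: presented_alg_def Let_def FactRing_def cls_def)

lemma zero_P: "\<zero>\<^bsub>P\<^esub> = cls G rel 0"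
  by (simp add: presented_alg_def Let_def FactRing_def cls_def a_r_coset_def')

lemma smult_P: "p \<in> falg_on G \<Longrightarrow> c \<odot>\<^bsub>P\<^esub> cls G rel p = cls G rel (scal c * p)"
  using mult_P[of "scal c" p] by (simp add: presented_alg_def Let_def)

lemmas P_simps = mult_P add_P one_P zero_P smult_P

lemma ring_P: "ring P"
proof (rule ringI)
  show "abelian_group P"
  proof (rule abelian_groupI)
    fix x assume "x \<in> carrier P"
    then obtain p where p: "p \<in> falg_on G" "x = cls G rel p" by (auto simp: carrier_P)
    then have "cls G rel (- p) \<oplus>\<^bsub>P\<^esub> x = \<zero>\<^bsub>P\<^esub>" by (simp add: P_simps falg_on_uminus)
    then show "\<exists>y\<in>carrier P. y \<oplus>\<^bsub>P\<^esub> x = \<zero>\<^bsub>P\<^esub>" using p by (auto simp: carrier_P)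
  qed (auto simp: carrier_P P_simps falg_on_add algebra_simps)
  show "monoid P"
    by (rule monoidI) (auto simp: carrier_P P_simps falg_on_mult mult.assoc)
qed (auto simp: carrier_P P_simps falg_on_add falg_on_mult algebra_simps)

lemma vectorspace_P: "vectorspace class_ring P"
proof -
  have "module class_ring P"
  proof (rule moduleI)
    show "abelian_group P" by (rule ring.is_abelian_group[OF ring_P])
    show "cring (class_ring :: 'k ring)" by (rule class_cring.cring_axioms)
  qed (auto simp: carrier_P P_simps falg_on_mult falg_on_add scal_add scal_mult scal_1 algebra_simps)
  then show ?thesis by (simp add: vectorspace_def class_field)
qed

lemma finsum_P:
  assumes "finite A" "\<And>x. x \<in> A \<Longrightarrow> f x \<in> falg_on G"
  shows "finsum P (\<lambda>x. cls G rel (f x)) A = cls G rel (\<Sum>x\<in>A. f x)"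
proof -
  interpret ring P by (rule ring_P)
  show ?thesis
    using assms by (induction A) (auto simp: carrier_P P_simps falg_on_sum)
qed

text \<open>Independence of the representatives also makes the classes distinct, so the basis may be
  stated as a set.\<close>

lemma presented_basis:
  assumes d: "\<And>x. x \<in> X \<Longrightarrow> d x \<in> falg_on G"
    and span: "\<And>p. p \<in> falg_on G \<Longrightarrow> \<exists>A a. finite A \<and> A \<subseteq> X \<and> equ rel p (\<Sum>x\<in>A. scal (a x) * d x)"
    and indep: "\<And>A a. \<lbrakk>finite A; A \<subseteq> X; equ rel (\<Sum>x\<in>A. scal (a x) * d x) 0\<rbrakk> \<Longrightarrow> \<forall>x\<in>A. a x = 0"
  shows "vectorspace.basis class_ring P ((\<lambda>x. cls G rel (d x)) ` X)"
proof -
  interpret V: vectorspace class_ring P by (rule vectorspace_P)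
  let ?c = "\<lambda>x. cls G rel (d x)"
  have inj: "inj_on ?c X"
  proof (rule inj_onI, rule ccontr)
    fix x y assume xy: "x \<in> X" "y \<in> X" "?c x = ?c y" "x \<noteq> y"
    then have "equ rel (d x - d y) 0" using d by (simp add: cls_eq_iff flip: equ_diff_zero)
    then have "\<forall>z\<in>{x, y}. (if z = x then 1 else - 1) = (0 :: 'k)"
      using xy by (intro indep) (auto simp: scal_1 scal_def single_uminus)
    then show False by simp
  qed
  have lin: "V.lincomb a (?c ` A) = cls G rel (\<Sum>x\<in>A. scal (a (?c x)) * d x)"
    if "finite A" "A \<subseteq> X" for a A
  proof -
    have "V.lincomb a (?c ` A) = finsum P (\<lambda>x. a (?c x) \<odot>\<^bsub>P\<^esub> ?c x) A"
      unfolding V.lincomb_def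
      by (rule V.finsum_reindex) (use that d inj in \<open>auto simp: carrier_P P_simps falg_on_mult intro: inj_on_subset\<close>)
    also have "\<dots> = finsum P (\<lambda>x. cls G rel (scal (a (?c x)) * d x)) A"
      by (rule V.finsum_cong') (use that d in \<open>auto simp: carrier_P P_simps falg_on_mult\<close>)
    also have "\<dots> = cls G rel (\<Sum>x\<in>A. scal (a (?c x)) * d x)"
      by (rule finsum_P) (use that d in auto)
    finally show ?thesis .
  qed
  have on: "(\<Sum>x\<in>A. scal (a x) * d x) \<in> falg_on G" if "A \<subseteq> X" for A a
    using that d by auto
  have "V.lin_indpt (?c ` X)"
  proof
    assume "V.lin_dep (?c ` X)"
    then obtain B a v where B: "finite B" "B \<subseteq> ?c ` X" "V.lincomb a B = \<zero>\<^bsub>P\<^esub>" "v \<in> B" "a v \<noteq> 0"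
      unfolding V.lin_dep_def by auto
    then obtain A where A: "A \<subseteq> X" "finite A" "B = ?c ` A"
      using finite_subset_image by metis
    then have "equ rel (\<Sum>x\<in>A. scal (a (?c x)) * d x) 0"
      using B(3) lin[of A a] on[OF A(1)] by (simp add: zero_P cls_eq_iff)
    then have "\<forall>x\<in>A. a (?c x) = 0" using A by (intro indep)
    then show False using B A by auto
  qed
  moreover have "V.span (?c ` X) = carrier P"
  proof
    show "V.span (?c ` X) \<subseteq> carrier P"
    proof
      fix v assume "v \<in> V.span (?c ` X)"
      then obtain a B where B: "finite B" "B \<subseteq> ?c ` X" "v = V.lincomb a B" unfolding V.span_def by auto
      then obtain A where "A \<subseteq> X" "finite A" "B = ?c ` A" using finite_subset_image by metis
      then show "v \<in> carrier P" using B lin on by (auto simp: carrier_P)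
    qed
    show "carrier P \<subseteq> V.span (?c ` X)"
    proof
      fix v assume "v \<in> carrier P"
      then obtain p where p: "p \<in> falg_on G" "v = cls G rel p" by (auto simp: carrier_P)
      then obtain A a where A: "finite A" "A \<subseteq> X" "equ rel p (\<Sum>x\<in>A. scal (a x) * d x)"
        using span by blast
      define a' where "a' = a \<circ> inv_into X ?c"
      have "a' (?c x) = a x" if "x \<in> A" for x
        using inv_into_f_f[OF inj, of x] that A by (auto simp: a'_def)
      then have "V.lincomb a' (?c ` A) = cls G rel (\<Sum>x\<in>A. scal (a x) * d x)"
        using lin[OF A(1,2), of a'] by simp
      also have "\<dots> = v" using A p on equ_sym by (simp add: cls_eq_iff) blast
      finally have "v = V.lincomb a' (?c ` A)" ..
      moreover have "finite (?c ` A)" "?c ` A \<subseteq> ?c ` X" using A by auto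
      ultimately show "v \<in> V.span (?c ` X)" unfolding V.span_def by auto
    qed
  qed
  moreover have "?c ` X \<subseteq> carrier P" using d by (auto simp: carrier_P)
  ultimately show ?thesis by (simp add: V.basis_def)
qed

end


lemma scal_left_commute: "p * (scal c * r) = scal c * (p * r)"
  by (metis mult.assoc scal_comm)

lemmas scal_move = scal_left_commute[of "gen g" for g] scal_left_commute[of "prod_list xs" for xs]

lemma scal_scal: "scal c * (scal d * p) = scal (c * d) * p"
  by (simp add: scal_mult mult.assoc)


section \<open>The two presentations\<close>

text \<open>The index \<open>b + 1\<close> of the relations is to keep its form under simplification.\<close>

declare One_nat_def [simp del]

lemma edge_total: "x = y \<or> no_edge q x y \<or> edge_right q x y \<or> edge_left q x y \<or> edge_both q x y"
  unfolding no_edge_def edge_right_def edge_left_def edge_both_def insert_iff empty_iff by metis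

locale klr =
  fixes n :: nat and q :: "'k::field" and \<beta> :: "(nat \<Rightarrow> 'k) set"
  assumes n2: "n \<ge> 2" and fin_\<beta>: "finite \<beta>"
    and actB_closed: "\<lbrakk>a < n; i \<in> \<beta>\<rbrakk> \<Longrightarrow> actB a i \<in> \<beta>"
begin

lemma actD_0: "actD 0 i = actB 0 (actB 1 (actB 0 i))"
  by (auto simp: actD_def actB_def fun_eq_iff transpose_def)

lemma actD_closed: "\<lbrakk>a < n; i \<in> \<beta>\<rbrakk> \<Longrightarrow> actD a i \<in> \<beta>"
proof (cases "a = 0")
  case True
  assume "i \<in> \<beta>"
  then show ?thesis unfolding True actD_0 using n2 by (intro actB_closed) auto
next
  case False
  assume "a < n" "i \<in> \<beta>"
  with actB_closed[of a i] False show ?thesis by (simp add: actD_def actB_def)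
qed

abbreviation "G \<equiv> klr_gens n \<beta>"

lemma gens_on [intro]:
  "a < n \<Longrightarrow> psi a \<in> falg_on G" "j \<in> {1..n} \<Longrightarrow> yy j \<in> falg_on G" "i \<in> \<beta> \<Longrightarrow> ee i \<in> falg_on G"
  by (auto simp: klr_gens_def)

lemma transpose_range: "\<lbrakk>b \<in> {1..<n}; j \<in> {1..n}\<rbrakk> \<Longrightarrow> transpose b (b + 1) j \<in> {1..n}"
  by (auto simp: transpose_def)

lemma common_rel_closed:
  assumes "common_rel act n q \<beta> l r" "\<And>a i. \<lbrakk>a < n; i \<in> \<beta>\<rbrakk> \<Longrightarrow> act a i \<in> \<beta>"
  shows "l \<in> falg_on G \<and> r \<in> falg_on G"
  using assms(1)
proof cases
  case (psi_y b j i)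
  then show ?thesis using transpose_range[of b j]
    by (auto intro!: falg_on_mult falg_on_diff falg_on_uminus gens_on)
qed (auto intro!: falg_on_mult falg_on_diff falg_on_add falg_on_uminus falg_on_power falg_on_sum gens_on assms(2))

sublocale V: presentation G "V_rel n q \<beta>"
proof
  fix l r :: "'k klr" assume "V_rel n q \<beta> l r"
  then show "l \<in> falg_on G \<and> r \<in> falg_on G"
  proof cases
    case common then show ?thesis using actB_closed by (rule common_rel_closed)
  qed (use n2 in \<open>auto intro!: falg_on_mult falg_on_add falg_on_power gens_on\<close>)
qed

sublocale W: presentation G "W_rel n q \<beta>"
proof
  fix l r :: "'k klr" assume "W_rel n q \<beta> l r"
  then show "l \<in> falg_on G \<and> r \<in> falg_on G"
  proof cases
    case common then show ?thesis using actD_closed by (rule common_rel_closed)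
  next
    case (psi0_y j i)
    have "transpose 1 2 j \<in> {1..n}" using psi0_y n2 by (auto simp: transpose_def)
    then show ?thesis using psi0_y n2
      by (auto intro!: falg_on_mult falg_on_add falg_on_uminus gens_on)
  qed (use n2 in \<open>auto intro!: falg_on_mult falg_on_diff falg_on_add falg_on_uminus falg_on_power gens_on\<close>)
qed


section \<open>The length filtration of W\<close>

abbreviation "eqW \<equiv> equ (W_rel n q \<beta>)"

lemma W_relation: "W_rel n q \<beta> l r \<Longrightarrow> eqW l r"
  by (rule equ_rel)

lemma W_common: "common_rel actD n q \<beta> l r \<Longrightarrow> eqW l r"
  by (rule equ_rel[OF W_rel.common])

primrec psi_index :: "'k klr_gen \<Rightarrow> nat list" where
  "psi_index (Psi a) = [a]" | "psi_index (Y j) = []" | "psi_index (E i) = []"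

definition psis :: "'k klr_gen list \<Rightarrow> nat list"
  where "psis u = concat (map psi_index u)"

lemma psis_simps [simp]: "psis [] = []" "psis (g # u) = psi_index g @ psis u" "psis (u @ v) = psis u @ psis v"
  by (simp_all add: psis_def)

abbreviation word :: "'k klr_gen list \<Rightarrow> 'k klr" where "word u \<equiv> prod_list (map gen u)"

text \<open>The filtration of W by the number of letters \<open>Psi a\<close>. In its associated graded algebra the
  \<open>Psi a\<close> satisfy the relations of the nil-Coxeter algebra of type D and commute with the other
  generators up to permutations and signs.\<close>

inductive low :: "nat \<Rightarrow> 'k klr \<Rightarrow> bool" for k where
  zero: "low k 0"
| add: "\<lbrakk>low k p; low k r\<rbrakk> \<Longrightarrow> low k (p + r)"
| word: "\<lbrakk>set u \<subseteq> G; length (psis u) < k\<rbrakk> \<Longrightarrow> low k (scal c * word u)"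
| equ: "\<lbrakk>low k p; eqW p r\<rbrakk> \<Longrightarrow> low k r"

lemma eqW_low_1: "\<lbrakk>low k r; eqW p r\<rbrakk> \<Longrightarrow> low k p"
  by (blast intro: low.equ equ_sym)

lemma low_mono: "\<lbrakk>low k p; k \<le> l\<rbrakk> \<Longrightarrow> low l p"
  by (induction rule: low.induct) (auto intro: low.intros)

lemma low_scal: "low k p \<Longrightarrow> low k (scal c * p)"
proof (induction rule: low.induct)
  case (word u d)
  then show ?case using low.word[of u k "c * d"] by (simp add: scal_mult mult.assoc)
qed (auto simp: distrib_left intro: low.intros equ_mult_left)

lemma low_uminus: "low k p \<Longrightarrow> low k (- p)"
  using low_scal[of k p "- 1"] by (simp add: scal_def single_uminus)

lemma low_diff: "\<lbrakk>low k p; low k r\<rbrakk> \<Longrightarrow> low k (p - r)"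
  using low.add[of k p "- r"] low_uminus by simp

lemma low_sum: "(\<And>x. x \<in> A \<Longrightarrow> low k (f x)) \<Longrightarrow> low k (sum f A)"
  by (induction A rule: infinite_finite_induct) (auto intro: low.intros)

lemma low_word_left: "\<lbrakk>low k p; set v \<subseteq> G\<rbrakk> \<Longrightarrow> low (length (psis v) + k) (word v * p)"
proof (induction rule: low.induct)
  case (word u c)
  then show ?case using low.word[of "v @ u" "length (psis v) + k" c]
    by (simp add: scal_move)
qed (auto simp: distrib_left intro: low.intros equ_mult_left)

lemma low_mult:
  assumes "low k p" "low l r"
  shows "low (k + l - 1) (p * r)"
  using assms(1)
proof (induction rule: low.induct)
  case (word u c)
  have "low (k + l - 1) (word u * r)"
    using low_mono[OF low_word_left[OF assms(2) word(1)]] word(2) by simp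
  then show ?case using low_scal by (simp add: mult.assoc)
qed (auto simp: distrib_right intro: low.intros equ_mult_right)

lemma low_mult_le: "\<lbrakk>low k p; low l r; k + l \<le> Suc m\<rbrakk> \<Longrightarrow> low m (p * r)"
  using low_mono[OF low_mult] by simp

lemma low_1: "k \<ge> 1 \<Longrightarrow> low k 1"
  using low.word[of "[]" k 1] by (simp add: scal_1)

lemma low_yy: "\<lbrakk>j \<in> {1..n}; k \<ge> 1\<rbrakk> \<Longrightarrow> low k (yy j)"
  using low.word[of "[Y j]" k 1] by (auto simp: scal_1 klr_gens_def)

lemma low_ee: "\<lbrakk>i \<in> \<beta>; k \<ge> 1\<rbrakk> \<Longrightarrow> low k (ee i)"
  using low.word[of "[E i]" k 1] by (auto simp: scal_1 klr_gens_def)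

lemma low_psi: "\<lbrakk>a < n; k \<ge> 2\<rbrakk> \<Longrightarrow> low k (psi a)"
  using low.word[of "[Psi a]" k 1] by (auto simp: scal_1 klr_gens_def)

lemma low_mult_1: "\<lbrakk>low 1 p; low 1 r\<rbrakk> \<Longrightarrow> low 1 (p * r)"
  using low_mult_le[of 1 p 1 r 1] by simp

lemma low_2: "low 1 2"
  using low.add[OF low_1 low_1, of 1] by simp

lemmas low_intros = low_mult_1 low_diff low_uminus low_1 low_yy low_ee low_2 low.zero low.add

lemma eqW_sum_e: "eqW (\<Sum>i\<in>\<beta>. p * ee i) p"
proof -
  have "eqW (p * (\<Sum>i\<in>\<beta>. ee i)) (p * 1)"
    by (intro equ_mult_left W_common common_rel.sum_e)
  then show ?thesis by (simp add: sum_distrib_left)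
qed

lemma low_by_idempotents: "(\<And>i. i \<in> \<beta> \<Longrightarrow> low k (p * ee i)) \<Longrightarrow> low k p"
  using low.equ[OF low_sum eqW_sum_e] by blast

text \<open>In the associated graded algebra, \<open>Psi a\<close> moves past \<open>yy j\<close> by the action of \<open>genD a\<close> on the
  vector $\varepsilon_j$, which goes to a vector with index \<open>yperm a j\<close> and sign \<open>ysign a j\<close>.\<close>

definition yperm :: "nat \<Rightarrow> nat \<Rightarrow> nat"
  where "yperm a j = (if a = 0 then transpose 1 2 j else transpose a (a + 1) j)"

definition ysign :: "nat \<Rightarrow> nat \<Rightarrow> 'k"
  where "ysign a j = (if a = 0 \<and> j \<in> {1, 2} then - 1 else 1)"

lemma yperm_range: "\<lbrakk>a < n; j \<in> {1..n}\<rbrakk> \<Longrightarrow> yperm a j \<in> {1..n}"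
  using n2 by (auto simp: yperm_def transpose_def)

lemma psi_yy_leading:
  assumes a: "a < n" and j: "j \<in> {1..n}"
  shows "low 1 (psi a * yy j - scal (ysign a j) * (yy (yperm a j) * psi a))"
proof (rule low_by_idempotents)
  fix i assume i: "i \<in> \<beta>"
  show "low 1 ((psi a * yy j - scal (ysign a j) * (yy (yperm a j) * psi a)) * ee i)"
  proof (cases "a = 0")
    case False
    then have b: "a \<in> {1..<n}" using a by auto
    have "low 1 (if j = a \<and> i a = i (a + 1) then - ee i else if j = a + 1 \<and> i a = i (a + 1) then ee i else 0)"
      using i by (auto intro: low_intros)
    then have "low 1 ((psi a * yy j - yy (transpose a (a + 1) j) * psi a) * ee i)"
      by (rule eqW_low_1) (intro W_common common_rel.psi_y b j i)
    then show ?thesis using False by (simp add: yperm_def ysign_def scal_1)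
  next
    case True
    have sc: "scal (- 1) * p = - p" for p :: "'k klr" by (simp add: scal_def single_uminus)
    let ?R = "if j \<in> {1, 2} \<and> inverse (i 1) = i 2 then (- yy (transpose 1 2 j) * psi 0 + 1) * ee i
       else if j \<in> {1, 2} \<and> inverse (i 1) \<noteq> i 2 then - yy (transpose 1 2 j) * psi 0 * ee i
       else yy j * psi 0 * ee i :: 'k klr"
    have R: "eqW (psi 0 * yy j * ee i - scal (ysign 0 j) * (yy (yperm 0 j) * psi 0) * ee i)
       (?R - scal (ysign 0 j) * (yy (yperm 0 j) * psi 0) * ee i)"
      by (intro equ_diff equ_rel W_rel.psi0_y j i equ_refl)
    have "?R - scal (ysign 0 j) * (yy (yperm 0 j) * psi 0) * ee i
       = (if j \<in> {1, 2} \<and> inverse (i 1) = i 2 then ee i else 0)"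
      by (auto simp: ysign_def yperm_def sc scal_1 algebra_simps)
    also have "low 1 (if j \<in> {1, 2} \<and> inverse (i 1) = i 2 then ee i else 0)"
      using i by (simp add: low_ee low.zero)
    finally have "low 1 (psi 0 * yy j * ee i - scal (ysign 0 j) * (yy (yperm 0 j) * psi 0) * ee i)"
      using R by (rule eqW_low_1)
    then show ?thesis using True by (simp add: left_diff_distrib)
  qed
qed

abbreviation yword :: "nat list \<Rightarrow> 'k klr" where "yword js \<equiv> prod_list (map yy js)"
abbreviation psiword :: "nat list \<Rightarrow> 'k klr" where "psiword ws \<equiv> prod_list (map psi ws)"

lemma low_yword: "set js \<subseteq> {1..n} \<Longrightarrow> low 1 (yword js)"
  by (induction js) (auto intro!: low_mult_1 low_yy low_1)

lemma low_psiword: "\<lbrakk>set ws \<subseteq> {0..<n}; length ws < k\<rbrakk> \<Longrightarrow> low k (psiword ws)"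
proof -
  assume *: "set ws \<subseteq> {0..<n}" "length ws < k"
  have "psis (map Psi ws) = ws" by (induction ws) auto
  then show ?thesis using low.word[of "map Psi ws" k 1] * by (auto simp: scal_1 klr_gens_def o_def)
qed

lemma psi_yword_leading:
  assumes a: "a < n" and "set js \<subseteq> {1..n}"
  shows "\<exists>c js'. set js' \<subseteq> {1..n} \<and> low 1 (psi a * yword js - scal c * (yword js' * psi a))"
  using assms(2)
proof (induction js)
  case Nil
  show ?case by (rule exI[of _ 1], rule exI[of _ "[]"]) (simp add: scal_1 low.zero)
next
  case (Cons j js)
  then obtain c js' where js': "set js' \<subseteq> {1..n}" "low 1 (psi a * yword js - scal c * (yword js' * psi a))"
    by auto
  let ?s = "ysign a j" and ?j = "yperm a j"
  have j: "j \<in> {1..n}" "?j \<in> {1..n}" using Cons yperm_range[OF a, of j] by auto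
  have "low 1 ((psi a * yy j - scal ?s * (yy ?j * psi a)) * yword js
     + scal ?s * (yy ?j * (psi a * yword js - scal c * (yword js' * psi a))))"
    using Cons.prems j js'(2) by (intro low.add low_mult_1 low_scal psi_yy_leading low_yword low_yy a) auto
  also have "(psi a * yy j - scal ?s * (yy ?j * psi a)) * yword js
     + scal ?s * (yy ?j * (psi a * yword js - scal c * (yword js' * psi a)))
     = psi a * yword (j # js) - scal (?s * c) * (yword (?j # js') * psi a)"
    by (simp add: algebra_simps scal_scal scal_move)
  finally show ?case using js'(1) j by (metis insert_subset list.simps(15))
qed

lemma psiword_ee:
  assumes "set ws \<subseteq> {0..<n}" "i \<in> \<beta>"
  shows "foldr actD ws i \<in> \<beta> \<and> eqW (psiword ws * ee i) (ee (foldr actD ws i) * psiword ws)"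
  using assms(1)
proof (induction ws)
  case Nil show ?case using assms by simp
next
  case (Cons a ws)
  let ?i = "foldr actD ws i"
  have IH: "?i \<in> \<beta>" "eqW (psiword ws * ee i) (ee ?i * psiword ws)" using Cons by auto
  have "eqW (psi a * (psiword ws * ee i)) (psi a * (ee ?i * psiword ws))"
    by (rule equ_mult_left[OF IH(2)])
  also have "psi a * (ee ?i * psiword ws) = psi a * ee ?i * psiword ws" by (simp add: mult.assoc)
  also have "eqW \<dots> (ee (actD a ?i) * psi a * psiword ws)"
    using Cons IH by (intro equ_mult_right W_common common_rel.psi_e) auto
  finally show ?case using Cons.prems IH(1) actD_closed by (simp add: mult.assoc)
qed

lemma ee_yword:
  assumes "set js \<subseteq> {1..n}" "i \<in> \<beta>"
  shows "eqW (ee i * yword js) (yword js * ee i)"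
  using assms(1)
proof (induction js)
  case (Cons j js)
  have "eqW (ee i * yy j * yword js) (yy j * ee i * yword js)"
    using Cons assms by (intro equ_mult_right equ_sym[OF W_common] common_rel.y_e) auto
  also have "yy j * ee i * yword js = yy j * (ee i * yword js)" by (simp add: mult.assoc)
  also have "eqW \<dots> (yy j * (yword js * ee i))" using Cons by (intro equ_mult_left) auto
  finally show ?case by (simp add: mult.assoc)
qed simp

text \<open>Moving \<open>yy j\<close> to the left past \<open>Psi a\<close> costs only terms without this letter, and idempotents pass all
  letters. So modulo fewer letters \<open>Psi a\<close> the other letters of a word collect at its two ends.\<close>

lemma word_leading:
  assumes "set u \<subseteq> G" "i \<in> \<beta>"
  shows "\<exists>c js. set js \<subseteq> {1..n} \<and>
    low (length (psis u)) (word u * ee i - scal c * (yword js * psiword (psis u) * ee i))"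
  using assms(1)
proof (induction u)
  case Nil
  show ?case by (rule exI[of _ 1], rule exI[of _ "[]"]) (simp add: scal_1 low.zero)
next
  case (Cons g u)
  let ?ws = "psis u"
  obtain c js where js: "set js \<subseteq> {1..n}"
    and IH: "low (length ?ws) (word u * ee i - scal c * (yword js * psiword ?ws * ee i))" (is "low _ ?d")
    using Cons by auto
  have ws: "set ?ws \<subseteq> {0..<n}" using Cons.prems by (induction u) (auto simp: klr_gens_def)
  have g: "low (length (psi_index g) + length ?ws) (gen g * ?d)"
    using low_word_left[OF IH, of "[g]"] Cons.prems by simp
  show ?case
  proof (cases g)
    case (Y j)
    then have "j \<in> {1..n}" using Cons.prems by (auto simp: klr_gens_def)
    moreover have "gen g * ?d = word (g # u) * ee i - scal c * (yword (j # js) * psiword (psis (g # u)) * ee i)"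
      by (simp add: Y algebra_simps scal_scal scal_move)
    ultimately show ?thesis using g js Y by (intro exI[of _ c] exI[of _ "j # js"]) simp
  next
    case (E k)
    then have k: "k \<in> \<beta>" using Cons.prems by (auto simp: klr_gens_def)
    let ?i = "foldr actD ?ws i"
    have i: "?i \<in> \<beta>" "eqW (psiword ?ws * ee i) (ee ?i * psiword ?ws)" using psiword_ee[OF ws assms(2)] by auto
    have "eqW (ee k * yword js * (psiword ?ws * ee i)) (yword js * ee k * (ee ?i * psiword ?ws))"
      by (intro equ_mult ee_yword js k i)
    also have "yword js * ee k * (ee ?i * psiword ?ws) = yword js * (ee k * ee ?i) * psiword ?ws"
      by (simp add: mult.assoc)
    also have "eqW \<dots> (yword js * (if k = ?i then ee k else 0) * psiword ?ws)"
      by (intro equ_mult_left equ_mult_right W_common common_rel.e_e k i)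
    also have "\<dots> = (if k = ?i then yword js * (ee ?i * psiword ?ws) else 0)" by (simp add: mult.assoc)
    also have "eqW \<dots> (if k = ?i then yword js * (psiword ?ws * ee i) else 0)"
      using equ_mult_left[OF equ_sym[OF i(2)]] by simp
    also have "\<dots> = scal (if k = ?i then 1 else 0) * (yword js * psiword ?ws * ee i)"
      by (simp add: scal_1 scal_0 mult.assoc)
    finally have "eqW (ee k * yword js * (psiword ?ws * ee i))
      (scal (if k = ?i then 1 else 0) * (yword js * psiword ?ws * ee i))" .
    then have step: "eqW (ee k * word u * ee i - scal c * (ee k * yword js * (psiword ?ws * ee i)))
      (ee k * word u * ee i - scal c * (scal (if k = ?i then 1 else 0) * (yword js * psiword ?ws * ee i)))"
      by (intro equ_diff equ_mult_left equ_refl)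
    have "gen g * ?d = ee k * word u * ee i - scal c * (ee k * yword js * (psiword ?ws * ee i))"
      by (simp add: E algebra_simps scal_scal scal_move)
    moreover have "low (length ?ws) (gen g * ?d)" using g E by simp
    ultimately have "low (length ?ws) (ee k * word u * ee i - scal c * (ee k * yword js * (psiword ?ws * ee i)))"
      by (simp only:)
    then have "low (length ?ws)
      (ee k * word u * ee i - scal c * (scal (if k = ?i then 1 else 0) * (yword js * psiword ?ws * ee i)))"
      using step by (rule low.equ)
    then show ?thesis using js E
      by (intro exI[of _ "c * (if k = ?i then 1 else 0)"] exI[of _ js]) (simp add: scal_mult mult.assoc)
  next
    case (Psi a)
    then have a: "a < n" using Cons.prems by (auto simp: klr_gens_def)
    obtain c' js' where js': "set js' \<subseteq> {1..n}" "low 1 (psi a * yword js - scal c' * (yword js' * psi a))"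
      using psi_yword_leading[OF a js] by auto
    have "low (Suc (length ?ws)) (psiword ?ws * ee i)"
      using low_mult_le[OF low_psiword[OF ws, of "Suc (length ?ws)"] low_ee[OF assms(2), of 1]] by simp
    then have "low (Suc (length ?ws)) (gen g * ?d
        + scal c * ((psi a * yword js - scal c' * (yword js' * psi a)) * (psiword ?ws * ee i)))"
      using g Psi js'(2) by (intro low.add low_scal) (auto intro: low_mult_le)
    moreover have "gen g * ?d + scal c * ((psi a * yword js - scal c' * (yword js' * psi a)) * (psiword ?ws * ee i))
      = word (g # u) * ee i - scal (c * c') * (yword js' * psiword (psis (g # u)) * ee i)"
      by (simp add: Psi algebra_simps scal_scal scal_move)
    ultimately show ?thesis using js'(1) Psi by (intro exI[of _ "c * c'"] exI[of _ js']) simp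
  qed
qed

lemma psi_square_low:
  assumes a: "a < n"
  shows "low 1 (psi a * psi a)"
proof (rule low_by_idempotents)
  fix i assume i: "i \<in> \<beta>"
  have "low 1 ((psi a)\<^sup>2 * ee i)"
  proof (cases "a = 0")
    case False
    then have b: "a \<in> {1..<n}" "a \<in> {1..n}" "a + 1 \<in> {1..n}" using a by auto
    from edge_total[of "i a" "i (a + 1)" q] consider "i a = i (a + 1)" | "no_edge q (i a) (i (a + 1))"
      | "edge_right q (i a) (i (a + 1))" | "edge_left q (i a) (i (a + 1))" | "edge_both q (i a) (i (a + 1))"
      by blast
    then show ?thesis
    proof cases
      case 1 show ?thesis by (rule eqW_low_1[OF _ W_common[OF common_rel.psi_sq_eq[OF b(1) i 1]]]) (rule low.zero)
    next
      case 2 show ?thesis by (rule eqW_low_1[OF _ W_common[OF common_rel.psi_sq_no_edge[OF b(1) i 2]]]) (intro low_intros i order_refl)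
    next
      case 3 show ?thesis by (rule eqW_low_1[OF _ W_common[OF common_rel.psi_sq_right[OF b(1) i 3]]]) (intro low_intros i b order_refl)
    next
      case 4 show ?thesis by (rule eqW_low_1[OF _ W_common[OF common_rel.psi_sq_left[OF b(1) i 4]]]) (intro low_intros i b order_refl)
    next
      case 5 show ?thesis by (rule eqW_low_1[OF _ W_common[OF common_rel.psi_sq_both[OF b(1) i 5]]]) (intro low_intros i b order_refl)
    qed
  next
    case a0: True
    have b: "1 \<in> {1..n}" "2 \<in> {1..n}" using n2 by auto
    let ?x = "inverse (i 1)" and ?y = "i 2"
    from edge_total[of ?x ?y q] consider "?x = ?y" | "no_edge q ?x ?y" | "edge_right q ?x ?y" | "edge_left q ?x ?y"
      | "edge_both q ?x ?y" by blast
    then show ?thesis unfolding a0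
    proof cases
      case 1 show "low 1 ((psi 0)\<^sup>2 * ee i)" by (rule eqW_low_1[OF _ W_relation[OF W_rel.psi0_sq_eq[OF i 1]]]) (rule low.zero)
    next
      case 2 show "low 1 ((psi 0)\<^sup>2 * ee i)" by (rule eqW_low_1[OF _ W_relation[OF W_rel.psi0_sq_no_edge[OF i 2]]]) (intro low_intros i order_refl)
    next
      case 3 show "low 1 ((psi 0)\<^sup>2 * ee i)" by (rule eqW_low_1[OF _ W_relation[OF W_rel.psi0_sq_right[OF i 3]]]) (intro low_intros i b order_refl)
    next
      case 4 show "low 1 ((psi 0)\<^sup>2 * ee i)" by (rule eqW_low_1[OF _ W_relation[OF W_rel.psi0_sq_left[OF i 4]]]) (intro low_intros i b order_refl)
    next
      case 5 show "low 1 ((psi 0)\<^sup>2 * ee i)" by (rule eqW_low_1[OF _ W_relation[OF W_rel.psi0_sq_both[OF i 5]]])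
         (simp only: power2_eq_square, intro low_intros i b order_refl)
    qed
  qed
  then show "low 1 (psi a * psi a * ee i)" by (simp add: power2_eq_square)
qed

lemma psi_comm:
  assumes "a < n" "b < n" "a \<noteq> b" "\<not> adjD a b"
  shows "eqW (psi a * psi b) (psi b * psi a)"
proof -
  have 0: "eqW (psi 0 * psi c) (psi c * psi 0)" if "c < n" "c \<noteq> 0" "\<not> adjD 0 c" for c
    using that by (intro equ_rel W_rel.psi0_psi) (auto simp: adjD_def)
  show ?thesis
  proof (cases "a = 0 \<or> b = 0")
    case True then show ?thesis using 0 assms equ_sym adjD_sym by metis
  next
    case False
    then show ?thesis using assms by (intro W_common common_rel.psi_psi) (auto simp: adjD_def)
  qed
qed

lemma psi_braid_low:
  assumes "a < n" "b < n" "adjD a b"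
  shows "low 1 (psi a * psi b * psi a - psi b * psi a * psi b)"
proof -
  have minus: "low 1 (psi a * psi b * psi a - psi b * psi a * psi b)"
    if "low 1 (psi b * psi a * psi b - psi a * psi b * psi a)" for a b
    using low_uminus[OF that] by simp
  have A: "low 1 (psi b * psi (b + 1) * psi b - psi (b + 1) * psi b * psi (b + 1))"
    if "b \<ge> 1" "b + 1 < n" for b
  proof (rule low_by_idempotents)
    fix i assume i: "i \<in> \<beta>"
    have b: "b \<in> {1..<n}" "b + 1 \<in> {1..<n}" "b \<in> {1..n}" "b + 1 \<in> {1..n}" "b + 2 \<in> {1..n}" using that by auto
    show "low 1 ((psi b * psi (b + 1) * psi b - psi (b + 1) * psi b * psi (b + 1)) * ee i)"
      by (rule eqW_low_1[OF _ W_common[OF common_rel.psi_braid[OF b(1,2) i]]])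
        (simp only: split: if_split, intro conjI impI low_intros i b order_refl)
  qed
  have B: "low 1 (psi 0 * psi 2 * psi 0 - psi 2 * psi 0 * psi 2)" if "2 < n"
  proof (rule low_by_idempotents)
    fix i assume i: "i \<in> \<beta>"
    have b: "2 \<in> {1..<n}" "1 \<in> {1..n}" "2 \<in> {1..n}" "3 \<in> {1..n}" using that by auto
    show "low 1 ((psi 0 * psi 2 * psi 0 - psi 2 * psi 0 * psi 2) * ee i)"
      by (rule eqW_low_1[OF _ W_relation[OF W_rel.psi0_braid[OF b(1) i]]])
        (simp only: split: if_split, intro conjI impI low_intros i b order_refl)
  qed
  show ?thesis
    using assms(3) A[of a] A[of b] B assms minus unfolding adjD_def by auto
qed

lemma braid_equiv_low:
  "braid_equiv n us vs \<Longrightarrow> length us = length vs \<and> low (length us) (psiword us - psiword vs)"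
proof (induction rule: braid_equiv.induct)
  case (refl us) then show ?case by (simp add: low.zero)
next
  case (trans us vs ws)
  then have "low (length us) ((psiword us - psiword vs) + (psiword vs - psiword ws))"
    by (intro low.add) metis+
  then show ?case using trans by simp
next
  case (in_context us vs xs ys)
  have "low (Suc (length ys)) (psiword ys)" using in_context by (intro low_psiword) auto
  then have "low (length us + length ys) ((psiword us - psiword vs) * psiword ys)"
    using in_context.IH by (intro low_mult_le[of "length us" _ "Suc (length ys)"]) auto
  then have "low (length xs + (length us + length ys)) (psiword xs * ((psiword us - psiword vs) * psiword ys))"
    using in_context by (intro low_mult_le[OF low_psiword[of xs "Suc (length xs)"]]) auto
  then show ?case using in_context by (simp add: algebra_simps)
next
  case (comm a b)
  then have "eqW 0 (psi a * psi b - psi b * psi a)"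
    using psi_comm equ_sym equ_diff_zero by metis
  then show ?case using low.equ[OF low.zero] by simp
next
  case (braid a b)
  then show ?case using low_mono[OF psi_braid_low[of a b], of 3] by (simp add: mult.assoc numeral_3_eq_3)
qed

text \<open>If a letter does not lengthen a reduced word, the exchange condition and braid moves bring an
  equal letter next to it, and the square of a generator has no leading term.\<close>

lemma nonreduced_low:
  "\<lbrakk>set ws \<subseteq> {0..<n}; \<not> reducedD n ws\<rbrakk> \<Longrightarrow> low (length ws) (psiword ws)"
proof (induction ws)
  case Nil
  then show ?case by (simp add: reducedD_iff)
next
  case (Cons a ws)
  have a: "a < n" and ws: "set ws \<subseteq> {0..<n}" using Cons.prems by auto
  show ?case
  proof (cases "reducedD n ws")
    case False
    then have "low (length ws) (psiword ws)" using Cons.IH ws by simp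
    then show ?thesis using low_mult_le[OF low_psi[OF a, of 2]] by simp
  next
    case True
    obtain us b vs where ex: "ws = us @ b # vs" "wprod genD (a # us @ vs) = wprod genD ws"
      using exchange[OF True a Cons.prems(2)] by metis
    have "reducedD n (a # us @ vs)"
      by (rule reducedD_cong[OF True _ ex(2)]) (use ws a ex in auto)
    then have "low (length ws) (psiword ws - psiword (a # us @ vs))"
      using braid_equiv_low[OF braid_equiv_reduced[OF True _ ex(2)[symmetric]]] by blast
    then have 1: "low (Suc (length ws)) (psi a * (psiword ws - psiword (a # us @ vs)))"
      using low_mult_le[OF low_psi[OF a, of 2]] by simp
    have "low (length ws) (psiword (us @ vs))"
      by (rule low_psiword) (use ws ex in auto)
    then have 2: "low (Suc (length ws)) (psi a * psi a * psiword (us @ vs))"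
      using low_mult_le[OF psi_square_low[OF a]] by simp
    have "psiword (a # ws) = psi a * (psiword ws - psiword (a # us @ vs)) + psi a * psi a * psiword (us @ vs)"
      by (simp add: algebra_simps)
    then show ?thesis using low.add[OF 1 2] by simp
  qed
qed


section \<open>The spanning set of W\<close>

definition ymonom :: "(nat \<Rightarrow> nat) \<Rightarrow> 'k klr"
  where "ymonom m = prod_list (map (\<lambda>j. yy j ^ m j) [1..<n + 1])"

lemma yy_mult_ymonom:
  assumes j: "j \<in> {1..n}"
  shows "eqW (yy j * ymonom m) (ymonom (m(j := Suc (m j))))"
proof -
  have pow: "eqW (yy j * yy k ^ e) (yy k ^ e * yy j)" if "k \<in> {1..n}" for k e
  proof (induction e)
    case (Suc e)
    have "eqW (yy j * yy k * yy k ^ e) (yy k * yy j * yy k ^ e)"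
      by (intro equ_mult_right W_common common_rel.y_y j that)
    also have "yy k * yy j * yy k ^ e = yy k * (yy j * yy k ^ e)" by (simp add: mult.assoc)
    also have "eqW \<dots> (yy k * (yy k ^ e * yy j))" by (rule equ_mult_left[OF Suc])
    finally show ?case by (simp add: mult.assoc)
  qed simp
  have "eqW (yy j * prod_list (map (\<lambda>k. yy k ^ m k) ks)) (prod_list (map (\<lambda>k. yy k ^ (m(j := Suc (m j))) k) ks))"
    if "set ks \<subseteq> {1..n}" "distinct ks" "j \<in> set ks" for ks
    using that
  proof (induction ks)
    case (Cons k ks)
    let ?m = "m(j := Suc (m j))"
    let ?P = "\<lambda>m. prod_list (map (\<lambda>k. yy k ^ m k) ks) :: 'k klr"
    show ?case
    proof (cases "k = j")
      case True
      then have "map (\<lambda>k. yy k ^ ?m k) ks = map (\<lambda>k. yy k ^ m k :: 'k klr) ks" using Cons.prems by auto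
      then have "?P ?m = ?P m" by (simp only:)
      then show ?thesis using True by (simp add: mult.assoc del: fun_upd_apply) (simp add: mult.assoc)
    next
      case False
      have "eqW (yy j * yy k ^ m k * ?P m) (yy k ^ m k * yy j * ?P m)"
        using Cons.prems by (intro equ_mult_right pow) auto
      also have "yy k ^ m k * yy j * ?P m = yy k ^ m k * (yy j * ?P m)" by (simp add: mult.assoc)
      also have "eqW \<dots> (yy k ^ m k * ?P ?m)" using Cons False by (intro equ_mult_left) auto
      finally show ?thesis using False by (simp add: mult.assoc)
    qed
  qed simp
  moreover have "set [1..<n + 1] \<subseteq> {1..n}" "distinct [1..<n + 1]" "j \<in> set [1..<n + 1]"
    using j by auto
  ultimately show ?thesis unfolding ymonom_def by blast
qed

lemma yword_ymonom: "set js \<subseteq> {1..n} \<Longrightarrow> \<exists>m. (\<forall>j. j \<notin> {1..n} \<longrightarrow> m j = 0) \<and> eqW (yword js) (ymonom m)"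
proof (induction js)
  case Nil
  have "prod_list (map (\<lambda>j. yy j ^ 0) xs) = (1 :: 'k klr)" for xs by (induction xs) auto
  then show ?case by (intro exI[of _ "\<lambda>_. 0"]) (simp add: ymonom_def)
next
  case (Cons j js)
  then obtain m where m: "\<forall>j. j \<notin> {1..n} \<longrightarrow> m j = 0" "eqW (yword js) (ymonom m)" by auto
  have "eqW (yword (j # js)) (yy j * ymonom m)" using m by (simp add: equ_mult_left)
  also have "eqW \<dots> (ymonom (m(j := Suc (m j))))" using Cons by (intro yy_mult_ymonom) auto
  finally have "eqW (yword (j # js)) (ymonom (m(j := Suc (m j))))" .
  moreover have "\<forall>l. l \<notin> {1..n} \<longrightarrow> (m(j := Suc (m j))) l = 0" using m(1) Cons.prems by auto
  ultimately show ?case by blast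
qed

end

locale klr_red = klr n q \<beta> for n and q :: "'k::field" and \<beta> +
  fixes red :: "(int \<Rightarrow> int) \<Rightarrow> nat list"
  assumes redD: "w \<in> weyl genD n \<Longrightarrow> reduced_expr genD n w (red w)"
    and redB: "w \<in> weyl genD n \<Longrightarrow> reduced_expr genB n w (D_to_B (red w))"
begin

text \<open>The exponents vanish outside \<open>{1..n}\<close>, so that a monomial determines its exponent function.\<close>

definition basis_index :: "((int \<Rightarrow> int) \<times> (nat \<Rightarrow> nat) \<times> (nat \<Rightarrow> 'k)) set"
  where "basis_index = {(w, m, i). w \<in> weyl genD n \<and> (\<forall>j. j \<notin> {1..n} \<longrightarrow> m j = 0) \<and> i \<in> \<beta>}"

definition basis_elem :: "(int \<Rightarrow> int) \<times> (nat \<Rightarrow> nat) \<times> (nat \<Rightarrow> 'k) \<Rightarrow> 'k klr"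
  where "basis_elem = (\<lambda>(w, m, i). ymonom m * psiword (red w) * ee i)"

definition spanned :: "'k klr \<Rightarrow> bool"
  where "spanned p \<longleftrightarrow> (\<exists>A a. finite A \<and> A \<subseteq> basis_index \<and> eqW p (\<Sum>x\<in>A. scal (a x) * basis_elem x))"

lemma spanned_0: "spanned 0"
  unfolding spanned_def by (rule exI[of _ "{}"]) simp

lemma spanned_equ: "\<lbrakk>spanned p; eqW p r\<rbrakk> \<Longrightarrow> spanned r"
  unfolding spanned_def by (meson equ_sym equ_trans)

lemma spanned_scal: "spanned p \<Longrightarrow> spanned (scal c * p)"
proof -
  assume "spanned p"
  then obtain A a where A: "finite A" "A \<subseteq> basis_index" "eqW p (\<Sum>x\<in>A. scal (a x) * basis_elem x)"
    unfolding spanned_def by blast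
  then have "eqW (scal c * p) (\<Sum>x\<in>A. scal (c * a x) * basis_elem x)"
    using equ_mult_left[OF A(3), of "scal c"] by (simp add: sum_distrib_left scal_mult mult.assoc)
  then show ?thesis using A(1,2) unfolding spanned_def by (intro exI[of _ A] exI[of _ "\<lambda>x. c * a x"]) simp
qed

lemma spanned_add: "\<lbrakk>spanned p; spanned r\<rbrakk> \<Longrightarrow> spanned (p + r)"
proof -
  assume "spanned p" "spanned r"
  then obtain A a B b where A: "finite A" "A \<subseteq> basis_index" "eqW p (\<Sum>x\<in>A. scal (a x) * basis_elem x)"
    and B: "finite B" "B \<subseteq> basis_index" "eqW r (\<Sum>x\<in>B. scal (b x) * basis_elem x)"
    unfolding spanned_def by blast
  let ?c = "\<lambda>x. (if x \<in> A then a x else 0) + (if x \<in> B then b x else 0)"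
  have "(\<Sum>x\<in>A. scal (a x) * basis_elem x) = (\<Sum>x\<in>A \<union> B. scal (if x \<in> A then a x else 0) * basis_elem x)"
    using A B by (intro sum.mono_neutral_cong_left) (auto simp: scal_0)
  moreover have "(\<Sum>x\<in>B. scal (b x) * basis_elem x) = (\<Sum>x\<in>A \<union> B. scal (if x \<in> B then b x else 0) * basis_elem x)"
    using A B by (intro sum.mono_neutral_cong_left) (auto simp: scal_0)
  ultimately have "eqW (p + r) (\<Sum>x\<in>A \<union> B. scal (?c x) * basis_elem x)"
    using equ_add[OF A(3) B(3)] by (simp only: scal_add distrib_right sum.distrib)
  then show ?thesis using A B unfolding spanned_def by (intro exI[of _ "A \<union> B"] exI[of _ ?c]) auto
qed

lemma spanned_sum: "(\<And>x. x \<in> A \<Longrightarrow> spanned (f x)) \<Longrightarrow> spanned (sum f A)"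
  by (induction A rule: infinite_finite_induct) (auto intro: spanned_0 spanned_add)

lemma spanned_basis_elem: "x \<in> basis_index \<Longrightarrow> spanned (basis_elem x)"
  unfolding spanned_def by (intro exI[of _ "{x}"] exI[of _ "\<lambda>_. 1"]) (simp add: scal_1)

text \<open>Induction on the number of letters \<open>Psi a\<close>. A word has a leading term with the \<open>Psi a\<close> collected in
  the middle; there they form a word that is lower if it is not reduced, and otherwise
  can be replaced by the chosen reduced word of the same element.\<close>

lemma low_spanned: "low k p \<Longrightarrow> spanned p"
proof (induction k arbitrary: p rule: less_induct)
  case (less k)
  show ?case using less.prems
  proof (induction rule: low.induct)
    case (word u c)
    let ?ws = "psis u"
    have IH: "spanned r" if "low (length ?ws) r" for r using less.IH that word(2) by blast
    have ws: "set ?ws \<subseteq> {0..<n}" using word(1) by (induction u) (auto simp: klr_gens_def)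
    have "spanned (word u * ee i)" if i: "i \<in> \<beta>" for i
    proof -
      obtain d js where js: "set js \<subseteq> {1..n}"
        "low (length ?ws) (word u * ee i - scal d * (yword js * psiword ?ws * ee i))"
        using word_leading[OF word(1) i] by blast
      have sandwich: "spanned (yword js * r * ee i)" if "low (length ?ws) r" for r
        using low_mult_le[OF low_mult_le[OF low_yword[OF js(1)] that, of "length ?ws"] low_ee[OF i, of 1], of "length ?ws"]
        by (intro IH) simp
      have "spanned (yword js * psiword ?ws * ee i)"
      proof (cases "reducedD n ?ws")
        case False
        then show ?thesis using nonreduced_low[OF ws] by (intro sandwich)
      next
        case True
        define w where "w = wprod genD ?ws"
        have w: "w \<in> weyl genD n" using ws by (auto simp: weyl_def w_def)
        then have "reducedD n (red w)" "wprod genD (red w) = w"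
          using redD by (auto simp: reducedD_def reduced_expr_def)
        then have "braid_equiv n ?ws (red w)"
          using True unfolding w_def by (intro braid_equiv_reduced) simp_all
        then have "low (length ?ws) (psiword ?ws - psiword (red w))"
          using braid_equiv_low by blast
        then have 1: "spanned (yword js * (psiword ?ws - psiword (red w)) * ee i)" by (rule sandwich)
        obtain m where m: "\<forall>j. j \<notin> {1..n} \<longrightarrow> m j = 0" "eqW (yword js) (ymonom m)"
          using yword_ymonom[OF js(1)] by blast
        have "spanned (ymonom m * psiword (red w) * ee i)"
          using spanned_basis_elem[of "(w, m, i)"] m(1) w i by (simp add: basis_index_def basis_elem_def)
        then have 2: "spanned (yword js * psiword (red w) * ee i)"
          by (rule spanned_equ) (intro equ_mult_right equ_sym[OF m(2)])
        show ?thesis using spanned_add[OF 1 2] by (simp add: algebra_simps)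
      qed
      then have "spanned ((word u * ee i - scal d * (yword js * psiword ?ws * ee i)) + scal d * (yword js * psiword ?ws * ee i))"
        by (rule spanned_add[OF IH[OF js(2)] spanned_scal])
      then show ?thesis by simp
    qed
    then have "spanned (\<Sum>i\<in>\<beta>. word u * ee i)" by (rule spanned_sum)
    then show ?case using spanned_equ[OF _ eqW_sum_e] spanned_scal by blast
  qed (auto intro: spanned_0 spanned_add spanned_equ)
qed

end


section \<open>The homomorphism from W to V\<close>

context klr
begin

abbreviation "eqV \<equiv> equ (V_rel n q \<beta>)"

lemma V_relation: "V_rel n q \<beta> l r \<Longrightarrow> eqV l r"
  by (rule equ_rel)

lemma V_common: "common_rel actB n q \<beta> l r \<Longrightarrow> eqV l r"
  by (rule equ_rel[OF V_rel.common])

abbreviation Psi0 :: "'k klr" where "Psi0 \<equiv> psi 0 * psi 1 * psi 0"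

definition phi :: "'k klr \<Rightarrow> 'k klr"
  where "phi = free_hom (\<lambda>g. if g = Psi 0 then Psi0 else gen g)"

lemma phi_simps:
  "phi (p + r) = phi p + phi r" "phi (p - r) = phi p - phi r" "phi (- p) = - phi p"
  "phi (p * r) = phi p * phi r" "phi 0 = 0" "phi 1 = 1" "phi (scal c) = scal c"
  "phi (psi a) = (if a = 0 then Psi0 else psi a)" "phi (yy j) = yy j" "phi (ee i) = ee i"
  "phi (sum f A) = (\<Sum>x\<in>A. phi (f x))"
  by (simp_all add: phi_def free_hom_add free_hom_diff free_hom_uminus free_hom_mult free_hom_zero
      free_hom_one free_hom_scal free_hom_sum)

lemma phi_power: "phi (p ^ m) = phi p ^ m"
  by (induction m) (simp_all add: phi_simps)

lemma phi_2: "phi 2 = 2"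
proof -
  have "phi (1 + 1) = 1 + 1" by (simp only: phi_simps)
  then show ?thesis by simp
qed

lemma phi_closed: "p \<in> falg_on G \<Longrightarrow> phi p \<in> falg_on G"
  unfolding phi_def by (rule free_hom_closed) (use n2 in \<open>auto intro!: falg_on_mult gens_on\<close>)

text \<open>\<open>conj0 p p'\<close> expresses that conjugation by the involution \<open>psi 0\<close> takes \<open>p\<close> to \<open>p'\<close> in V. As
  it takes \<open>psi 1\<close> to the image of \<open>Psi 0\<close>, the relations for \<open>Psi 0\<close> are the conjugates of the
  relations for \<open>psi 1\<close>.\<close>

definition conj0 :: "'k klr \<Rightarrow> 'k klr \<Rightarrow> bool"
  where "conj0 p p' \<longleftrightarrow> eqV (psi 0 * p * psi 0) p'"

lemma psi0_psi0: "eqV (psi 0 * psi 0) 1"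
  using V_relation[OF V_rel.psi0_sq] by (simp add: power2_eq_square)

lemma psi0_psi0_left: "eqV (psi 0 * (psi 0 * p)) p"
  using equ_mult_right[OF psi0_psi0, of p] by (simp add: mult.assoc)

lemma conj0_transport: "\<lbrakk>eqV p r; conj0 p p'; conj0 r r'\<rbrakk> \<Longrightarrow> eqV p' r'"
  unfolding conj0_def by (meson equ_mult_left equ_mult_right equ_sym equ_trans)

lemma conj0_mult: assumes "conj0 p p'" "conj0 r r'" shows "conj0 (p * r) (p' * r')"
proof -
  have "eqV (psi 0 * p * r * psi 0) (psi 0 * p * (psi 0 * (psi 0 * (r * psi 0))))"
    using equ_mult_left[OF equ_sym[OF psi0_psi0_left], of "psi 0 * p" "r * psi 0"]
    by (simp add: mult.assoc)
  also have "\<dots> = (psi 0 * p * psi 0) * (psi 0 * r * psi 0)" by (simp add: mult.assoc)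
  also have "eqV \<dots> (p' * r')" using assms unfolding conj0_def by (rule equ_mult)
  finally show ?thesis by (simp add: conj0_def mult.assoc)
qed

lemma conj0_add: "\<lbrakk>conj0 p p'; conj0 r r'\<rbrakk> \<Longrightarrow> conj0 (p + r) (p' + r')"
  using equ_add[of "V_rel n q \<beta>" "psi 0 * p * psi 0" p' "psi 0 * r * psi 0" r']
  by (simp add: conj0_def algebra_simps)

lemma conj0_diff: "\<lbrakk>conj0 p p'; conj0 r r'\<rbrakk> \<Longrightarrow> conj0 (p - r) (p' - r')"
  using equ_diff[of "V_rel n q \<beta>" "psi 0 * p * psi 0" p' "psi 0 * r * psi 0" r']
  by (simp add: conj0_def algebra_simps)

lemma conj0_0: "conj0 0 0"
  by (simp add: conj0_def)

lemma conj0_uminus: "conj0 p p' \<Longrightarrow> conj0 (- p) (- p')"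
  using conj0_diff[OF conj0_0, of p p'] by simp

lemma conj0_1: "conj0 1 1"
  by (simp add: conj0_def psi0_psi0)

lemma conj0_2: "conj0 2 2"
  using conj0_add[OF conj0_1 conj0_1] by simp

lemma conj0_power: "conj0 p p' \<Longrightarrow> conj0 (p ^ m) (p' ^ m)"
  by (induction m) (simp_all add: conj0_1 conj0_mult)

lemma conj0_scal: "conj0 (scal c) (scal c)"
proof -
  have "psi 0 * scal c * psi 0 = scal c * (psi 0 * psi 0)" by (simp add: scal_comm mult.assoc)
  then show ?thesis using equ_mult_left[OF psi0_psi0, of "scal c"] by (simp add: conj0_def)
qed

lemma conj0_commuting: "eqV (psi 0 * p) (p' * psi 0) \<Longrightarrow> conj0 p p'"
proof -
  assume "eqV (psi 0 * p) (p' * psi 0)"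
  then have "eqV (psi 0 * p * psi 0) (p' * psi 0 * psi 0)" by (rule equ_mult_right)
  also have "p' * psi 0 * psi 0 = p' * (psi 0 * psi 0)" by (simp add: mult.assoc)
  also have "eqV \<dots> (p' * 1)" by (rule equ_mult_left[OF psi0_psi0])
  finally show ?thesis by (simp add: conj0_def)
qed

lemma conj0_psi1: "conj0 (psi 1) Psi0"
  by (simp add: conj0_def)

lemma conj0_Psi0: "conj0 Psi0 (psi 1)"
proof -
  have "eqV (psi 0 * (psi 0 * (psi 1 * (psi 0 * psi 0)))) (psi 1 * (psi 0 * psi 0))" by (rule psi0_psi0_left)
  also have "eqV \<dots> (psi 1 * 1)" by (rule equ_mult_left[OF psi0_psi0])
  finally show ?thesis by (simp add: conj0_def mult.assoc)
qed

lemma conj0_psi: "\<lbrakk>b > 1; b < n\<rbrakk> \<Longrightarrow> conj0 (psi b) (psi b)"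
  by (rule conj0_commuting, rule V_relation, rule V_rel.psi0_psi) auto

lemma conj0_y1: "conj0 (yy 1) (- yy 1)"
  by (rule conj0_commuting, rule equ_by_eq[OF V_relation[OF V_rel.psi0_y1]]) simp

lemma conj0_y: "\<lbrakk>j > 1; j \<le> n\<rbrakk> \<Longrightarrow> conj0 (yy j) (yy j)"
  by (rule conj0_commuting, rule V_relation, rule V_rel.psi0_y) auto

lemma conj0_ee: "i \<in> \<beta> \<Longrightarrow> conj0 (ee i) (ee (actB 0 i))"
  using n2 by (intro conj0_commuting V_common common_rel.psi_e) auto

lemma actB0_actB0 [simp]: "actB 0 (actB 0 i) = i"
  by (simp add: actB_def fun_eq_iff)

lemma actB0_closed: "i \<in> \<beta> \<Longrightarrow> actB 0 i \<in> \<beta>"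
  using actB_closed[of 0 i] n2 by simp

lemma conj0_ee': "i \<in> \<beta> \<Longrightarrow> conj0 (ee (actB 0 i)) (ee i)"
  using conj0_ee[OF actB0_closed, of i] by simp

lemmas conj0_intros = conj0_mult conj0_add conj0_diff conj0_uminus conj0_0 conj0_1 conj0_2 conj0_power
  conj0_psi1 conj0_Psi0 conj0_y1 conj0_ee'

text \<open>The relations of W that involve \<open>Psi 0\<close> hold for its image in V. Most are relations of V for
  \<open>psi 1\<close> at the tuple \<open>actB 0 i\<close>, conjugated by \<open>psi 0\<close>; that \<open>Psi 0\<close> and \<open>Psi 1\<close> commute is
  the braid relation of length 4.\<close>

lemma Psi0_ee:
  assumes i: "i \<in> \<beta>"
  shows "eqV (Psi0 * ee i) (ee (actD 0 i) * Psi0)"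
proof -
  let ?i = "actB 0 i"
  have "eqV (psi 1 * ee ?i) (ee (actB 1 ?i) * psi 1)"
    using n2 i by (intro V_common common_rel.psi_e actB0_closed) auto
  then show ?thesis
    by (rule conj0_transport)
      (use n2 i in \<open>auto intro!: conj0_intros conj0_ee actB_closed simp: actD_0\<close>)
qed

lemma Psi0_y:
  assumes i: "i \<in> \<beta>" and j: "j \<in> {1..n}"
  shows "eqV (Psi0 * yy j * ee i)
      (if j \<in> {1, 2} \<and> inverse (i 1) = i 2 then (- yy (transpose 1 2 j) * Psi0 + 1) * ee i
       else if j \<in> {1, 2} \<and> inverse (i 1) \<noteq> i 2 then - yy (transpose 1 2 j) * Psi0 * ee i
       else yy j * Psi0 * ee i)"
proof -
  let ?i = "actB 0 i"
  have i': "?i 1 = inverse (i 1)" "?i 2 = i 2" by (auto simp: actB_def)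
  have base: "eqV ((psi 1 * yy j - yy (transpose 1 2 j) * psi 1) * ee ?i)
     (if j = 1 \<and> inverse (i 1) = i 2 then - ee ?i else if j = 2 \<and> inverse (i 1) = i 2 then ee ?i else 0)"
    using V_common[OF common_rel.psi_y[OF _ j actB0_closed[OF i]], of 1, unfolded one_add_one i'] n2 by simp
  have y2: "conj0 (yy 2) (yy 2)" using n2 by (intro conj0_y) auto
  consider "j = 1" | "j = 2" | "j > 2" using j by fastforce
  then show ?thesis
  proof cases
    case 1
    have "eqV ((psi 1 * yy 1 - yy 2 * psi 1) * ee ?i) (if inverse (i 1) = i 2 then - ee ?i else 0)"
      using base 1 by (cases "inverse (i 1) = i 2") simp_all
    then have "eqV ((Psi0 * (- yy 1) - yy 2 * Psi0) * ee i) (if inverse (i 1) = i 2 then - ee i else 0)"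
      by (rule conj0_transport) (intro conj0_intros y2 i, use i in \<open>auto intro!: conj0_intros\<close>)
    then show ?thesis by (rule equ_by_minus) (simp add: 1 algebra_simps)
  next
    case 2
    have "eqV ((psi 1 * yy 2 - yy 1 * psi 1) * ee ?i) (if inverse (i 1) = i 2 then ee ?i else 0)"
      using base 2 by (cases "inverse (i 1) = i 2") simp_all
    then have "eqV ((Psi0 * yy 2 - (- yy 1) * Psi0) * ee i) (if inverse (i 1) = i 2 then ee i else 0)"
      by (rule conj0_transport) (intro conj0_intros y2 i, use i in \<open>auto intro!: conj0_intros\<close>)
    then show ?thesis by (rule equ_by_eq) (simp add: 2 algebra_simps)
  next
    case 3
    have "eqV ((psi 1 * yy j - yy j * psi 1) * ee ?i) 0"
      using base 3 by (simp add: transpose_def)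
    then have "eqV ((Psi0 * yy j - yy j * Psi0) * ee i) 0"
      by (rule conj0_transport) (use n2 i j 3 in \<open>auto intro!: conj0_intros conj0_y\<close>)
    then show ?thesis by (rule equ_by_eq) (use 3 in \<open>simp add: algebra_simps\<close>)
  qed
qed

lemma Psi0_psi:
  assumes "b \<in> {1..<n}" "b = 1 \<or> b > 2"
  shows "eqV (Psi0 * psi b) (psi b * Psi0)"
proof (cases "b = 1")
  case True
  then show ?thesis
    using V_relation[OF V_rel.psi0_braid] by (simp add: power2_eq_square mult.assoc)
next
  case False
  have "eqV (psi 1 * psi b) (psi b * psi 1)"
    using assms False by (intro V_common common_rel.psi_psi) auto
  then show ?thesis
    by (rule conj0_transport) (use assms False in \<open>auto intro!: conj0_intros conj0_psi\<close>)
qed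

lemma Psi0_sq:
  assumes i: "i \<in> \<beta>"
  shows "inverse (i 1) = i 2 \<Longrightarrow> eqV (Psi0 ^ 2 * ee i) 0"
    and "no_edge q (inverse (i 1)) (i 2) \<Longrightarrow> eqV (Psi0 ^ 2 * ee i) (ee i)"
    and "edge_right q (inverse (i 1)) (i 2) \<Longrightarrow> eqV (Psi0 ^ 2 * ee i) ((yy 1 + yy 2) * ee i)"
    and "edge_left q (inverse (i 1)) (i 2) \<Longrightarrow> eqV (Psi0 ^ 2 * ee i) (- (yy 1 + yy 2) * ee i)"
    and "edge_both q (inverse (i 1)) (i 2) \<Longrightarrow> eqV (Psi0 ^ 2 * ee i) (- ((yy 1 + yy 2) ^ 2) * ee i)"
proof -
  let ?i = "actB 0 i"
  have i': "?i 1 = inverse (i 1)" "?i 2 = i 2" by (auto simp: actB_def)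
  have 1: "1 \<in> {1..<n}" and n: "2 \<le> n" using n2 by auto
  have lhs: "conj0 (psi 1 ^ 2 * ee ?i) (Psi0 ^ 2 * ee i)" by (intro conj0_intros i)
  note rels = common_rel.psi_sq_eq common_rel.psi_sq_no_edge common_rel.psi_sq_right
    common_rel.psi_sq_left common_rel.psi_sq_both
  note R = rels[OF 1 actB0_closed[OF i], THEN V_common, THEN conj0_transport, OF _ lhs, unfolded one_add_one i']
  have y2: "conj0 (yy 2) (yy 2)" using n by (intro conj0_y) auto
  show "inverse (i 1) = i 2 \<Longrightarrow> eqV (Psi0 ^ 2 * ee i) 0"
    by (rule R(1)) (assumption, intro conj0_intros)
  show "no_edge q (inverse (i 1)) (i 2) \<Longrightarrow> eqV (Psi0 ^ 2 * ee i) (ee i)"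
    by (rule R(2)) (assumption, intro conj0_intros i)
  have 3: "conj0 ((yy 2 - yy 1) * ee ?i) ((yy 2 - - yy 1) * ee i)"
    by (intro conj0_intros i y2)
  have 4: "conj0 ((yy 1 - yy 2) * ee ?i) ((- yy 1 - yy 2) * ee i)"
    by (intro conj0_intros i y2)
  have 5: "conj0 ((yy 2 - yy 1) * (yy 1 - yy 2) * ee ?i) ((yy 2 - - yy 1) * (- yy 1 - yy 2) * ee i)"
    by (intro conj0_intros i y2)
  have e3: "yy 2 - - yy 1 = yy 1 + (yy 2 :: 'k klr)" and e4: "- yy 1 - yy 2 = - (yy 1 + yy 2 :: 'k klr)"
    by simp_all
  show "edge_right q (inverse (i 1)) (i 2) \<Longrightarrow> eqV (Psi0 ^ 2 * ee i) ((yy 1 + yy 2) * ee i)"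
    by (rule R(3)) (assumption, rule 3[unfolded e3])
  show "edge_left q (inverse (i 1)) (i 2) \<Longrightarrow> eqV (Psi0 ^ 2 * ee i) (- (yy 1 + yy 2) * ee i)"
    by (rule R(4)) (assumption, rule 4[unfolded e4])
  have e5: "(yy 1 + yy 2) * - (yy 1 + yy 2) = - ((yy 1 + yy 2 :: 'k klr) ^ 2)"
    by (simp only: power2_eq_square mult_minus_right)
  show "edge_both q (inverse (i 1)) (i 2) \<Longrightarrow> eqV (Psi0 ^ 2 * ee i) (- ((yy 1 + yy 2) ^ 2) * ee i)"
    by (rule R(5)) (assumption, rule 5[unfolded e3 e4 e5])
qed

lemma Psi0_braid:
  assumes n: "2 \<in> {1..<n}" and i: "i \<in> \<beta>"
  shows "eqV ((Psi0 * psi 2 * Psi0 - psi 2 * Psi0 * psi 2) * ee i)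
      (if inverse (i 1) = i 3 \<and> edge_right q (inverse (i 1)) (i 2) then ee i
       else if inverse (i 1) = i 3 \<and> edge_left q (inverse (i 1)) (i 2) then - ee i
       else if inverse (i 1) = i 3 \<and> edge_both q (inverse (i 1)) (i 2)
         then (yy 3 - 2 * yy 2 - yy 1) * ee i
       else 0)"
proof -
  let ?i = "actB 0 i"
  have i': "?i 1 = inverse (i 1)" "?i 2 = i 2" "?i 3 = i 3" by (auto simp: actB_def)
  have 1: "1 \<in> {1..<n}" "1 + 1 \<in> {1..<n}" using n by auto
  have three: "1 + 2 = (3 :: nat)" by simp
  have lhs: "conj0 ((psi 1 * psi 2 * psi 1 - psi 2 * psi 1 * psi 2) * ee ?i)
      ((Psi0 * psi 2 * Psi0 - psi 2 * Psi0 * psi 2) * ee i)"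
    using n by (intro conj0_mult conj0_diff conj0_psi1 conj0_ee' conj0_psi i) auto
  have y: "conj0 (yy 2) (yy 2)" "conj0 (yy 3) (yy 3)" using n by (auto intro!: conj0_y)
  have b: "conj0 ((yy 3 - 2 * yy 2 + yy 1) * ee ?i) ((yy 3 - 2 * yy 2 + - yy 1) * ee i)"
    by (intro conj0_mult conj0_add conj0_diff conj0_2 conj0_y1 conj0_ee' i y)
  show ?thesis
    by (rule conj0_transport[OF V_common[OF common_rel.psi_braid[OF 1 actB0_closed[OF i], unfolded one_add_one three i']] lhs])
      (use b i in \<open>auto intro!: conj0_ee' conj0_uminus conj0_0\<close>)
qed

lemma phi_rel: assumes "W_rel n q \<beta> l r" shows "eqV (phi l) (phi r)"
  using assms
proof cases
  case common
  then show ?thesis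
  proof cases
    case (psi_e a i)
    show ?thesis
    proof (cases "a = 0")
      case True then show ?thesis using Psi0_ee[OF psi_e(4)] psi_e by (simp add: phi_simps)
    next
      case False
      then have "actD a i = actB a i" by (simp add: actD_def actB_def)
      then show ?thesis using V_common[OF common_rel.psi_e[OF psi_e(3,4)]] psi_e False by (simp add: phi_simps)
    qed
  next
    case sum_e
    then show ?thesis using V_common[OF common_rel.sum_e] by (simp add: phi_simps)
  next
    case (e_e i j)
    then show ?thesis using V_common[OF common_rel.e_e[OF e_e(3,4)]] by (cases "i = j") (simp_all add: phi_simps)
  next
    case (y_y j k)
    then show ?thesis using V_common[OF common_rel.y_y[OF y_y(3,4)]] by (simp add: phi_simps)
  next
    case (y_e j i)
    then show ?thesis using V_common[OF common_rel.y_e[OF y_e(3,4)]] by (simp add: phi_simps)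
  next
    case (psi_psi b b')
    then show ?thesis using V_common[OF common_rel.psi_psi[OF psi_psi(3-5)]] by (auto simp: phi_simps)
  next
    case (psi_y b j i)
    then show ?thesis using V_common[OF common_rel.psi_y[OF psi_y(3-5)]]
      by (simp add: phi_simps if_distrib[of phi] cong: if_cong)
  next
    case (psi_sq_eq b i)
    then show ?thesis using V_common[OF common_rel.psi_sq_eq[OF psi_sq_eq(3-5)]] by (simp add: phi_simps phi_power)
  next
    case (psi_sq_no_edge b i)
    then show ?thesis using V_common[OF common_rel.psi_sq_no_edge[OF psi_sq_no_edge(3-5)]] by (simp add: phi_simps phi_power)
  next
    case (psi_sq_right b i)
    then show ?thesis using V_common[OF common_rel.psi_sq_right[OF psi_sq_right(3-5)]] by (simp add: phi_simps phi_power)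
  next
    case (psi_sq_left b i)
    then show ?thesis using V_common[OF common_rel.psi_sq_left[OF psi_sq_left(3-5)]] by (simp add: phi_simps phi_power)
  next
    case (psi_sq_both b i)
    then show ?thesis using V_common[OF common_rel.psi_sq_both[OF psi_sq_both(3-5)]] by (simp add: phi_simps phi_power)
  next
    case (psi_braid b i)
    then show ?thesis using V_common[OF common_rel.psi_braid[OF psi_braid(3-5)]]
      by (simp add: phi_simps phi_2 if_distrib[of phi] cong: if_cong)
  qed
next
  case (psi0_y j i)
  then show ?thesis using Psi0_y[of i j]
    by (simp add: phi_simps if_distrib[of phi] cong: if_cong)
next
  case (psi0_psi b)
  then show ?thesis using Psi0_psi[of b] by (auto simp: phi_simps)
next
  case (psi0_sq_eq i)
  then show ?thesis using Psi0_sq(1)[of i] by (simp add: phi_simps phi_power)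
next
  case (psi0_sq_no_edge i)
  then show ?thesis using Psi0_sq(2)[of i] by (simp add: phi_simps phi_power)
next
  case (psi0_sq_right i)
  then show ?thesis using Psi0_sq(3)[of i] by (simp add: phi_simps phi_power)
next
  case (psi0_sq_left i)
  then show ?thesis using Psi0_sq(4)[of i] by (simp only: phi_simps phi_power simp_thms if_True)
next
  case (psi0_sq_both i)
  then show ?thesis using Psi0_sq(5)[of i] by (simp only: phi_simps phi_power simp_thms if_True)
next
  case (psi0_braid i)
  then show ?thesis using Psi0_braid[of i]
    by (simp add: phi_simps phi_2 if_distrib[of phi] cong: if_cong)
qed

lemma phi_equ: "eqW p r \<Longrightarrow> eqV (phi p) (phi r)"
  unfolding phi_def by (rule free_hom_equ[OF _ phi_rel[unfolded phi_def]])


section \<open>The fixed points of the involution\<close>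

lemma rho_free_more: "rho_free (p - r) = rho_free p - rho_free r" "rho_free (- p) = - rho_free p"
  "rho_free 0 = 0" "rho_free 1 = 1" "rho_free (sum f A) = (\<Sum>x\<in>A. rho_free (f x))"
  by (simp_all add: rho_free_def free_hom_diff free_hom_uminus free_hom_zero free_hom_one free_hom_sum)

lemma rho_free_power: "rho_free (p ^ m) = rho_free p ^ m"
  by (induction m) (simp_all add: rho_free_simps rho_free_more)

lemma rho_free_2: "rho_free 2 = (2 :: 'k klr)"
proof -
  have "rho_free (1 + 1) = (1 + 1 :: 'k klr)" by (simp only: rho_free_simps rho_free_more)
  then show ?thesis by simp
qed

lemma rho_free_rho_free: "rho_free (rho_free p) = (p :: 'k klr)"
proof (induction p rule: falg_induct)
  case (single w c)
  have "rho_free (rho_free (word u)) = word u" for u :: "'k klr_gen list"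
  proof (induction u)
    case (Cons g u)
    have "rho_free (rho_free (gen g)) = (gen g :: 'k klr)"
      by (cases g) (auto simp: rho_free_simps rho_free_more)
    then show ?case using Cons by (simp add: rho_free_simps)
  qed (simp add: rho_free_more)
  then show ?case by (simp add: single_word rho_free_simps)
qed (simp_all add: rho_free_simps rho_free_more)

lemma rho_free_phi: "rho_free (phi p) = phi p"
proof (induction p rule: falg_induct)
  case (single w c)
  have "rho_free (phi (word u)) = phi (word u)" for u
  proof (induction u)
    case (Cons g u)
    have "rho_free (phi (gen g)) = phi (gen g)"
      by (cases g) (auto simp: rho_free_simps rho_free_more phi_simps)
    then show ?case using Cons by (simp add: rho_free_simps phi_simps)
  qed (simp add: rho_free_more phi_simps)
  then show ?case by (simp add: single_word rho_free_simps phi_simps)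
qed (simp_all add: rho_free_simps rho_free_more phi_simps)

lemma rho_free_closed: "p \<in> falg_on G \<Longrightarrow> rho_free p \<in> falg_on G"
  unfolding rho_free_def by (rule free_hom_closed) auto

lemma rho_rel: assumes "V_rel n q \<beta> l r" shows "eqV (rho_free l) (rho_free r)"
proof -
  note rel = V_relation[OF assms]
  show ?thesis
    using assms
  proof cases
    case common
    then show ?thesis
    proof cases
      case (psi_e a i)
      then show ?thesis using rel equ_uminus[OF rel] by (cases "a = 0") (simp_all add: rho_free_simps rho_free_more)
    qed (use rel in \<open>auto simp: rho_free_simps rho_free_more rho_free_power rho_free_2 if_distrib[of rho_free] cong: if_cong\<close>)
  qed (use rel equ_uminus[OF rel] in \<open>auto simp: rho_free_simps rho_free_more rho_free_power power2_eq_square\<close>)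
qed

lemma rho_equ: "eqV p r \<Longrightarrow> eqV (rho_free p) (rho_free r)"
  unfolding rho_free_def by (rule free_hom_equ[OF _ rho_rel[unfolded rho_free_def]])

lemma rho_cls:
  assumes p: "p \<in> falg_on G"
  shows "rho (cls G (V_rel n q \<beta>) p) = cls G (V_rel n q \<beta>) (rho_free p)"
proof -
  have 1: "rho_free r \<in> cls G (V_rel n q \<beta>) (rho_free p)" if "r \<in> cls G (V_rel n q \<beta>) p" "p \<in> falg_on G" for r p
    using that by (auto simp: V.in_cls_iff rho_free_closed intro: rho_equ)
  show ?thesis
  proof
    show "rho (cls G (V_rel n q \<beta>) p) \<subseteq> cls G (V_rel n q \<beta>) (rho_free p)"
      unfolding rho_def using 1 p by blast
    show "cls G (V_rel n q \<beta>) (rho_free p) \<subseteq> rho (cls G (V_rel n q \<beta>) p)"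
    proof
      fix r assume "r \<in> cls G (V_rel n q \<beta>) (rho_free p)"
      then have "rho_free r \<in> cls G (V_rel n q \<beta>) p"
        using 1[of r "rho_free p"] rho_free_closed[OF p] by (simp add: rho_free_rho_free)
      then show "r \<in> rho (cls G (V_rel n q \<beta>) p)"
        unfolding rho_def by (metis image_eqI rho_free_rho_free)
    qed
  qed
qed

text \<open>Conjugation by \<open>psi 0\<close> preserves the image of \<open>phi\<close>; it extends the symmetry of the Dynkin
  diagram of type D that exchanges \<open>Psi 0\<close> and \<open>Psi 1\<close>.\<close>

lemma conj0_phi: "p \<in> falg_on G \<Longrightarrow> \<exists>p'\<in>falg_on G. conj0 (phi p) (phi p')"
proof (induction rule: falg_on_induct)
  case zero
  show ?case by (rule bexI[of _ 0]) (simp_all add: phi_simps conj0_0)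
next
  case (add p r)
  then obtain p' r' where "p' \<in> falg_on G" "conj0 (phi p) (phi p')" "r' \<in> falg_on G" "conj0 (phi r) (phi r')" by blast
  then show ?case by (intro bexI[of _ "p' + r'"]) (auto simp: phi_simps conj0_add)
next
  case (word u c)
  have gen: "\<exists>p'\<in>falg_on G. conj0 (phi (gen g)) (phi p')" if "g \<in> G" for g
  proof (cases g)
    case (Psi a)
    then have a: "a < n" using that by (auto simp: klr_gens_def)
    consider "a = 0" | "a = 1" | "a > 1" by linarith
    then show ?thesis
    proof cases
      case 1
      then show ?thesis using conj0_Psi0 n2 Psi by (intro bexI[of _ "psi 1"]) (auto simp: phi_simps)
    next
      case 2
      then show ?thesis using conj0_psi1 n2 Psi by (intro bexI[of _ "psi 0"]) (auto simp: phi_simps)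
    next
      case 3
      then show ?thesis using conj0_psi a Psi by (intro bexI[of _ "psi a"]) (auto simp: phi_simps)
    qed
  next
    case (Y j)
    then have j: "1 \<le> j" "j \<le> n" using that by (auto simp: klr_gens_def)
    show ?thesis
    proof (cases "j = 1")
      case True
      then show ?thesis using conj0_y1 j Y by (intro bexI[of _ "- yy 1"]) (auto simp: phi_simps intro!: falg_on_uminus gens_on)
    next
      case False
      then show ?thesis using conj0_y j Y by (intro bexI[of _ "yy j"]) (auto simp: phi_simps)
    qed
  next
    case (E i)
    then have i: "i \<in> \<beta>" using that by (auto simp: klr_gens_def)
    then show ?thesis using conj0_ee E actB0_closed by (intro bexI[of _ "ee (actB 0 i)"]) (auto simp: phi_simps)
  qed
  have "\<exists>p'\<in>falg_on G. conj0 (phi (word u)) (phi p')"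
    using word
  proof (induction u)
    case Nil
    show ?case by (rule bexI[of _ 1]) (simp_all add: phi_simps conj0_1)
  next
    case (Cons g u)
    then obtain p' r' where "p' \<in> falg_on G" "conj0 (phi (gen g)) (phi p')" "r' \<in> falg_on G" "conj0 (phi (word u)) (phi r')"
      using gen[of g] by auto
    then show ?case by (intro bexI[of _ "p' * r'"]) (auto simp: phi_simps conj0_mult)
  qed
  then obtain p' where "p' \<in> falg_on G" "conj0 (phi (word u)) (phi p')" by blast
  then show ?case by (intro bexI[of _ "scal c * p'"]) (auto simp: phi_simps conj0_mult conj0_scal)
qed

lemma psi0_phi: assumes "p \<in> falg_on G" shows "\<exists>p'\<in>falg_on G. eqV (psi 0 * phi p) (phi p' * psi 0)"
proof -
  obtain p' where p': "p' \<in> falg_on G" "eqV (psi 0 * phi p * psi 0) (phi p')"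
    using conj0_phi[OF assms] by (auto simp: conj0_def)
  have "eqV (psi 0 * phi p * 1) (psi 0 * phi p * (psi 0 * psi 0))"
    by (rule equ_mult_left[OF equ_sym[OF psi0_psi0]])
  also have "psi 0 * phi p * (psi 0 * psi 0) = psi 0 * phi p * psi 0 * psi 0" by (simp add: mult.assoc)
  also have "eqV \<dots> (phi p' * psi 0)" by (rule equ_mult_right[OF p'(2)])
  finally show ?thesis using p'(1) by auto
qed

text \<open>Let \<open>A\<close> be the image of \<open>phi\<close>. The sum of \<open>A\<close> and \<open>A * psi 0\<close> contains 1. Left
  multiplication by \<open>psi 0\<close> exchanges the two summands, because conjugation by \<open>psi 0\<close> preserves
  \<open>A\<close>; the other generators lie in \<open>A\<close>.\<close>

lemma V_decomposition:
  "p \<in> falg_on G \<Longrightarrow> \<exists>a\<in>falg_on G. \<exists>b\<in>falg_on G. eqV p (phi a + phi b * psi 0)"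
proof (induction rule: falg_on_induct)
  case zero
  show ?case by (rule bexI[of _ 0], rule bexI[of _ 0]) (simp_all add: phi_simps)
next
  case (add p r)
  then obtain a b c d where *: "a \<in> falg_on G" "b \<in> falg_on G" "eqV p (phi a + phi b * psi 0)"
    "c \<in> falg_on G" "d \<in> falg_on G" "eqV r (phi c + phi d * psi 0)" by blast
  have "eqV (p + r) (phi (a + c) + phi (b + d) * psi 0)"
    using equ_add[OF *(3) *(6)] by (simp add: phi_simps algebra_simps)
  then show ?case using * by blast
next
  case (word u c)
  have "\<exists>a\<in>falg_on G. \<exists>b\<in>falg_on G. eqV (word u) (phi a + phi b * psi 0)"
    using word
  proof (induction u)
    case Nil
    show ?case by (rule bexI[of _ 1], rule bexI[of _ 0]) (simp_all add: phi_simps)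
  next
    case (Cons g u)
    then obtain a b where ab: "a \<in> falg_on G" "b \<in> falg_on G" "eqV (word u) (phi a + phi b * psi 0)"
      by auto
    then have g: "eqV (word (g # u)) (gen g * phi a + gen g * phi b * psi 0)"
      using equ_mult_left[OF ab(3), of "gen g"] by (simp add: algebra_simps)
    show ?case
    proof (cases "g = Psi 0")
      case False
      then have "phi (gen g) = gen g" by (cases g) (auto simp: phi_simps)
      then have "eqV (word (g # u)) (phi (gen g * a) + phi (gen g * b) * psi 0)"
        using g by (simp add: phi_simps)
      moreover have "gen g \<in> falg_on G" using Cons.prems by auto
      ultimately show ?thesis using ab by blast
    next
      case True
      obtain a' where a': "a' \<in> falg_on G" "eqV (psi 0 * phi a) (phi a' * psi 0)"
        using psi0_phi[OF ab(1)] by blast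
      obtain b' where b': "b' \<in> falg_on G" "eqV (psi 0 * phi b) (phi b' * psi 0)"
        using psi0_phi[OF ab(2)] by blast
      have "eqV (word (g # u)) (psi 0 * phi a + psi 0 * phi b * psi 0)" using g True by simp
      also have "eqV \<dots> (phi a' * psi 0 + phi b' * psi 0 * psi 0)"
        by (intro equ_add equ_mult_right a' b')
      also have "\<dots> = phi a' * psi 0 + phi b' * (psi 0 * psi 0)" by (simp add: mult.assoc)
      also have "eqV \<dots> (phi a' * psi 0 + phi b' * 1)"
        by (intro equ_add equ_mult_left psi0_psi0 equ_refl)
      also have "\<dots> = phi b' + phi a' * psi 0" by simp
      finally show ?thesis using a' b' by blast
    qed
  qed
  then obtain a b where ab: "a \<in> falg_on G" "b \<in> falg_on G" "eqV (word u) (phi a + phi b * psi 0)" by blast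
  then have "eqV (scal c * word u) (phi (scal c * a) + phi (scal c * b) * psi 0)"
    using equ_mult_left[OF ab(3), of "scal c"] by (simp add: phi_simps algebra_simps)
  then show ?case using ab by blast
qed

text \<open>The involution negates the second summand of the decomposition, so twice that summand
  vanishes at a fixed point.\<close>

lemma fixed_in_image:
  assumes char: "(2 :: 'k) \<noteq> 0" and p: "p \<in> falg_on G" and fixed: "eqV (rho_free p) p"
  shows "\<exists>a\<in>falg_on G. eqV p (phi a)"
proof -
  obtain a b where ab: "a \<in> falg_on G" "b \<in> falg_on G" "eqV p (phi a + phi b * psi 0)"
    using V_decomposition[OF p] by blast
  have "eqV (rho_free p) (phi a - phi b * psi 0)"
    using rho_equ[OF ab(3)] by (simp add: rho_free_simps rho_free_phi)
  then have "eqV (phi a + phi b * psi 0) (phi a - phi b * psi 0)"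
    using fixed ab(3) equ_sym equ_trans by meson
  then have "eqV (phi b * psi 0 + phi b * psi 0) 0"
    by (rule equ_by_eq) simp
  moreover have "phi b * psi 0 + phi b * psi 0 = scal 2 * (phi b * psi 0)"
    by (simp only: one_add_one[symmetric] scal_add scal_1 distrib_right mult_1_left)
  ultimately have "eqV (scal (inverse 2) * (scal 2 * (phi b * psi 0))) (scal (inverse 2) * 0)"
    by (intro equ_mult_left) simp
  then have "eqV (phi b * psi 0) 0" using char by (simp add: scal_scal scal_1)
  then have "eqV (phi a + phi b * psi 0) (phi a + 0)" by (intro equ_add equ_refl)
  then show ?thesis using ab equ_trans by (metis add.right_neutral)
qed

end


section \<open>Signed permutations acting on rational functions\<close>

type_synonym 'k pol = "(nat \<Rightarrow>\<^sub>0 nat) \<Rightarrow>\<^sub>0 'k"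
type_synonym 'k ratf = "'k pol fract"

lemma poly_mapping_induct [case_names zero single add]:
  assumes "P 0" "\<And>m c. P (Poly_Mapping.single m c)" "\<And>p r. P p \<Longrightarrow> P r \<Longrightarrow> P (p + r)"
  shows "P (p :: 'a \<Rightarrow>\<^sub>0 'b::comm_monoid_add)"
proof -
  have P: "P (sum (\<lambda>w. Poly_Mapping.single w (g w)) S)" if "finite S" for S g
    using that by (induction S) (auto intro: assms)
  have "p = (\<Sum>w\<in>Poly_Mapping.keys p. Poly_Mapping.single w (Poly_Mapping.lookup p w))"
    by (rule poly_mapping_eqI) (simp add: lookup_sum lookup_single when_def in_keys_iff)
  then show ?thesis using P[of "Poly_Mapping.keys p" "Poly_Mapping.lookup p"] by simp
qed

text \<open>The variable \<open>k\<close> with \<open>k \<ge> 1\<close> stands for $y_k$. The generator \<open>genB a\<close> permutes the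
  monomials up to a sign, which is \<open>- 1\<close> only for \<open>a = 0\<close> and odd degree in $y_1$.\<close>

definition mon_perm :: "nat \<Rightarrow> (nat \<Rightarrow>\<^sub>0 nat) \<Rightarrow> nat \<Rightarrow>\<^sub>0 nat"
  where "mon_perm a = (if a = 0 then id else Poly_Mapping.map_key (transpose a (a + 1)))"

definition mon_sign :: "nat \<Rightarrow> (nat \<Rightarrow>\<^sub>0 nat) \<Rightarrow> 'k::field"
  where "mon_sign a m = (if a = 0 then (- 1) ^ Poly_Mapping.lookup m 1 else 1)"

definition pol_act :: "nat \<Rightarrow> 'k::field pol \<Rightarrow> 'k pol"
  where "pol_act a p = (\<Sum>m\<in>Poly_Mapping.keys p.
    Poly_Mapping.single (mon_perm a m) (mon_sign a m * Poly_Mapping.lookup p m))"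

lemma inj_transpose: "inj (transpose a (b :: nat))"
  by (rule inj_on_inverseI[where g = "transpose a b"]) simp

lemma mon_perm_add: "mon_perm a (m + m') = mon_perm a m + mon_perm a m'"
  by (simp add: mon_perm_def map_key_plus inj_transpose)

lemma mon_perm_0: "mon_perm a 0 = 0"
  by (simp add: mon_perm_def inj_transpose)

lemma mon_sign_add: "mon_sign a (m + m') = mon_sign a m * mon_sign a m'"
  by (simp add: mon_sign_def lookup_add power_add)

lemma mon_sign_0: "mon_sign a 0 = 1"
  by (simp add: mon_sign_def)

lemma mon_perm_invol: "mon_perm a (mon_perm a m) = m"
  by (rule poly_mapping_eqI) (simp add: mon_perm_def map_key.rep_eq inj_transpose)

lemma mon_sign_invol: "mon_sign a (mon_perm a m) * mon_sign a m = (1 :: 'k::field)"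
  by (simp add: mon_sign_def mon_perm_def power_mult_distrib[symmetric])

lemma pol_act_superset:
  assumes "finite S" "Poly_Mapping.keys p \<subseteq> S"
  shows "pol_act a p = (\<Sum>m\<in>S. Poly_Mapping.single (mon_perm a m) (mon_sign a m * Poly_Mapping.lookup p m))"
  unfolding pol_act_def
  by (rule sum.mono_neutral_left) (use assms in \<open>auto simp: in_keys_iff\<close>)

lemma pol_act_single: "pol_act a (Poly_Mapping.single m c) = Poly_Mapping.single (mon_perm a m) (mon_sign a m * c)"
  by (cases "c = 0") (simp_all add: pol_act_def)

lemma pol_act_0: "pol_act a 0 = 0"
  by (simp add: pol_act_def)

lemma pol_act_add: "pol_act a (p + r) = pol_act a p + pol_act a r"
proof -
  let ?S = "Poly_Mapping.keys p \<union> Poly_Mapping.keys r"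
  have "finite ?S" by simp
  note * = pol_act_superset[OF this]
  show ?thesis
    by (subst (1 2 3) *)
      (use keys_add[of p r] in \<open>auto simp: lookup_add single_add distrib_left sum.distrib\<close>)
qed

lemma pol_act_mult: "pol_act a (p * r) = pol_act a p * pol_act a r"
proof (induction p rule: poly_mapping_induct)
  case (single m c)
  show ?case
  proof (induction r rule: poly_mapping_induct)
    case (single m' d)
    show ?case
      by (simp add: mult_single pol_act_single mon_perm_add mon_sign_add mult.assoc mult.left_commute)
  qed (simp_all add: pol_act_0 pol_act_add distrib_left)
qed (simp_all add: pol_act_0 pol_act_add distrib_right)

lemma pol_act_invol: "pol_act a (pol_act a p) = (p :: 'k::field pol)"
proof (induction p rule: poly_mapping_induct)
  case (single m c)
  have "mon_sign a (mon_perm a m) * (mon_sign a m * c) = c"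
    by (simp only: mult.assoc[symmetric] mon_sign_invol mult_1_left)
  then show ?case by (simp only: pol_act_single mon_perm_invol)
qed (simp_all add: pol_act_0 pol_act_add)

text \<open>The automorphism of the field of fractions; by \<open>sg_Fract\<close> all representations as a fraction
  give the same value.\<close>

definition sg :: "nat \<Rightarrow> 'k::field ratf \<Rightarrow> 'k ratf"
  where "sg a x = (SOME z. \<exists>p r. r \<noteq> 0 \<and> x = Fraction_Field.Fract p r
    \<and> z = Fraction_Field.Fract (pol_act a p) (pol_act a r))"

lemma sg_Fract:
  assumes "r \<noteq> 0"
  shows "sg a (Fraction_Field.Fract p r) = Fraction_Field.Fract (pol_act a p) (pol_act a r)"
proof -
  have nz: "pol_act a r \<noteq> 0" if "r \<noteq> 0" for r :: "'a pol"
    using that pol_act_invol[of a r] by (metis pol_act_0)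
  have "z = Fraction_Field.Fract (pol_act a p) (pol_act a r)"
    if "s \<noteq> 0" "Fraction_Field.Fract p r = Fraction_Field.Fract o' s"
      "z = Fraction_Field.Fract (pol_act a o') (pol_act a s)" for z o' s
  proof -
    have "p * s = o' * r" using that assms by (simp add: eq_fract)
    then have "pol_act a p * pol_act a s = pol_act a o' * pol_act a r" by (metis pol_act_mult)
    then show ?thesis using that(3) nz[OF assms] nz[OF that(1)] by (simp add: eq_fract)
  qed
  then show ?thesis unfolding sg_def using assms by (intro some_equality) blast+
qed

definition const :: "'k::field \<Rightarrow> 'k ratf"
  where "const c = to_fract (Poly_Mapping.single 0 c)"

definition yv :: "nat \<Rightarrow> 'k::field ratf"
  where "yv j = to_fract (Poly_Mapping.single (Poly_Mapping.single j 1) 1)"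

lemma pol_act_1: "pol_act a 1 = 1"
  using pol_act_single[of a 0 1] by (simp add: mon_perm_0 mon_sign_0)

lemma sg_add: "sg a (x + y) = sg a x + sg a y"
proof -
  obtain p r s t where "x = Fraction_Field.Fract p r" "r \<noteq> 0" "y = Fraction_Field.Fract s t" "t \<noteq> 0"
    by (metis Fract_cases)
  moreover have "pol_act a r \<noteq> 0" if "r \<noteq> 0" for r :: "'a pol"
    using that pol_act_invol[of a r] by (metis pol_act_0)
  ultimately show ?thesis by (simp add: sg_Fract pol_act_mult pol_act_add)
qed

lemma sg_mult: "sg a (x * y) = sg a x * sg a y"
proof -
  obtain p r s t where "x = Fraction_Field.Fract p r" "r \<noteq> 0" "y = Fraction_Field.Fract s t" "t \<noteq> 0"
    by (metis Fract_cases)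
  then show ?thesis by (simp add: sg_Fract pol_act_mult)
qed

lemma sg_to_fract: "sg a (to_fract p) = to_fract (pol_act a p)"
  by (simp add: to_fract_def sg_Fract pol_act_1)

lemma sg_1 [simp]: "sg a 1 = 1"
  using sg_to_fract[of a 1] by (simp add: pol_act_1)

lemma sg_0 [simp]: "sg a 0 = 0"
  using sg_to_fract[of a 0] by (simp add: pol_act_0)

lemma sg_const [simp]: "sg a (const c) = const c"
  by (simp add: const_def sg_to_fract pol_act_single mon_perm_0 mon_sign_0)

lemma sg_uminus: "sg a (- x) = - sg a x"
  using sg_add[of a x "- x"] by (simp add: eq_neg_iff_add_eq_0 add.commute)

lemma sg_diff: "sg a (x - y) = sg a x - sg a y"
  using sg_add[of a x "- y"] by (simp add: sg_uminus)

lemma sg_inverse: "sg a (inverse x) = inverse (sg a x)"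
proof (cases "x = 0")
  case False
  then have "sg a x * sg a (inverse x) = 1" by (simp flip: sg_mult)
  then show ?thesis by (metis inverse_unique)
qed simp

lemma sg_divide: "sg a (x / y) = sg a x / sg a y"
  by (simp add: divide_inverse sg_mult sg_inverse)

lemma sg_yv: "sg a (yv j) = (if a = 0 then if j = 1 then - yv 1 else yv j else yv (transpose a (a + 1) j))"
proof -
  have "Poly_Mapping.map_key (transpose a (a + 1)) (Poly_Mapping.single j (1::nat))
      = Poly_Mapping.single (transpose a (a + 1) j) 1"
    using map_key_single[OF inj_transpose, of a "a + 1" "transpose a (a + 1) j" "1::nat"] by simp
  then show ?thesis
    by (auto simp: yv_def sg_to_fract pol_act_single mon_perm_def mon_sign_def lookup_single when_def
        single_uminus simp flip: to_fract_uminus)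
qed

lemma yv_inject: "yv i = yv j \<longleftrightarrow> i = j"
  by (auto simp: yv_def dest!: arg_cong[where f = Poly_Mapping.keys])

text \<open>The linear form $y$ at the vector encoded by an integer. On these forms the substitution \<open>sg a\<close>
  acts as \<open>genB a\<close> does on the vectors, and they are pairwise distinct unless \<open>2 = 0\<close>. So the
  substitutions along a word depend exactly on the element of the group of type B that it represents
  (\<open>sgw_cong\<close>, \<open>sgw_inject\<close>).\<close>

definition yl :: "int \<Rightarrow> 'k::field ratf"
  where "yl x = (if x \<ge> 0 then yv (nat x) else - yv (nat (- x)))"

lemma sg_yl: "sg a (yl x) = yl (genB a x)"
proof (cases "a = 0")
  case True
  then show ?thesis by (auto simp: yl_def genB_def transpose_def sg_yv sg_uminus One_nat_def)
next
  case False
  consider "x = int a" | "x = int a + 1" | "x = - int a" | "x = - int a - 1"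
    | "x \<noteq> int a" "x \<noteq> int a + 1" "x \<noteq> - int a" "x \<noteq> - int a - 1" by blast
  then show ?thesis
    by cases (use False in \<open>auto simp: yl_def genB_def transpose_def sg_yv sg_uminus nat_add_distrib One_nat_def\<close>)
qed

lemma yl_inject:
  assumes "(2 :: 'k::field) \<noteq> 0"
  shows "yl x = (yl y :: 'k ratf) \<longleftrightarrow> x = y"
proof -
  have neg: "yv i \<noteq> - (yv j :: 'k ratf)" for i j
  proof
    assume "yv i = - (yv j :: 'k ratf)"
    then have "Poly_Mapping.single (Poly_Mapping.single i 1) 1 = - Poly_Mapping.single (Poly_Mapping.single j (1::nat)) (1 :: 'k)"
      by (simp add: yv_def flip: to_fract_uminus)
    then have eq: "Poly_Mapping.single (Poly_Mapping.single i 1) 1 = Poly_Mapping.single (Poly_Mapping.single j (1::nat)) (- 1 :: 'k)"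
      by (simp add: single_uminus)
    then have "Poly_Mapping.single i (1::nat) = Poly_Mapping.single j 1"
      by (auto dest!: arg_cong[where f = Poly_Mapping.keys])
    then have "1 = (- 1 :: 'k)" using arg_cong[OF eq, of "\<lambda>p. Poly_Mapping.lookup p (Poly_Mapping.single i 1)"] by simp
    then have "(1 + 1 :: 'k) = 0" by (metis add.right_inverse)
    then show False using assms by simp
  qed
  then have neg': "- yv i \<noteq> (yv j :: 'k ratf)" for i j by (metis minus_minus)
  show ?thesis using neg neg' by (auto simp: yl_def yv_inject)
qed

lemma ring_hom_determined:
  fixes f g :: "'k::field ratf \<Rightarrow> 'k ratf"
  assumes f: "\<And>x y. f (x + y) = f x + f y" "\<And>x y. f (x * y) = f x * f y" "\<And>c. f (const c) = const c"
    and g: "\<And>x y. g (x + y) = g x + g y" "\<And>x y. g (x * y) = g x * g y" "\<And>c. g (const c) = const c"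
    and eq: "\<And>j. f (yv j) = g (yv j)"
  shows "f = g"
proof
  have const_1: "const 1 = (1 :: 'k ratf)" by (simp add: const_def)
  have one: "f 1 = 1" "g 1 = 1" using f(3)[of 1] g(3)[of 1] by (simp_all add: const_1)
  have zero: "f 0 = 0" "g 0 = 0" by (metis add.right_neutral add_left_imp_eq f(1), metis add.right_neutral add_left_imp_eq g(1))
  have mon: "f (to_fract (Poly_Mapping.single m 1)) = g (to_fract (Poly_Mapping.single m 1))" for m
  proof (induction m rule: poly_mapping_induct)
    case zero show ?case by (simp add: one)
  next
    case (single j e)
    show ?case
    proof (induction e)
      case 0 then show ?case using one by simp
    next
      case (Suc e)
      have "Poly_Mapping.single j (Suc e) = Poly_Mapping.single j 1 + Poly_Mapping.single j e"
        by (simp add: One_nat_def flip: single_add)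
      then have "to_fract (Poly_Mapping.single (Poly_Mapping.single j (Suc e)) 1)
        = yv j * to_fract (Poly_Mapping.single (Poly_Mapping.single j e) (1 :: 'k))"
        by (simp add: yv_def mult_single flip: to_fract_mult)
      then show ?case using Suc by (simp add: f g eq)
    qed
  next
    case (add m m')
    have "to_fract (Poly_Mapping.single (m + m') (1 :: 'k)) = to_fract (Poly_Mapping.single m 1) * to_fract (Poly_Mapping.single m' 1)"
      by (simp add: mult_single flip: to_fract_mult)
    then show ?case using add by (simp add: f g)
  qed
  have pol: "f (to_fract p) = g (to_fract p)" for p
  proof (induction p rule: poly_mapping_induct)
    case (single m c)
    have "to_fract (Poly_Mapping.single m c) = const c * to_fract (Poly_Mapping.single m 1)"
      by (simp add: const_def mult_single flip: to_fract_mult)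
    then show ?case by (simp add: f g mon)
  qed (simp_all add: zero f g)
  have inv: "f (inverse x) = inverse (f x)" "g (inverse x) = inverse (g x)" for x
  proof -
    show "f (inverse x) = inverse (f x)"
      using f(2)[of x "inverse x"] one zero by (cases "x = 0") (simp_all add: inverse_unique)
    show "g (inverse x) = inverse (g x)"
      using g(2)[of x "inverse x"] one zero by (cases "x = 0") (simp_all add: inverse_unique)
  qed
  fix x :: "'k ratf"
  obtain p r where x: "x = Fraction_Field.Fract p r" "r \<noteq> 0" by (metis Fract_cases)
  then have "x = to_fract p * inverse (to_fract r)" by (simp add: to_fract_def)
  then show "f x = g x" by (simp add: f g inv pol)
qed

definition sgw :: "nat list \<Rightarrow> 'k::field ratf \<Rightarrow> 'k ratf"
  where "sgw ws = foldr (\<circ>) (map sg ws) id"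

lemma sgw_simps [simp]: "sgw [] = id" "sgw (a # ws) = sg a \<circ> sgw ws"
  by (simp_all add: sgw_def)

lemma sgw_mult: "sgw ws (x * y) = sgw ws x * sgw ws y"
  by (induction ws) (simp_all add: sg_mult)

lemma sgw_add: "sgw ws (x + y) = sgw ws x + sgw ws y"
  by (induction ws) (simp_all add: sg_add)

lemma sgw_1: "sgw ws 1 = 1"
  by (induction ws) simp_all

lemma sgw_0: "sgw ws 0 = 0"
  by (induction ws) simp_all

lemma sgw_const: "sgw ws (const c) = const c"
  by (induction ws) simp_all

lemma sgw_yl: "sgw ws (yl x) = yl (wprod genB ws x)"
  by (induction ws) (simp_all add: sg_yl)

lemma sgw_cong:
  assumes "wprod genB us = wprod genB vs" shows "sgw us = (sgw vs :: 'k::field ratf \<Rightarrow> 'k ratf)"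
proof (rule ring_hom_determined)
  fix j
  have "yv j = (yl (int j) :: 'k ratf)" by (simp add: yl_def)
  moreover have "sgw us (yl (int j)) = (sgw vs (yl (int j)) :: 'k ratf)" by (simp only: sgw_yl assms)
  ultimately show "sgw us (yv j) = (sgw vs (yv j) :: 'k ratf)" by (simp only:)
qed (simp_all add: sgw_add sgw_mult sgw_const)

lemma sgw_inject:
  assumes "(2 :: 'k::field) \<noteq> 0" "sgw us = (sgw vs :: 'k ratf \<Rightarrow> 'k ratf)"
  shows "wprod genB us = wprod genB vs"
proof
  fix x
  have "yl (wprod genB us x) = (yl (wprod genB vs x) :: 'k ratf)"
    using assms(2) by (simp flip: sgw_yl)
  then show "wprod genB us x = wprod genB vs x" using yl_inject[OF assms(1)] by blast
qed

lemma genB_invol: "genB a \<circ> genB a = id"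
  by (auto simp: fun_eq_iff genB_def transpose_def)

lemma sg_sg [simp]: "sg a (sg a x) = x"
  using fun_cong[OF sgw_cong[of "[a, a]" "[]"], of x] genB_invol[of a] by simp

lemma genB_genD: "a \<ge> 1 \<Longrightarrow> genB a = genD a"
  by (simp add: genD_def)

lemma genB_comm_braid:
  shows "b > 1 \<Longrightarrow> genB 0 \<circ> genB b = genB b \<circ> genB 0"
    and "\<lbrakk>a \<ge> 1; b > a + 1\<rbrakk> \<Longrightarrow> genB a \<circ> genB b = genB b \<circ> genB a"
    and "b \<ge> 1 \<Longrightarrow> genB b \<circ> genB (b + 1) \<circ> genB b = genB (b + 1) \<circ> genB b \<circ> genB (b + 1)"
    and "genB 0 \<circ> genB 1 \<circ> genB 0 \<circ> genB 1 = genB 1 \<circ> genB 0 \<circ> genB 1 \<circ> genB 0"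
proof -
  show "genB 0 \<circ> genB b = genB b \<circ> genB 0" if b: "b > 1"
  proof
    fix z
    have fix1: "genB b 1 = 1" "genB b (- 1) = - 1" using b by (simp_all add: genB_def)
    have "genB b (genB b y) = y" for y using genB_invol[of b] by (simp add: fun_eq_iff)
    then have "genB b z = 1 \<longleftrightarrow> z = 1" "genB b z = - 1 \<longleftrightarrow> z = - 1" using fix1 by metis+
    then show "(genB 0 \<circ> genB b) z = (genB b \<circ> genB 0) z"
      using fix1 by (simp add: genB_def[of 0] transpose_def)
  qed
  show "\<lbrakk>a \<ge> 1; b > a + 1\<rbrakk> \<Longrightarrow> genB a \<circ> genB b = genB b \<circ> genB a"
    using genD_commute[of a b] by (simp add: genB_genD adjD_def)
  show "b \<ge> 1 \<Longrightarrow> genB b \<circ> genB (b + 1) \<circ> genB b = genB (b + 1) \<circ> genB b \<circ> genB (b + 1)"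
    using genD_braid[of b "b + 1"] by (simp add: genB_genD adjD_def)
  show "genB 0 \<circ> genB 1 \<circ> genB 0 \<circ> genB 1 = genB 1 \<circ> genB 0 \<circ> genB 1 \<circ> genB 0"
  proof
    fix z :: int
    consider "z = 1" | "z = - 1" | "z = 2" | "z = - 2" | "z \<noteq> 1" "z \<noteq> - 1" "z \<noteq> 2" "z \<noteq> - 2" by blast
    then show "(genB 0 \<circ> genB 1 \<circ> genB 0 \<circ> genB 1) z = (genB 1 \<circ> genB 0 \<circ> genB 1 \<circ> genB 0) z"
      by cases (simp_all add: genB_def transpose_def)
  qed
qed

lemma sg_comm_0: "b > 1 \<Longrightarrow> sg 0 (sg b x) = sg b (sg 0 x)"
  using fun_cong[OF sgw_cong[of "[0, b]" "[b, 0]"], of x] genB_comm_braid(1)[of b] by (simp add: comp_assoc)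

lemma sg_comm: "\<lbrakk>a \<ge> 1; b > a + 1\<rbrakk> \<Longrightarrow> sg a (sg b x) = sg b (sg a x)"
  using fun_cong[OF sgw_cong[of "[a, b]" "[b, a]"], of x] genB_comm_braid(2)[of a b] by (simp add: comp_assoc)

lemma sg_braid: "b \<ge> 1 \<Longrightarrow> sg b (sg (b + 1) (sg b x)) = sg (b + 1) (sg b (sg (b + 1) x))"
  using fun_cong[OF sgw_cong[of "[b, b + 1, b]" "[b + 1, b, b + 1]"], of x] genB_comm_braid(3)[of b] by (simp add: comp_assoc)

lemma sg_braid_0: "sg 0 (sg 1 (sg 0 (sg 1 x))) = sg 1 (sg 0 (sg 1 (sg 0 x)))"
  using fun_cong[OF sgw_cong[of "[0, 1, 0, 1]" "[1, 0, 1, 0]"], of x] genB_comm_braid(4) by (simp add: comp_assoc)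

lemmas sg_hom = sg_add sg_diff sg_uminus sg_mult sg_divide


section \<open>A representation of V on rational functions\<close>

lemma const_simps: "const 0 = 0" "const 1 = 1" "const (c + d) = const c + const d" "const (c * d) = const c * const d"
  by (simp_all add: const_def single_add mult_single flip: to_fract_add to_fract_mult)

text \<open>Read from both ends, an edge between \<open>x\<close> and \<open>y\<close> contributes the two factors whose product is
  the value of the square of \<open>psi b\<close>: a single arrow contributes a difference of variables at its
  tail only, a double edge at both ends.\<close>

definition edge_factor :: "'k::field \<Rightarrow> 'k \<Rightarrow> 'k \<Rightarrow> 'k ratf \<Rightarrow> 'k ratf \<Rightarrow> 'k ratf"
  where "edge_factor q x y u v = (if edge_right q x y \<or> edge_both q x y then v - u else 1)"

lemma sg_edge_factor: "sg a (edge_factor q x y u v) = edge_factor q x y (sg a u) (sg a v)"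
  by (simp add: edge_factor_def sg_diff)

lemma edge_iff:
  assumes "q \<noteq> 0"
  shows "edge_right q x y \<longleftrightarrow> y = q^2 * x \<and> q^2 * (q^2 * x) \<noteq> x"
    and "edge_left q x y \<longleftrightarrow> x = q^2 * y \<and> q^2 * (q^2 * y) \<noteq> y"
    and "edge_both q x y \<longleftrightarrow> y = q^2 * x \<and> q^2 * (q^2 * x) = x"
    and "no_edge q x y \<longleftrightarrow> x \<noteq> y \<and> y \<noteq> q^2 * x \<and> x \<noteq> q^2 * y"
proof -
  define z where "z = q^2"
  have z: "z \<noteq> 0" using assms by (simp add: z_def)
  have p: "q powi 2 = z" "q powi (- 2) = inverse z"
    by (simp_all add: z_def power_int_minus)
  have 1: "y = inverse z * x \<longleftrightarrow> x = z * y" for x y using z by (auto simp: field_simps)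
  have 2: "z * x = inverse z * x \<longleftrightarrow> z * (z * x) = x" for x using z by (auto simp: field_simps)
  have 3: "inverse z * (z * x) = x" "z * (inverse z * x) = x" for x using z by (simp_all add: mult.assoc[symmetric])
  show "edge_right q x y \<longleftrightarrow> y = q^2 * x \<and> q^2 * (q^2 * x) \<noteq> x"
    unfolding edge_right_def p z_def[symmetric] by (simp only: 2)
  show "edge_left q x y \<longleftrightarrow> x = q^2 * y \<and> q^2 * (q^2 * y) \<noteq> y"
    unfolding edge_left_def p z_def[symmetric] using 1 2 3 by metis
  show "edge_both q x y \<longleftrightarrow> y = q^2 * x \<and> q^2 * (q^2 * x) = x"
    unfolding edge_both_def p z_def[symmetric] by (simp only: 2)
  show "no_edge q x y \<longleftrightarrow> x \<noteq> y \<and> y \<noteq> q^2 * x \<and> x \<noteq> q^2 * y"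
    unfolding no_edge_def p z_def[symmetric] using 1 by auto
qed

lemma edge_inverse:
  assumes "q \<noteq> 0"
  shows "edge_right q (inverse x) (inverse y) \<longleftrightarrow> edge_right q y x"
    and "edge_both q (inverse x) (inverse y) \<longleftrightarrow> edge_both q y x"
proof -
  have 1: "inverse y = q^2 * inverse x \<longleftrightarrow> x = q^2 * y"
    using assms by (cases "x = 0"; cases "y = 0") (auto simp: field_simps)
  have 2: "q^2 * (q^2 * inverse x) = inverse x \<longleftrightarrow> q^2 * (q^2 * y) = y" if "x = q^2 * y"
    using assms that by (cases "y = 0") (auto simp: field_simps)
  show "edge_right q (inverse x) (inverse y) \<longleftrightarrow> edge_right q y x"
    "edge_both q (inverse x) (inverse y) \<longleftrightarrow> edge_both q y x"
    using 1 2 by (auto simp: edge_iff[OF assms])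
qed

lemma edge_reverse:
  assumes "q \<noteq> 0"
  shows "no_edge q x y \<Longrightarrow> \<not> edge_right q x y \<and> \<not> edge_left q x y \<and> \<not> edge_both q x y
      \<and> \<not> edge_right q y x \<and> \<not> edge_both q y x"
    and "edge_right q x y \<Longrightarrow> \<not> edge_left q x y \<and> \<not> edge_both q x y \<and> \<not> edge_right q y x \<and> \<not> edge_both q y x"
    and "edge_left q x y \<Longrightarrow> \<not> edge_right q x y \<and> \<not> edge_both q x y \<and> edge_right q y x \<and> \<not> edge_both q y x"
    and "edge_both q x y \<Longrightarrow> \<not> edge_right q x y \<and> \<not> edge_left q x y \<and> \<not> edge_right q y x \<and> edge_both q y x"
proof -
  note I = edge_iff[OF assms]
  show "no_edge q x y \<Longrightarrow> \<not> edge_right q x y \<and> \<not> edge_left q x y \<and> \<not> edge_both q x y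
      \<and> \<not> edge_right q y x \<and> \<not> edge_both q y x"
    unfolding I by blast
  show "edge_right q x y \<Longrightarrow> \<not> edge_left q x y \<and> \<not> edge_both q x y \<and> \<not> edge_right q y x \<and> \<not> edge_both q y x"
    unfolding I by (elim conjE, hypsubst) metis
  show "edge_left q x y \<Longrightarrow> \<not> edge_right q x y \<and> \<not> edge_both q x y \<and> edge_right q y x \<and> \<not> edge_both q y x"
    unfolding I by (elim conjE, hypsubst) metis
  show "edge_both q x y \<Longrightarrow> \<not> edge_right q x y \<and> \<not> edge_left q x y \<and> \<not> edge_right q y x \<and> edge_both q y x"
    unfolding I by (elim conjE, hypsubst) metis
qed

text \<open>Inversion of the entries reverses the arrows, and negation of the variables compensates for
  it. This makes the edge factors compatible with the braid relation of length 4.\<close>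

lemma edge_factor_inverse:
  assumes "q \<noteq> 0"
  shows "edge_factor q (inverse x) (inverse y) u v = edge_factor q y x (- v) (- u)"
  by (simp add: edge_factor_def edge_inverse[OF assms])

locale klr_rep = klr n q \<beta> for n and q :: "'k::field" and \<beta> +
  assumes char2: "(2 :: 'k) \<noteq> 0" and q0: "q \<noteq> 0" and q21: "q^2 \<noteq> 1"
    and nonzero: "\<lbrakk>i \<in> \<beta>; k \<in> {1..n}\<rbrakk> \<Longrightarrow> i k \<noteq> 0"
begin

lemma edge_refl:
  assumes "x \<noteq> 0"
  shows "\<not> edge_right q x x" "\<not> edge_left q x x" "\<not> edge_both q x x"
  using assms q21 by (auto simp: edge_iff[OF q0])

abbreviation EF where "EF \<equiv> edge_factor q"

text \<open>The action of the generators on functions from tuples to rational functions. The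
  generator \<open>psi 0\<close> inverts the first entry and negates the first variable. For \<open>a \<ge> 1\<close> the
  generator \<open>psi a\<close> is a divided difference at a tuple with equal entries \<open>a\<close> and \<open>a + 1\<close>; at the
  other tuples it exchanges the two entries and the two variables, with an edge factor.\<close>

primrec opr :: "'k klr_gen \<Rightarrow> ((nat \<Rightarrow> 'k) \<Rightarrow> 'k ratf) \<Rightarrow> (nat \<Rightarrow> 'k) \<Rightarrow> 'k ratf" where
  "opr (Psi a) f = (\<lambda>i. if i \<notin> \<beta> then 0 else if a = 0 then sg 0 (f (actB 0 i))
     else if i a = i (a + 1) then (sg a (f i) - f i) / (yv a - yv (a + 1))
     else EF (i a) (i (a + 1)) (yv a) (yv (a + 1)) * sg a (f (actB a i)))"
| "opr (Y j) f = (\<lambda>i. yv j * f i)"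
| "opr (E k) f = (\<lambda>i. if i = k then f i else 0)"

definition supp :: "((nat \<Rightarrow> 'k) \<Rightarrow> 'k ratf) \<Rightarrow> bool"
  where "supp f \<longleftrightarrow> (\<forall>i. i \<notin> \<beta> \<longrightarrow> f i = 0)"

definition act :: "'k klr \<Rightarrow> ((nat \<Rightarrow> 'k) \<Rightarrow> 'k ratf) \<Rightarrow> (nat \<Rightarrow> 'k) \<Rightarrow> 'k ratf"
  where "act p f i = (\<Sum>w\<in>Poly_Mapping.keys p. const (Poly_Mapping.lookup p w) * foldr opr (letters w) f i)"

lemma opr_add: "opr g (\<lambda>i. f i + h i) = (\<lambda>i. opr g f i + opr g h i)"
  by (cases g) (auto simp: fun_eq_iff sg_add distrib_left diff_divide_distrib add_divide_distrib)

lemma opr_const: "opr g (\<lambda>i. const c * f i) = (\<lambda>i. const c * opr g f i)"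
  by (cases g) (auto simp: fun_eq_iff sg_mult right_diff_distrib)

lemma foldr_opr_add: "foldr opr u (\<lambda>i. f i + h i) = (\<lambda>i. foldr opr u f i + foldr opr u h i)"
  by (induction u) (simp_all add: opr_add)

lemma foldr_opr_const: "foldr opr u (\<lambda>i. const c * f i) = (\<lambda>i. const c * foldr opr u f i)"
  by (induction u) (simp_all add: opr_const)

lemma act_superset:
  assumes "finite S" "Poly_Mapping.keys p \<subseteq> S"
  shows "act p f i = (\<Sum>w\<in>S. const (Poly_Mapping.lookup p w) * foldr opr (letters w) f i)"
  unfolding act_def
  by (rule sum.mono_neutral_left) (use assms in \<open>auto simp: in_keys_iff const_simps\<close>)

lemma act_add: "act (p + r) f i = act p f i + act r f i"
proof -
  let ?S = "Poly_Mapping.keys p \<union> Poly_Mapping.keys r"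
  have "finite ?S" by simp
  note * = act_superset[OF this]
  show ?thesis
    by (subst (1 2 3) *)
      (use keys_add[of p r] in \<open>auto simp: lookup_add const_simps distrib_right sum.distrib\<close>)
qed

lemma act_0: "act 0 f i = 0"
  by (simp add: act_def)

lemma act_uminus: "act (- p) f i = - act p f i"
  using act_add[of p "- p" f i] by (simp add: act_0 eq_neg_iff_add_eq_0 add.commute)

lemma act_diff: "act (p - r) f i = act p f i - act r f i"
  using act_add[of p "- r" f i] by (simp add: act_uminus)

lemma act_sum: "act (sum h A) f i = (\<Sum>x\<in>A. act (h x) f i)"
  by (induction A rule: infinite_finite_induct) (simp_all add: act_0 act_add)

lemma act_single: "act (Poly_Mapping.single w c) f i = const c * foldr opr (letters w) f i"
  by (cases "c = 0") (simp_all add: act_def const_simps)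

lemma act_gen: "act (gen g) f = opr g f"
  by (rule ext) (simp add: gen_def act_single const_simps)

lemma act_scal: "act (scal c) f i = const c * f i"
  by (simp add: scal_def act_single)

lemma act_1: "act 1 f = f"
  by (rule ext) (use act_scal[of 1 f] in \<open>simp add: scal_1 const_simps\<close>)

lemma act_fun_add: "act p (\<lambda>i. f i + h i) i = act p f i + act p h i"
  by (simp add: act_def foldr_opr_add distrib_left sum.distrib)

lemma act_fun_const: "act p (\<lambda>i. const c * f i) i = const c * act p f i"
  by (simp add: act_def foldr_opr_const sum_distrib_left mult.left_commute)

lemma act_fun_0: "act p (\<lambda>i. 0) i = 0"
  using act_fun_const[of p 0 "\<lambda>i. 0" i] by (simp add: const_simps)

lemma act_mult: "act (p * r) f = act p (act r f)"
proof
  fix i show "act (p * r) f i = act p (act r f) i"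
  proof (induction p rule: falg_induct)
    case (single w c)
    show ?case
    proof (induction r rule: falg_induct)
      case zero
      have "act 0 f = (\<lambda>i. 0)" by (rule ext) (rule act_0)
      then show ?case by (simp add: act_0 act_fun_0)
    next
      case (single v d)
      have "act (Poly_Mapping.single v d) f = (\<lambda>i. const d * foldr opr (letters v) f i)"
        by (rule ext) (rule act_single)
      then show ?case
        by (simp add: mult_single act_single const_simps foldr_opr_const mult.assoc)
    next
      case (add p r)
      have "act (p + r) f = (\<lambda>i. act p f i + act r f i)" by (rule ext) (rule act_add)
      then show ?case using add by (simp add: distrib_left act_add act_fun_add)
    qed
  qed (simp_all add: act_0 act_add distrib_right)
qed

lemma opr_supp: "supp f \<Longrightarrow> supp (opr g f)"
  by (cases g) (auto simp: supp_def)

lemma act_supp: "supp f \<Longrightarrow> supp (act p f)"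
proof -
  assume f: "supp f"
  have "supp (foldr opr u f)" for u by (induction u) (use f opr_supp in auto)
  then show ?thesis by (simp add: supp_def act_def)
qed

lemmas act_simps = act_add act_0 act_uminus act_diff act_sum act_gen act_scal act_1 act_mult

lemma act_2: "act 2 f i = f i + f i"
  using act_add[of 1 1 f i] by (simp add: act_1)

lemma Psi_0: "i \<in> \<beta> \<Longrightarrow> opr (Psi 0) f i = sg 0 (f (actB 0 i))"
  by simp

lemma Psi_eq: "\<lbrakk>i \<in> \<beta>; a \<ge> 1; i a = i (a + 1)\<rbrakk> \<Longrightarrow> opr (Psi a) f i = (sg a (f i) - f i) / (yv a - yv (a + 1))"
  by simp

lemma Psi_ne: "\<lbrakk>i \<in> \<beta>; a \<ge> 1; i a \<noteq> i (a + 1)\<rbrakk>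
    \<Longrightarrow> opr (Psi a) f i = EF (i a) (i (a + 1)) (yv a) (yv (a + 1)) * sg a (f (actB a i))"
  by simp

lemma actB_apply: "a \<ge> 1 \<Longrightarrow> actB a i k = (if k = a then i (a + 1) else if k = a + 1 then i a else i k)"
  by (simp add: actB_def transpose_def)

lemma actB_0_apply: "actB 0 i k = (if k = 1 then inverse (i 1) else i k)"
  by (simp add: actB_def)

lemma actB_actB: "actB a (actB a i) = i"
  by (cases "a = 0") (auto simp: fun_eq_iff actB_apply actB_0_apply)

lemma actB_same: "\<lbrakk>a \<ge> 1; i a = i (a + 1)\<rbrakk> \<Longrightarrow> actB a i = i"
  by (auto simp: fun_eq_iff actB_apply)

lemma actB_eq_iff: "actB a i = k \<longleftrightarrow> i = actB a k"
  using actB_actB by metis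

text \<open>Relations of the form \<open>L * ee k = R * ee k\<close> with \<open>R\<close> polynomial say that \<open>L\<close> acts on the
  component \<open>k\<close> by a scalar.\<close>

lemma act_diagonal:
  assumes "\<And>f i. \<lbrakk>supp f; i \<in> \<beta>\<rbrakk> \<Longrightarrow> act L f i = c i * f i" "supp f" "i \<in> \<beta>"
  shows "act (L * ee k) f i = c k * (if i = k then f i else 0)"
proof -
  have "act (L * ee k) f i = act L (opr (E k) f) i" by (simp add: act_mult act_gen)
  also have "\<dots> = c i * opr (E k) f i" by (intro assms(1) opr_supp assms)
  finally show ?thesis by simp
qed

lemma opr_square:
  assumes f: "supp f" and i: "i \<in> \<beta>" and a: "a \<ge> 1" "a < n"
  shows "opr (Psi a) (opr (Psi a) f) i = (if i a = i (a + 1) then 0 else if no_edge q (i a) (i (a + 1)) then 1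
    else if edge_right q (i a) (i (a + 1)) then yv (a + 1) - yv a
    else if edge_left q (i a) (i (a + 1)) then yv a - yv (a + 1)
    else (yv (a + 1) - yv a) * (yv a - yv (a + 1))) * f i"
proof (cases "i a = i (a + 1)")
  case True
  have "yv a \<noteq> (yv (a + 1) :: 'k ratf)" by (simp add: yv_inject)
  then show ?thesis using True i a by (simp add: sg_divide sg_diff sg_yv divide_simps) (simp add: algebra_simps)
next
  case False
  have "actB a i \<in> \<beta>" using actB_closed i a by auto
  then have "opr (Psi a) (opr (Psi a) f) i =
    EF (i a) (i (a + 1)) (yv a) (yv (a + 1)) * (EF (i (a + 1)) (i a) (yv (a + 1)) (yv a) * f i)"
    using False i a by (simp add: actB_apply actB_actB sg_mult sg_edge_factor sg_yv)
  moreover have "\<dots> = (if no_edge q (i a) (i (a + 1)) then 1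
    else if edge_right q (i a) (i (a + 1)) then yv (a + 1) - yv a
    else if edge_left q (i a) (i (a + 1)) then yv a - yv (a + 1)
    else (yv (a + 1) - yv a) * (yv a - yv (a + 1))) * f i"
    using False by (auto simp: edge_factor_def edge_iff[OF q0])
  ultimately show ?thesis using False by simp
qed

text \<open>The cases are the coincidences among the three entries. Unless the outer entries agree and
  differ from the middle one, the two sides agree because the substitutions satisfy the braid
  relation and permute the edge factors and the denominators of the divided differences. In the
  exceptional case the middle operator is a divided difference between two edge factors of one edge, which it does not commute with; the difference of
  the two sides is the correction term of the relation.\<close>

lemma opr_braid:
  assumes f: "supp f" and i: "i \<in> \<beta>" and b: "b \<ge> 1" "c < n" and cd: "b + 1 = c" "c + 1 = d"
  shows "opr (Psi b) (opr (Psi c) (opr (Psi b) f)) i - opr (Psi c) (opr (Psi b) (opr (Psi c) f)) i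
    = (if i b = i d \<and> edge_right q (i b) (i c) then 1
       else if i b = i d \<and> edge_left q (i b) (i c) then - 1
       else if i b = i d \<and> edge_both q (i b) (i c) then yv d - 2 * yv c + yv b
       else 0) * f i"
proof -
  have bcd: "b \<noteq> c" "c \<noteq> b" "b \<noteq> d" "d \<noteq> b" "c \<noteq> d" "d \<noteq> c" "c \<ge> 1" "b \<noteq> 0" "c \<noteq> 0" "d \<noteq> 0" using b cd by auto
  have cl: "actB b j \<in> \<beta>" "actB c j \<in> \<beta>" if "j \<in> \<beta>" for j
    using actB_closed that b cd by auto
  have v: "actB b j b = j c" "actB b j c = j b" "actB b j d = j d"
    "actB c j b = j b" "actB c j c = j d" "actB c j d = j c" for j
    using bcd b cd by (simp_all add: actB_apply)
  have eq: "opr (Psi b) f j = (sg b (f j) - f j) / (yv b - yv c)" if "j \<in> \<beta>" "j b = j c" for j f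
    using that b cd by simp
  have eq': "opr (Psi c) f j = (sg c (f j) - f j) / (yv c - yv d)" if "j \<in> \<beta>" "j c = j d" for j f
    using that bcd cd by simp
  have ne: "opr (Psi b) f j = EF (j b) (j c) (yv b) (yv c) * sg b (f (actB b j))" if "j \<in> \<beta>" "j b \<noteq> j c" for j f
    using that b cd by simp
  have ne': "opr (Psi c) f j = EF (j c) (j d) (yv c) (yv d) * sg c (f (actB c j))" if "j \<in> \<beta>" "j c \<noteq> j d" for j f
    using that bcd cd by simp
  have same: "actB b j = j" if "j b = j c" for j using that b cd actB_same[of b j] by simp
  have same': "actB c j = j" if "j c = j d" for j using that bcd cd actB_same[of c j] by simp
  have s: "sg b (yv b) = yv c" "sg b (yv c) = yv b" "sg b (yv d) = yv d"
    "sg c (yv b) = yv b" "sg c (yv c) = yv d" "sg c (yv d) = yv c"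
    using bcd cd by (simp_all add: sg_yv transpose_def)
  have br: "sg b (sg c (sg b x)) = sg c (sg b (sg c x))" for x
    using sg_braid[OF b(1)] cd by simp
  have brB: "actB b (actB c (actB b i)) = actB c (actB b (actB c i))"
  proof
    fix k show "actB b (actB c (actB b i)) k = actB c (actB b (actB c i)) k"
      using b bcd cd by (simp add: actB_apply)
  qed
  have y: "yv b \<noteq> (yv c :: 'k ratf)" "yv c \<noteq> (yv d :: 'k ratf)" "yv b \<noteq> (yv d :: 'k ratf)"
    "yv c \<noteq> (yv b :: 'k ratf)" "yv d \<noteq> (yv c :: 'k ratf)" "yv d \<noteq> (yv b :: 'k ratf)"
    using bcd by (simp_all add: yv_inject)
  note S = i cl v eq eq' ne ne' same same' s br sg_hom sg_edge_factor actB_actB brB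
  consider "i b = i c" "i c = i d" | "i b = i c" "i c \<noteq> i d" | "i b \<noteq> i c" "i c = i d"
    | "i b \<noteq> i c" "i b = i d" | "i b \<noteq> i c" "i b \<noteq> i d" "i c \<noteq> i d" by blast
  then show ?thesis
  proof cases
    case 1
    have "i b \<noteq> 0" using nonzero[OF i, of b] b cd by simp
    then have edges: "\<not> edge_right q (i b) (i c)" "\<not> edge_left q (i b) (i c)" "\<not> edge_both q (i b) (i c)"
      using edge_refl 1 by simp_all
    show ?thesis
      using 1 edges
      by (simp add: S del: opr.simps) (simp add: divide_simps y, simp add: algebra_simps)
  next
    case 2
    have *: "opr (Psi b) (opr (Psi c) (opr (Psi b) f)) i = opr (Psi c) (opr (Psi b) (opr (Psi c) f)) i"
      using 2 by (simp add: S del: opr.simps) (simp add: divide_simps y, simp add: algebra_simps)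
    show ?thesis
      using 2 * by simp
  next
    case 3
    have *: "opr (Psi b) (opr (Psi c) (opr (Psi b) f)) i = opr (Psi c) (opr (Psi b) (opr (Psi c) f)) i"
      using 3 by (simp add: S del: opr.simps) (simp add: divide_simps y, simp add: algebra_simps)
    show ?thesis
      using 3 * by simp
  next
    case 4
    let ?x = "i b" and ?y = "i c"
    have d: "i d = ?x" and xy: "?x \<noteq> ?y" using 4 by simp_all
    consider "no_edge q ?x ?y" | "edge_right q ?x ?y" | "edge_left q ?x ?y" | "edge_both q ?x ?y"
      using xy edge_total[of ?x ?y q] by blast
    then show ?thesis
    proof cases
      case 1
      note e = edge_reverse(1)[OF q0 1] 1
      show ?thesis
        using xy e by (simp add: S d edge_factor_def del: opr.simps, (simp add: divide_simps y, (simp add: algebra_simps)?)?)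
    next
      case 2
      note e = edge_reverse(2)[OF q0 2] 2
      show ?thesis
        using xy e by (simp add: S d edge_factor_def del: opr.simps, (simp add: divide_simps y, (simp add: algebra_simps)?)?)
    next
      case 3
      note e = edge_reverse(3)[OF q0 3] 3
      show ?thesis
        using xy e by (simp add: S d edge_factor_def del: opr.simps, (simp add: divide_simps y, (simp add: algebra_simps)?)?)
    next
      case 4
      note e = edge_reverse(4)[OF q0 4] 4
      show ?thesis
        using xy e by (simp add: S d edge_factor_def del: opr.simps, (simp add: divide_simps y, (simp add: algebra_simps)?)?)
    qed
  next
    case 5
    have *: "opr (Psi b) (opr (Psi c) (opr (Psi b) f)) i = opr (Psi c) (opr (Psi b) (opr (Psi c) f)) i"
      using 5 by (simp add: S mult_ac del: opr.simps)
    show ?thesis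
      using 5 * by simp
  qed
qed

lemma edge_exclusive:
  assumes "x \<noteq> 0"
  shows "no_edge q x y \<Longrightarrow> x \<noteq> y"
    and "edge_right q x y \<Longrightarrow> x \<noteq> y \<and> \<not> no_edge q x y"
    and "edge_left q x y \<Longrightarrow> x \<noteq> y \<and> \<not> no_edge q x y \<and> \<not> edge_right q x y"
    and "edge_both q x y \<Longrightarrow> x \<noteq> y \<and> \<not> no_edge q x y \<and> \<not> edge_right q x y \<and> \<not> edge_left q x y"
  using edge_refl[OF assms] edge_reverse[OF q0, of x y] by (metis no_edge_def)+

lemma opr_y:
  assumes i: "i \<in> \<beta>" and b: "b \<ge> 1" "b < n"
  shows "opr (Psi b) (\<lambda>i. yv j * f i) i - yv (transpose b (b + 1) j) * opr (Psi b) f i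
    = (if j = b \<and> i b = i (b + 1) then - 1 else if j = b + 1 \<and> i b = i (b + 1) then 1 else 0) * f i"
proof (cases "i b = i (b + 1)")
  case True
  have y: "yv b \<noteq> (yv (b + 1) :: 'k ratf)" "yv (b + 1) \<noteq> (yv b :: 'k ratf)" by (simp_all add: yv_inject)
  show ?thesis using True i b y
    by (auto simp: Psi_eq sg_mult sg_yv transpose_def divide_simps simp del: opr.simps) (simp_all add: algebra_simps)
next
  case False
  then show ?thesis using i b by (simp add: sg_mult sg_yv)
qed

lemma actB_comm: "\<lbrakk>b \<ge> 1; b + 1 < c\<rbrakk> \<Longrightarrow> actB b (actB c i) = actB c (actB b i)"
  by (rule ext) (simp add: actB_apply)

lemma actB_0_comm: "b > 1 \<Longrightarrow> actB 0 (actB b i) = actB b (actB 0 i)"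
  by (rule ext) (simp add: actB_apply actB_0_apply)

lemma opr_comm:
  assumes i: "i \<in> \<beta>" and b: "b \<ge> 1" "b + 1 < c" "c < n"
  shows "opr (Psi b) (opr (Psi c) f) i = opr (Psi c) (opr (Psi b) f) i"
proof -
  have cl: "actB b i \<in> \<beta>" "actB c i \<in> \<beta>" using actB_closed i b by auto
  have v: "actB b i c = i c" "actB b i (c + 1) = i (c + 1)" "actB c i b = i b" "actB c i (b + 1) = i (b + 1)"
    using b by (simp_all add: actB_apply)
  have s: "sg b (yv c) = yv c" "sg b (yv (c + 1)) = yv (c + 1)" "sg c (yv b) = yv b" "sg c (yv (b + 1)) = yv (b + 1)"
    using b by (simp_all add: sg_yv transpose_def)
  have "c \<ge> 1" using b by simp
  note S = i cl v s Psi_eq[OF _ b(1)] Psi_eq[OF _ \<open>c \<ge> 1\<close>] Psi_ne[OF _ b(1)] Psi_ne[OF _ \<open>c \<ge> 1\<close>]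
    sg_hom sg_edge_factor sg_comm[OF b(1,2)] actB_comm[OF b(1,2)]
  show ?thesis
    by (cases "i b = i (b + 1)"; cases "i c = i (c + 1)")
      (simp_all add: S mult_ac diff_divide_distrib right_diff_distrib del: opr.simps)
qed

lemma opr_0_comm:
  assumes i: "i \<in> \<beta>" and b: "b > 1" "b < n"
  shows "opr (Psi 0) (opr (Psi b) f) i = opr (Psi b) (opr (Psi 0) f) i"
proof -
  have cl: "actB b i \<in> \<beta>" "actB 0 i \<in> \<beta>" using actB_closed i b by auto
  have v: "actB 0 i b = i b" "actB 0 i (b + 1) = i (b + 1)" using b by (simp_all add: actB_0_apply)
  have s: "sg 0 (yv b) = yv b" "sg 0 (yv (b + 1)) = yv (b + 1)" using b by (simp_all add: sg_yv)
  have "b \<ge> 1" using b by simp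
  note S = i cl v s Psi_0 Psi_eq[OF _ \<open>b \<ge> 1\<close>] Psi_ne[OF _ \<open>b \<ge> 1\<close>] sg_hom sg_edge_factor
    sg_comm_0[OF b(1)] actB_0_comm[OF b(1)]
  show ?thesis
    by (cases "i b = i (b + 1)") (simp_all add: S del: opr.simps)
qed

lemma opr_0_square: "i \<in> \<beta> \<Longrightarrow> opr (Psi 0) (opr (Psi 0) f) i = f i"
  using actB0_closed[of i] by (simp add: actB_actB)

lemma opr_braid_0:
  assumes i: "i \<in> \<beta>"
  shows "opr (Psi 0) (opr (Psi 1) (opr (Psi 0) (opr (Psi 1) f))) i
    = opr (Psi 1) (opr (Psi 0) (opr (Psi 1) (opr (Psi 0) f))) i"
proof -
  have cl: "actB 0 j \<in> \<beta>" "actB 1 j \<in> \<beta>" if "j \<in> \<beta>" for j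
    using actB_closed that n2 by auto
  have v: "actB 0 j 1 = inverse (j 1)" "actB 0 j 2 = j 2" "actB 1 j 1 = j 2" "actB 1 j 2 = j 1" for j :: "nat \<Rightarrow> 'k"
    by (simp_all add: actB_apply actB_0_apply)
  have eq: "opr (Psi 1) f j = (sg 1 (f j) - f j) / (yv 1 - yv 2)" if "j \<in> \<beta>" "j 1 = j 2" for j f
    using that by simp
  have ne: "opr (Psi 1) f j = EF (j 1) (j 2) (yv 1) (yv 2) * sg 1 (f (actB 1 j))" if "j \<in> \<beta>" "j 1 \<noteq> j 2" for j f
    using that by simp
  have same: "actB 1 j = j" if "j 1 = j 2" for j using that actB_same[of 1 j] by simp
  have same0: "actB 0 j = j" if "inverse (j 1) = j 1" for j :: "nat \<Rightarrow> 'k"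
    using that by (auto simp: fun_eq_iff actB_0_apply)
  have s: "sg 0 (yv 1) = - yv 1" "sg 0 (yv 2) = yv 2" "sg 1 (yv 1) = yv 2" "sg 1 (yv 2) = yv 1"
    by (simp_all add: sg_yv)
  have brB: "actB 0 (actB 1 (actB 0 (actB 1 i))) = actB 1 (actB 0 (actB 1 (actB 0 i)))"
  proof
    fix k show "actB 0 (actB 1 (actB 0 (actB 1 i))) k = actB 1 (actB 0 (actB 1 (actB 0 i))) k"
      by (simp add: actB_apply actB_0_apply)
  qed
  have inv: "inverse (i 2) = i 1 \<longleftrightarrow> inverse (i 1) = i 2" by (metis inverse_inverse_eq)
  have EF1: "EF (inverse (i 1)) (i 2) u w = EF (inverse (i 2)) (i 1) (- w) (- u)" for u w
    using edge_factor_inverse[OF q0, of "i 1" "inverse (i 2)" u w] by simp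
  have EF2: "EF (inverse (i 2)) (inverse (i 1)) u w = EF (i 1) (i 2) (- w) (- u)" for u w
    by (rule edge_factor_inverse[OF q0])
  have "yl 1 \<noteq> (yl (- 2) :: 'k ratf)" "yl 1 \<noteq> (yl 2 :: 'k ratf)" using yl_inject[OF char2] by simp_all
  then have "yv 1 \<noteq> - (yv 2 :: 'k ratf)" "yv 1 \<noteq> (yv 2 :: 'k ratf)" by (simp_all add: yl_def One_nat_def)
  moreover from this have p: "yv 1 + yv 2 \<noteq> (0 :: 'k ratf)" by (simp add: eq_neg_iff_add_eq_0)
  moreover have "- yv 1 - yv 2 = - (yv 1 + yv 2 :: 'k ratf)" "- yv 2 - yv 1 = - (yv 1 + yv 2 :: 'k ratf)" by simp_all
  moreover have "yv 2 + yv 1 \<noteq> (0 :: 'k ratf)" using p by (simp add: add.commute)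
  ultimately have y: "yv 1 \<noteq> - (yv 2 :: 'k ratf)" "yv 1 \<noteq> (yv 2 :: 'k ratf)" "yv 2 \<noteq> (yv 1 :: 'k ratf)"
    "- yv 2 \<noteq> (yv 1 :: 'k ratf)" "- yv 1 \<noteq> (yv 2 :: 'k ratf)" "yv 2 \<noteq> - (yv 1 :: 'k ratf)"
    "- yv 1 - yv 2 \<noteq> (0 :: 'k ratf)" "- yv 2 - yv 1 \<noteq> (0 :: 'k ratf)"
    "yv 1 + yv 2 \<noteq> (0 :: 'k ratf)" "yv 2 + yv 1 \<noteq> (0 :: 'k ratf)"
    by (metis neg_eq_iff_add_eq_0 eq_neg_iff_add_eq_0 neg_equal_0_iff_equal)+
  note S = i cl v Psi_0 eq ne same same0 s sg_braid_0 sg_hom sg_edge_factor actB_actB brB inv EF1 EF2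
  show ?thesis
  proof (cases "i 1 = i 2"; cases "inverse (i 1) = i 2")
    assume "i 1 = i 2" "inverse (i 1) = i 2"
    then show ?thesis by (simp add: S del: opr.simps) (simp add: divide_simps y, simp add: algebra_simps)
  next
    assume *: "i 1 = i 2" "inverse (i 1) \<noteq> i 2"
    then have "EF (inverse (i 2)) (i 2) (- yv 1) (yv 2) = EF (inverse (i 2)) (i 2) (- yv 2) (yv 1)"
      using EF1[of "- yv 1" "yv 2"] by simp
    then show ?thesis using * by (simp add: S del: opr.simps EF1) (simp add: right_diff_distrib)?
  next
    assume *: "i 1 \<noteq> i 2" "inverse (i 1) = i 2"
    then have "inverse (i 2) = i 1" using inv by simp
    then have "EF (i 1) (i 2) (- yv 2) (- yv 1) = EF (i 1) (i 2) (yv 1) (yv 2)"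
      using EF2[of "yv 1" "yv 2"] *(2) by simp
    then show ?thesis using * by (simp add: S del: opr.simps) (simp add: divide_simps y, (simp add: algebra_simps)?)
  next
    assume "i 1 \<noteq> i 2" "inverse (i 1) \<noteq> i 2"
    then show ?thesis by (simp add: S mult_ac del: opr.simps)
  qed
qed

lemma act_psi_square:
  assumes "supp f" "i \<in> \<beta>" "k \<in> \<beta>" "b \<in> {1..<n}"
  shows "act (psi b ^ 2 * ee k) f i = (if k b = k (b + 1) then 0 else if no_edge q (k b) (k (b + 1)) then 1
    else if edge_right q (k b) (k (b + 1)) then yv (b + 1) - yv b
    else if edge_left q (k b) (k (b + 1)) then yv b - yv (b + 1)
    else (yv (b + 1) - yv b) * (yv b - yv (b + 1))) * (if i = k then f i else 0)"
proof (rule act_diagonal[OF _ assms(1,2)])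
  have b: "1 \<le> b" "b < n" using assms(4) by auto
  fix h and j assume "supp h" "j \<in> \<beta>"
  from opr_square[OF this b] show "act (psi b ^ 2) h j = (if j b = j (b + 1) then 0 else if no_edge q (j b) (j (b + 1)) then 1
    else if edge_right q (j b) (j (b + 1)) then yv (b + 1) - yv b
    else if edge_left q (j b) (j (b + 1)) then yv b - yv (b + 1)
    else (yv (b + 1) - yv b) * (yv b - yv (b + 1))) * h j"
    by (simp only: power2_eq_square act_mult act_gen)
qed

lemma act_braid_correction:
  "act (if A then ee k else if B then - ee k else if C then (yy d - 2 * yy c + yy b) * ee k else 0) f i
    = (if A then 1 else if B then - 1 else if C then yv d - 2 * yv c + yv b else 0) * (if i = k then f i else 0)"
  by (cases A; cases B; cases C) (simp_all add: act_simps act_2 algebra_simps)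

lemma act_V_rel:
  assumes rel: "V_rel n q \<beta> l r" and f: "supp f"
  shows "act l f = act r f"
proof
  fix i
  show "act l f i = act r f i"
  proof (cases "i \<in> \<beta>")
    case False
    then show ?thesis using act_supp[OF f] by (simp add: supp_def)
  next
    case i: True
    show ?thesis using rel
    proof cases
      case common
      then show ?thesis
      proof cases
        case sum_e
        then show ?thesis using i fin_\<beta> by (simp add: act_simps)
      next
        case (psi_e a k)
        show ?thesis
        proof (cases "actB a i = k")
          case True
          then have "i = actB a k" by (simp add: actB_eq_iff)
          moreover have "i = k" if "a \<noteq> 0" "i a = i (a + 1)" using that True actB_same[of a i] by simp
          ultimately show ?thesis using psi_e True i by (simp add: act_simps)
        next
          case False
          then have "i \<noteq> actB a k" by (simp add: actB_eq_iff)
          moreover have "i \<noteq> k" if "a \<noteq> 0" "i a = i (a + 1)" using that False actB_same[of a i] by auto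
          ultimately show ?thesis using psi_e False i by (cases "a = 0") (simp_all add: act_simps)
        qed
      next
        case (psi_psi b b')
        then consider "b + 1 < b'" | "b' + 1 < b" by linarith
        then show ?thesis
          by cases (use psi_psi i opr_comm[of i b b' f] opr_comm[of i b' b f] in \<open>simp_all add: act_simps del: opr.simps\<close>)
      next
        case (psi_y b j k)
        have "act l f i = (if j = b \<and> k b = k (b + 1) then - 1 else if j = b + 1 \<and> k b = k (b + 1) then 1 else 0)
          * (if i = k then f i else 0)"
          unfolding psi_y
          by (rule act_diagonal[OF _ f i]) (use psi_y opr_y[of _ b j] in \<open>simp add: act_simps del: opr.simps(1)\<close>)
        then show ?thesis by (simp add: psi_y act_simps)
      next
        case (psi_sq_eq b k)
        then show ?thesis using act_psi_square[OF f i psi_sq_eq(4,3)] by (simp add: act_simps)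
      next
        case (psi_sq_no_edge b k)
        then have "k b \<noteq> 0" by (intro nonzero) auto
        then show ?thesis using psi_sq_no_edge act_psi_square[OF f i psi_sq_no_edge(4,3)] edge_exclusive(1)
          by (simp add: act_simps)
      next
        case (psi_sq_right b k)
        then have "k b \<noteq> 0" by (intro nonzero) auto
        then show ?thesis using psi_sq_right act_psi_square[OF f i psi_sq_right(4,3)] edge_exclusive(2)
          by (simp add: act_simps left_diff_distrib)
      next
        case (psi_sq_left b k)
        then have "k b \<noteq> 0" by (intro nonzero) auto
        then show ?thesis using psi_sq_left act_psi_square[OF f i psi_sq_left(4,3)] edge_exclusive(3)
          by (simp add: act_simps left_diff_distrib)
      next
        case (psi_sq_both b k)
        then have "k b \<noteq> 0" by (intro nonzero) auto
        then show ?thesis using psi_sq_both act_psi_square[OF f i psi_sq_both(4,3)] edge_exclusive(4)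
          by (simp add: act_simps) (simp add: algebra_simps)?
      next
        case (psi_braid b k)
        have *: "b + 1 + 1 = b + 2" by simp
        have "act l f i = (if k b = k (b + 2) \<and> edge_right q (k b) (k (b + 1)) then 1
           else if k b = k (b + 2) \<and> edge_left q (k b) (k (b + 1)) then - 1
           else if k b = k (b + 2) \<and> edge_both q (k b) (k (b + 1)) then yv (b + 2) - 2 * yv (b + 1) + yv b
           else 0) * (if i = k then f i else 0)"
          unfolding psi_braid
          by (rule act_diagonal[OF _ f i])
            (use psi_braid opr_braid[OF _ _ _ _ HOL.refl *] in \<open>simp add: act_diff act_mult act_gen del: opr.simps\<close>)
        also have "\<dots> = act r f i" unfolding psi_braid(2) by (rule act_braid_correction[symmetric])
        finally show ?thesis .
      qed (use i in \<open>auto simp: act_simps\<close>)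
    next
      case (psi0_psi b)
      then show ?thesis using opr_0_comm[OF i, of b f] by (simp add: act_simps del: opr.simps)
    next
      case psi0_y1
      then show ?thesis using i by (simp add: act_simps sg_mult sg_yv)
    next
      case (psi0_y j)
      then show ?thesis using i by (simp add: act_simps sg_mult sg_yv)
    next
      case psi0_sq
      then show ?thesis using opr_0_square[OF i, of f] by (simp add: act_simps power2_eq_square del: opr.simps)
    next
      case psi0_braid
      then show ?thesis using opr_braid_0[OF i, of f] by (simp add: act_simps power2_eq_square del: opr.simps)
    qed
  qed
qed

lemma act_ideal: "\<lbrakk>p \<in> rel_span (V_rel n q \<beta>); supp f\<rbrakk> \<Longrightarrow> act p f i = 0"
proof (induction arbitrary: i rule: rel_span.induct)
  case (rel l r a b)
  have "act l (act b f) = act r (act b f)" by (rule act_V_rel[OF rel(1) act_supp[OF rel(2)]])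
  then have "act (l - r) (act b f) j = 0" for j by (simp add: act_diff)
  then have "act (l - r) (act b f) = (\<lambda>i. 0)" by (rule ext)
  then show ?case by (simp add: act_mult act_fun_0)
qed (simp_all add: act_0 act_add)

end


section \<open>Linear independence\<close>

definition mult_hom :: "('a::field \<Rightarrow> 'a) \<Rightarrow> bool"
  where "mult_hom h \<longleftrightarrow> h 1 = 1 \<and> (\<forall>x y. h (x * y) = h x * h y)"

text \<open>Dedekind's theorem on the independence of characters: the relation at \<open>x * y\<close> minus \<open>h0 y\<close>
  times the relation at \<open>x\<close> is a relation without \<open>h0\<close>.\<close>

lemma dedekind_independence:
  assumes "finite H" "\<And>h. h \<in> H \<Longrightarrow> mult_hom h" "\<And>x. (\<Sum>h\<in>H. d h * h x) = 0"
  shows "\<forall>h\<in>H. d h = 0"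
  using assms
proof (induction H arbitrary: d rule: finite_induct)
  case (insert h0 H)
  have hom: "h (x * y) = h x * h y" "h 1 = 1" if "h \<in> insert h0 H" for h x y
    using insert.prems(1)[OF that] by (auto simp: mult_hom_def)
  have "d h0 * h0 x + (\<Sum>h\<in>H. d h * h x) = 0" for x using insert by simp
  then have sum: "(\<Sum>h\<in>H. d h * h x) = - (d h0 * h0 x)" for x
    by (simp add: eq_neg_iff_add_eq_0 add.commute)
  have zero: "d h = 0" if h: "h \<in> H" for h
  proof -
    obtain y where y: "h y \<noteq> h0 y" using h insert.hyps(2) by (metis ext)
    have "(\<Sum>h\<in>H. (d h * (h y - h0 y)) * h x) = 0" for x
    proof -
      have "(\<Sum>h\<in>H. (d h * (h y - h0 y)) * h x) = (\<Sum>h\<in>H. d h * h (x * y)) - h0 y * (\<Sum>h\<in>H. d h * h x)"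
        by (simp add: hom sum_distrib_left algebra_simps flip: sum_subtractf)
      also have "\<dots> = - (d h0 * h0 (x * y)) - h0 y * - (d h0 * h0 x)"
        by (simp only: sum)
      finally show ?thesis by (simp add: hom)
    qed
    then have "\<forall>h\<in>H. d h * (h y - h0 y) = 0" using insert.prems(1) by (intro insert.IH) auto
    then show ?thesis using h y by auto
  qed
  then have "d h0 = 0" using sum[of 1] by (simp add: hom)
  then show ?case using zero by simp
qed simp

inductive combination :: "('a::field \<Rightarrow> 'a) set \<Rightarrow> ('a \<Rightarrow> 'a) \<Rightarrow> bool" for S where
  zero: "combination S (\<lambda>x. 0)"
| add: "\<lbrakk>combination S T; combination S U\<rbrakk> \<Longrightarrow> combination S (\<lambda>x. T x + U x)"
| single: "h \<in> S \<Longrightarrow> combination S (\<lambda>x. d * h x)"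

lemma combination_mult: "combination S T \<Longrightarrow> combination S (\<lambda>x. c * T x)"
proof (induction rule: combination.induct)
  case (single h d)
  then show ?case using combination.single[of h S "c * d"] by (simp add: mult.assoc)
qed (auto simp: distrib_left intro: combination.intros)

lemma combination_sum:
  "(\<And>x. x \<in> A \<Longrightarrow> combination S (T x)) \<Longrightarrow> combination S (\<lambda>g. \<Sum>x\<in>A. T x g)"
  by (induction A rule: infinite_finite_induct) (auto intro: combination.intros)

lemma combination_finite:
  "combination S T \<Longrightarrow> \<exists>H d. finite H \<and> H \<subseteq> S \<and> (\<forall>x. T x = (\<Sum>h\<in>H. d h * h x))"
proof (induction rule: combination.induct)
  case zero
  show ?case by (rule exI[of _ "{}"]) simp
next
  case (add T U)
  then obtain H d H' d' where H: "finite H" "H \<subseteq> S" "\<forall>x. T x = (\<Sum>h\<in>H. d h * h x)"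
    and H': "finite H'" "H' \<subseteq> S" "\<forall>x. U x = (\<Sum>h\<in>H'. d' h * h x)" by blast
  let ?d = "\<lambda>h. (if h \<in> H then d h else 0) + (if h \<in> H' then d' h else 0)"
  have "T x + U x = (\<Sum>h\<in>H \<union> H'. ?d h * h x)" for x
  proof -
    have "T x = (\<Sum>h\<in>H \<union> H'. (if h \<in> H then d h else 0) * h x)"
      using H H'(1) by (simp add: sum.mono_neutral_cong_right if_distrib[of "\<lambda>c. c * _"] cong: if_cong flip: sum.inter_restrict)
    moreover have "U x = (\<Sum>h\<in>H \<union> H'. (if h \<in> H' then d' h else 0) * h x)"
      using H' H(1) by (simp add: sum.mono_neutral_cong_right if_distrib[of "\<lambda>c. c * _"] cong: if_cong flip: sum.inter_restrict)
    ultimately show ?thesis by (simp add: distrib_right sum.distrib)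
  qed
  then show ?case using H H' by (intro exI[of _ "H \<union> H'"] exI[of _ ?d]) auto
next
  case (single h d)
  then show ?case by (intro exI[of _ "{h}"] exI[of _ "\<lambda>_. d"]) simp
qed

lemma combination_independent:
  assumes S: "\<And>h. h \<in> S \<Longrightarrow> mult_hom h" and h0: "mult_hom h0" "h0 \<notin> S"
    and T: "combination S T" and zero: "\<And>x. c * h0 x + T x = 0"
  shows "c = 0"
proof -
  obtain H d where H: "finite H" "H \<subseteq> S" "\<forall>x. T x = (\<Sum>h\<in>H. d h * h x)"
    using combination_finite[OF T] by blast
  have "h0 \<notin> H" using H h0 by auto
  have "\<forall>h\<in>insert h0 H. (if h = h0 then c else d h) = 0"
  proof (rule dedekind_independence)
    fix x
    have "(\<Sum>h\<in>H. (if h = h0 then c else d h) * h x) = (\<Sum>h\<in>H. d h * h x)"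
      using \<open>h0 \<notin> H\<close> by (intro sum.cong) auto
    then show "(\<Sum>h\<in>insert h0 H. (if h = h0 then c else d h) * h x) = 0"
      using H zero[of x] \<open>h0 \<notin> H\<close> by simp
  qed (use H S h0 in auto)
  then show ?thesis by simp
qed

locale klr_full = klr_red n q \<beta> red + klr_rep n q \<beta>
  for n and q :: "'k::field" and \<beta> and red
begin

declare opr.simps(1) [simp del]

text \<open>The functionals that a word in the \<open>Psi a\<close> contributes besides its leading term: they twist
  by shorter words.\<close>

inductive lower :: "nat \<Rightarrow> (((nat \<Rightarrow> 'k) \<Rightarrow> 'k ratf) \<Rightarrow> 'k ratf) \<Rightarrow> bool" for N where
  zero: "lower N (\<lambda>f. 0)"
| add: "\<lbrakk>lower N T; lower N U\<rbrakk> \<Longrightarrow> lower N (\<lambda>f. T f + U f)"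
| single: "\<lbrakk>set vs \<subseteq> {0..<n}; length vs < N\<rbrakk> \<Longrightarrow> lower N (\<lambda>f. d * sgw vs (f j))"

lemma lower_mono: "\<lbrakk>lower M T; M \<le> N\<rbrakk> \<Longrightarrow> lower N T"
  by (induction rule: lower.induct) (auto intro: lower.intros)

lemma lower_mult: "lower N T \<Longrightarrow> lower N (\<lambda>f. c * T f)"
proof (induction rule: lower.induct)
  case (single vs d j)
  then show ?case using lower.single[of vs N "c * d" j] by (simp add: mult.assoc)
qed (auto simp: distrib_left intro: lower.intros)

lemma lower_sg: "\<lbrakk>lower N T; a < n\<rbrakk> \<Longrightarrow> lower (Suc N) (\<lambda>f. sg a (T f))"
proof (induction rule: lower.induct)
  case (single vs d j)
  then show ?case using lower.single[of "a # vs" "Suc N" "sg a d" j] by (simp add: sg_mult)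
qed (auto simp: sg_add intro: lower.intros)

abbreviation opr_word :: "nat list \<Rightarrow> ((nat \<Rightarrow> 'k) \<Rightarrow> 'k ratf) \<Rightarrow> (nat \<Rightarrow> 'k) \<Rightarrow> 'k ratf"
  where "opr_word ws \<equiv> foldr (\<lambda>a. opr (Psi a)) ws"

text \<open>Each letter acts by a nonzero multiple of its substitution, up to a multiple of the identity in
  the case of a divided difference. Expanding the product, the term with all
  substitutions is the leading one, and the others skip letters of the word.\<close>

lemma opr_word_leading:
  "\<lbrakk>set ws \<subseteq> {0..<n}; i \<in> \<beta>\<rbrakk> \<Longrightarrow> \<exists>c L. c \<noteq> 0 \<and> lower (length ws) L \<and>
    (\<forall>f. opr_word ws f i = c * sgw ws (f (foldr actB (rev ws) i)) + L f)"
proof (induction ws arbitrary: i)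
  case Nil
  show ?case by (rule exI[of _ 1], rule exI[of _ "\<lambda>_. 0"]) (simp add: lower.zero)
next
  case (Cons a ws)
  have a: "a < n" and ws: "set ws \<subseteq> {0..<n}" using Cons.prems by auto
  have nz: "sg a c \<noteq> 0" if "c \<noteq> 0" for c :: "'k ratf" using that by (metis sg_0 sg_sg)
  let ?j = "foldr actB (rev (a # ws)) i"
  obtain c L where c: "c \<noteq> 0" and L: "lower (length ws) L"
    and eq: "\<And>f. opr_word ws f (actB a i) = c * sgw ws (f ?j) + L f"
    using Cons.IH[OF ws actB_closed[OF a Cons.prems(2)]] by auto
  note La = lower_sg[OF L a]
  consider "a = 0" | "a \<ge> 1" "i a = i (a + 1)" | "a \<ge> 1" "i a \<noteq> i (a + 1)" by linarith
  then show ?case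
  proof cases
    case 1
    then have E: "opr_word (a # ws) f i = sg a c * sgw (a # ws) (f ?j) + sg a (L f)" for f
      using eq[of f] Psi_0[OF Cons.prems(2)] by (simp add: sg_add sg_mult)
    show ?thesis
      by (intro exI[of _ "sg a c"] exI[of _ "\<lambda>f. sg a (L f)"] conjI allI nz c E) (simp add: La)
  next
    case 2
    let ?D = "yv a - yv (a + 1) :: 'k ratf"
    have D: "?D \<noteq> 0" by (simp add: yv_inject)
    have same: "actB a i = i" by (rule actB_same[OF 2])
    let ?L = "\<lambda>f. inverse ?D * sg a (L f) + ((- c * inverse ?D) * sgw ws (f ?j) + (- inverse ?D) * L f)"
    have L': "lower (Suc (length ws)) ?L"
      using ws by (intro lower.add lower_mult La lower.single lower_mono[OF L]) auto
    have E: "opr_word (a # ws) f i = (sg a c * inverse ?D) * sgw (a # ws) (f ?j) + ?L f" for f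
    proof -
      have "opr_word (a # ws) f i = (sg a (opr_word ws f i) - opr_word ws f i) * inverse ?D"
        using Psi_eq[OF Cons.prems(2) 2] by (simp add: divide_inverse)
      then show ?thesis using eq[of f] same by (simp add: sg_add sg_mult algebra_simps)
    qed
    have "sg a c * inverse ?D \<noteq> 0" using nz[OF c] D by simp
    then show ?thesis
      by (intro exI[of _ "sg a c * inverse ?D"] exI[of _ ?L] conjI allI E) (assumption, simp only: length_Cons L')
  next
    case 3
    let ?E = "EF (i a) (i (a + 1)) (yv a) (yv (a + 1))"
    have nzE: "?E \<noteq> 0" by (simp add: edge_factor_def yv_inject)
    have E: "opr_word (a # ws) f i = (?E * sg a c) * sgw (a # ws) (f ?j) + ?E * sg a (L f)" for f
      using Psi_ne[OF Cons.prems(2) 3] eq[of f] by (simp add: sg_add sg_mult algebra_simps)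
    have "?E * sg a c \<noteq> 0" using nz[OF c] nzE by simp
    then show ?thesis using lower_mult[OF La, of ?E]
      by (intro exI[of _ "?E * sg a c"] exI[of _ "\<lambda>f. ?E * sg a (L f)"] conjI allI E) (assumption, simp only: length_Cons)
  qed
qed

definition mon :: "(nat \<Rightarrow> nat) \<Rightarrow> nat \<Rightarrow>\<^sub>0 nat"
  where "mon m = (\<Sum>j\<in>{1..n}. Poly_Mapping.single j (m j))"

lemma mon_inject:
  assumes "mon m = mon m'" "\<forall>j. j \<notin> {1..n} \<longrightarrow> m j = 0" "\<forall>j. j \<notin> {1..n} \<longrightarrow> m' j = 0"
  shows "m = m'"
proof
  fix j
  have "Poly_Mapping.lookup (mon m) j = (if j \<in> {1..n} then m j else 0)" for m
    by (simp add: mon_def lookup_sum lookup_single when_def)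
  then show "m j = m' j" using assms by (metis (full_types))
qed

lemma act_ymonom: "act (ymonom m) f i = to_fract (Poly_Mapping.single (mon m) 1) * f i"
proof -
  have interval: "{1..<n + 1} = {1..n}" by auto
  have pow: "act (yy j ^ e) f i = to_fract (Poly_Mapping.single (Poly_Mapping.single j e) 1) * f i" for j e f i
  proof (induction e arbitrary: f i)
    case 0 show ?case by (simp add: act_1)
  next
    case (Suc e)
    have "Poly_Mapping.single (Poly_Mapping.single j (Suc e)) (1 :: 'k)
      = Poly_Mapping.single (Poly_Mapping.single j 1) 1 * Poly_Mapping.single (Poly_Mapping.single j e) 1"
      by (simp add: mult_single One_nat_def flip: single_add)
    then show ?case using Suc by (simp add: act_mult act_gen yv_def mult.assoc)
  qed
  have "act (prod_list (map (\<lambda>j. yy j ^ m j) ks)) f i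
    = to_fract (Poly_Mapping.single (\<Sum>j\<in>set ks. Poly_Mapping.single j (m j)) 1) * f i" if "distinct ks" for ks
    using that
  proof (induction ks arbitrary: f i)
    case Nil show ?case by (simp add: act_1)
  next
    case (Cons k ks)
    have "Poly_Mapping.single (p + r) (1 :: 'k) = Poly_Mapping.single p 1 * Poly_Mapping.single r 1" for p r :: "nat \<Rightarrow>\<^sub>0 nat"
      by (simp add: mult_single)
    then show ?case using Cons by (simp add: act_mult pow mult.assoc)
  qed
  from this[of "[1..<n + 1]"] show ?thesis
    unfolding ymonom_def mon_def by (simp add: interval)
qed

lemma phi_psiword: "phi (psiword ws) = psiword (D_to_B ws)"
  by (induction ws) (simp_all add: phi_simps D_to_B_def mult.assoc)

lemma phi_ymonom: "phi (ymonom m) = ymonom m"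
proof -
  have "phi (prod_list (map (\<lambda>j. yy j ^ m j) ks)) = prod_list (map (\<lambda>j. yy j ^ m j) ks)" for ks
    by (induction ks) (simp_all add: phi_simps phi_power)
  then show ?thesis by (simp add: ymonom_def)
qed

lemma act_psiword: "act (psiword ws) f = opr_word ws f"
  by (induction ws) (simp_all add: act_1 act_mult act_gen)

lemma act_phi_basis_elem:
  "act (phi (scal c * basis_elem (w, m, k))) f i
    = const c * to_fract (Poly_Mapping.single (mon m) 1) * opr_word (D_to_B (red w)) (opr (E k) f) i"
  by (simp only: basis_elem_def case_prod_conv phi_simps phi_psiword phi_ymonom act_mult act_scal
      act_ymonom act_psiword act_gen mult.assoc)

lemma foldr_actB_rev: "foldr actB (rev ws) (foldr actB ws i) = i"
  by (induction ws arbitrary: i) (simp_all add: actB_actB)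

lemma foldr_actB_closed: "\<lbrakk>set ws \<subseteq> {0..<n}; i \<in> \<beta>\<rbrakk> \<Longrightarrow> foldr actB ws i \<in> \<beta>"
  by (induction ws) (auto intro: actB_closed)

lemma mult_hom_sgw: "mult_hom (sgw ws :: 'k ratf \<Rightarrow> 'k ratf)"
  by (simp add: mult_hom_def sgw_1 sgw_mult)

text \<open>In a relation consider an index \<open>(w0, m0, k0)\<close> with nonzero coefficient such that the word
  \<open>D_to_B (red w0)\<close> is longest, and let the relation act on functions supported at \<open>k0\<close>. The
  substitution of \<open>w0\<close> is the leading term of the elements with \<open>w = w0\<close>. It occurs in no other term,
  as a shorter word cannot represent \<open>w0\<close>, the word of \<open>w0\<close> being reduced in type B. By Dedekind's
  theorem its coefficient vanishes, and this coefficient is a polynomial in which the monomials of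
  distinct \<open>m\<close> cannot cancel.\<close>

theorem basis_independent:
  assumes fin: "finite A" and A: "A \<subseteq> basis_index"
    and rel: "eqV (phi (\<Sum>x\<in>A. scal (a x) * basis_elem x)) 0"
  shows "\<forall>x\<in>A. a x = 0"
proof (rule ccontr)
  define len where "len x = length (D_to_B (red (fst x)))" for x :: "(int \<Rightarrow> int) \<times> (nat \<Rightarrow> nat) \<times> (nat \<Rightarrow> 'k)"
  let ?A = "{x \<in> A. a x \<noteq> 0}"
  assume "\<not> (\<forall>x\<in>A. a x = 0)"
  then have "?A \<noteq> {}" "finite ?A" using fin by auto
  then have "Max (len ` ?A) \<in> len ` ?A" "\<And>x. x \<in> ?A \<Longrightarrow> len x \<le> Max (len ` ?A)" by simp_all
  then obtain x0 where x0: "x0 \<in> A" "a x0 \<noteq> 0" and max: "\<And>x. x \<in> A \<Longrightarrow> a x \<noteq> 0 \<Longrightarrow> len x \<le> len x0"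
    by (smt (verit, del_insts) imageE mem_Collect_eq)
  obtain w0 m0 k0 where x0_eq: "x0 = (w0, m0, k0)" by (cases x0)
  have w0: "w0 \<in> weyl genD n" and k0: "k0 \<in> \<beta>" using x0 A by (auto simp: x0_eq basis_index_def)
  define B where "B w = D_to_B (red w)" for w
  have B: "set (B w) \<subseteq> {0..<n}" "wprod genB (B w) = w"
    "\<And>vs. \<lbrakk>set vs \<subseteq> {0..<n}; wprod genB vs = w\<rbrakk> \<Longrightarrow> length (B w) \<le> length vs"
    if "w \<in> weyl genD n" for w
    using redB[OF that] by (auto simp: reduced_expr_def B_def)
  have len: "len (w, m, k) = length (B w)" for w m k by (simp add: len_def B_def)
  (* the leading substitution, and the substitutions of all other group elements *)
  define h0 :: "'k ratf \<Rightarrow> 'k ratf" where "h0 = sgw (B w0)"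
  define S where "S = {sgw vs | vs. set vs \<subseteq> {0..<n}} - {h0}"
  have in_S: "sgw vs \<in> S" if "set vs \<subseteq> {0..<n}" "wprod genB vs \<noteq> w0" for vs
    using that sgw_inject[OF char2, of vs "B w0"] B(2)[OF w0] by (auto simp: S_def h0_def)
  (* the tuple at which the leading term reads off the value at k0 *)
  define j0 where "j0 = foldr actB (B w0) k0"
  have j0: "j0 \<in> \<beta>" "foldr actB (rev (B w0)) j0 = k0"
    using foldr_actB_closed[OF B(1)[OF w0] k0] by (simp_all add: j0_def foldr_actB_rev)
  define \<delta> where "\<delta> g = (\<lambda>i. if i = k0 then g else 0)" for g :: "'k ratf"
  have supp_\<delta>: "supp (\<delta> g)" for g using k0 by (auto simp: supp_def \<delta>_def)
  have lower_S: "combination S (\<lambda>g. L (\<delta> g))" if "lower (length (B w0)) L" for L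
    using that
  proof (induction rule: lower.induct)
    case (single vs d j)
    then have "wprod genB vs \<noteq> w0" using B(3)[OF w0, of vs] by auto
    then have "sgw vs \<in> S" using single by (intro in_S)
    then show ?case
      by (cases "j = k0") (auto simp: \<delta>_def sgw_0 intro: combination.intros)
  qed (auto intro: combination.intros)
  obtain c0 L0 where c0: "c0 \<noteq> 0" and L0: "lower (length (B w0)) L0"
    and lead0: "\<And>f. opr_word (B w0) f j0 = c0 * h0 (f k0) + L0 f"
    using opr_word_leading[OF B(1)[OF w0] j0(1)] j0(2) unfolding h0_def by auto
  define coef where "coef x = (if fst x = w0 \<and> snd (snd x) = k0
    then const (a x) * to_fract (Poly_Mapping.single (mon (fst (snd x))) 1) else 0)" for x
  have "\<exists>T. combination S T \<and> (\<forall>g. act (phi (scal (a x) * basis_elem x)) (\<delta> g) j0 = coef x * c0 * h0 g + T g)"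
    if x: "x \<in> A" for x
  proof -
    obtain w m k where x_eq: "x = (w, m, k)" by (cases x)
    have w: "w \<in> weyl genD n" using x A by (auto simp: x_eq basis_index_def)
    let ?p = "const (a x) * to_fract (Poly_Mapping.single (mon m) 1)"
    have term_eq: "act (phi (scal (a x) * basis_elem x)) (\<delta> g) j0 = ?p * opr_word (B w) (opr (E k) (\<delta> g)) j0" for g
      using act_phi_basis_elem[of "a x" w m k] by (simp add: x_eq B_def)
    consider "a x = 0" | "k \<noteq> k0" | "a x \<noteq> 0" "k = k0" "w = w0" | "a x \<noteq> 0" "k = k0" "w \<noteq> w0" by blast
    then show ?thesis
    proof cases
      case 1
      then have "coef x = 0" "act (phi (scal (a x) * basis_elem x)) (\<delta> g) j0 = 0" for g
        using term_eq[of g] by (simp_all add: const_simps coef_def)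
      then show ?thesis using combination.zero by (intro exI[of _ "\<lambda>_. 0"]) simp
    next
      case 2
      have "opr (E k) (\<delta> g) = (\<lambda>i. 0)" for g using 2 by (auto simp: \<delta>_def)
      moreover have "opr_word ws (\<lambda>i. 0) = (\<lambda>i. 0)" for ws
        using foldr_opr_const[of "map Psi ws" 0 "\<lambda>i. 0"] by (simp add: const_simps foldr_map o_def)
      ultimately show ?thesis using term_eq combination.zero 2
        by (intro exI[of _ "\<lambda>_. 0"]) (simp add: coef_def x_eq)
    next
      case 3
      have "opr (E k) (\<delta> g) = \<delta> g" for g using 3 by (auto simp: \<delta>_def)
      then have "act (phi (scal (a x) * basis_elem x)) (\<delta> g) j0 = coef x * c0 * h0 g + ?p * L0 (\<delta> g)" for g
        using term_eq[of g] lead0[of "\<delta> g"] 3 by (simp add: coef_def x_eq \<delta>_def algebra_simps)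
      then show ?thesis using combination_mult[OF lower_S[OF L0]] by blast
    next
      case 4
      have \<delta>: "opr (E k) (\<delta> g) = \<delta> g" for g using 4 by (auto simp: \<delta>_def)
      obtain c L where L: "lower (length (B w)) L"
        and lead: "\<And>f. opr_word (B w) f j0 = c * sgw (B w) (f (foldr actB (rev (B w)) j0)) + L f"
        using opr_word_leading[OF B(1)[OF w] j0(1)] by auto
      have "length (B w) \<le> length (B w0)" using max[OF x 4(1)] by (simp add: x_eq x0_eq len)
      then have comb_L: "combination S (\<lambda>g. L (\<delta> g))" using lower_S lower_mono[OF L] by blast
      have comb_lead: "combination S (\<lambda>g. c * sgw (B w) (\<delta> g j))" for j
      proof (cases "j = k0")
        case True
        have "sgw (B w) \<in> S" using in_S[OF B(1)[OF w]] B(2)[OF w] 4 by simp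
        then show ?thesis using True by (simp add: \<delta>_def combination.single)
      next
        case False
        then show ?thesis by (simp add: \<delta>_def sgw_0 combination.zero)
      qed
      have "combination S (\<lambda>g. ?p * (c * sgw (B w) (\<delta> g (foldr actB (rev (B w)) j0)) + L (\<delta> g)))"
        by (rule combination_mult[OF combination.add[OF comb_lead comb_L]])
      moreover have "act (phi (scal (a x) * basis_elem x)) (\<delta> g) j0
        = coef x * c0 * h0 g + ?p * (c * sgw (B w) (\<delta> g (foldr actB (rev (B w)) j0)) + L (\<delta> g))" for g
        using term_eq[of g] 4 unfolding \<delta> lead by (simp add: coef_def x_eq)
      ultimately show ?thesis by blast
    qed
  qed
  then obtain T where T: "\<And>x. x \<in> A \<Longrightarrow> combination S (T x)"
    "\<And>x g. x \<in> A \<Longrightarrow> act (phi (scal (a x) * basis_elem x)) (\<delta> g) j0 = coef x * c0 * h0 g + T x g"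
    by metis
  have relation: "(\<Sum>x\<in>A. coef x * c0) * h0 g + (\<Sum>x\<in>A. T x g) = 0" for g
  proof -
    have "act (phi (\<Sum>x\<in>A. scal (a x) * basis_elem x)) (\<delta> g) j0 = 0"
      using act_ideal[OF _ supp_\<delta>] rel by (simp add: equ_def)
    then have "(\<Sum>x\<in>A. act (phi (scal (a x) * basis_elem x)) (\<delta> g) j0) = 0"
      by (simp only: phi_simps(11) act_sum)
    then show ?thesis
      by (simp add: T(2) sum_distrib_right sum.distrib)
  qed
  have "(\<Sum>x\<in>A. coef x * c0) = 0"
  proof (rule combination_independent)
    show "mult_hom h" if "h \<in> S" for h using that by (auto simp: S_def mult_hom_sgw)
    show "mult_hom h0" by (simp add: h0_def mult_hom_sgw)
    show "h0 \<notin> S" by (simp add: S_def)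
    show "combination S (\<lambda>g. \<Sum>x\<in>A. T x g)" by (rule combination_sum) (rule T(1))
    show "(\<Sum>x\<in>A. coef x * c0) * h0 g + (\<Sum>x\<in>A. T x g) = 0" for g by (rule relation)
  qed
  then have "(\<Sum>x\<in>A. coef x) = 0" using c0 by (simp flip: sum_distrib_right)
  moreover have "(\<Sum>x\<in>A. coef x) = to_fract (\<Sum>x\<in>A. if fst x = w0 \<and> snd (snd x) = k0
      then Poly_Mapping.single (mon (fst (snd x))) (a x) else 0)"
    using fin
  proof (induction A)
    case (insert x A)
    have "coef x = to_fract (if fst x = w0 \<and> snd (snd x) = k0 then Poly_Mapping.single (mon (fst (snd x))) (a x) else 0)"
      by (auto simp: coef_def const_def mult_single simp flip: to_fract_mult)
    then show ?case using insert by simp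
  qed simp
  ultimately have "to_fract (\<Sum>x\<in>A. if fst x = w0 \<and> snd (snd x) = k0
      then Poly_Mapping.single (mon (fst (snd x))) (a x) else 0) = 0" by (simp only:)
  then have "(\<Sum>x\<in>A. if fst x = w0 \<and> snd (snd x) = k0
      then Poly_Mapping.single (mon (fst (snd x))) (a x) else 0) = 0" by (simp only: to_fract_eq_0_iff)
  then have "Poly_Mapping.lookup (\<Sum>x\<in>A. if fst x = w0 \<and> snd (snd x) = k0
      then Poly_Mapping.single (mon (fst (snd x))) (a x) else 0) (mon m0) = 0" by simp
  moreover have "Poly_Mapping.lookup (if fst x = w0 \<and> snd (snd x) = k0
      then Poly_Mapping.single (mon (fst (snd x))) (a x) else 0) (mon m0) = (if x = x0 then a x0 else 0)"
    if "x \<in> A" for x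
  proof -
    have only: "x = x0" if "fst x = w0" "snd (snd x) = k0" "mon (fst (snd x)) = mon m0"
      using that mon_inject[OF that(3)] \<open>x \<in> A\<close> x0(1) A by (cases x) (auto simp: x0_eq basis_index_def)
    show ?thesis
    proof (cases "x = x0")
      case True
      then show ?thesis by (simp add: x0_eq)
    next
      case False
      then have "\<not> (fst x = w0 \<and> snd (snd x) = k0 \<and> mon (fst (snd x)) = mon m0)" using only by blast
      then show ?thesis using False by (simp add: lookup_single when_def)
    qed
  qed
  ultimately have "a x0 = 0" using fin x0(1) by (simp add: lookup_sum)
  then show False using x0(2) by simp
qed


section \<open>The basis and the isomorphism\<close>

lemma basis_elem_on: "x \<in> basis_index \<Longrightarrow> basis_elem x \<in> falg_on G"
proof -
  assume "x \<in> basis_index"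
  then obtain w m i where x: "x = (w, m, i)" "w \<in> weyl genD n" "i \<in> \<beta>" by (auto simp: basis_index_def)
  then have "\<forall>b\<in>set (red w). b < n" using redD[of w] by (auto simp: reduced_expr_def)
  then show ?thesis using x unfolding basis_elem_def ymonom_def
    by (auto intro!: falg_on_mult falg_on_prod_list falg_on_power gens_on)
qed

lemma W_spanned: "p \<in> falg_on G \<Longrightarrow> spanned p"
proof (induction rule: falg_on_induct)
  case (word u c)
  then show ?case using low_spanned[OF low.word[of u "Suc (length (psis u))" c]] by simp
qed (auto intro: spanned_0 spanned_add)

lemma basis_independent_W:
  assumes "finite A" "A \<subseteq> basis_index" "eqW (\<Sum>x\<in>A. scal (a x) * basis_elem x) 0"
  shows "\<forall>x\<in>A. a x = 0"
proof -
  have "eqV (phi (\<Sum>x\<in>A. scal (a x) * basis_elem x)) (phi 0)" by (rule phi_equ[OF assms(3)])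
  then have "eqV (phi (\<Sum>x\<in>A. scal (a x) * basis_elem x)) 0" by (simp only: phi_simps(5))
  then show ?thesis by (rule basis_independent[OF assms(1,2)])
qed

text \<open>An element of the kernel is a combination of the spanning set, and the images of the spanning set
  are independent.\<close>

lemma phi_injective:
  assumes "p \<in> falg_on G" "r \<in> falg_on G" "eqV (phi p) (phi r)"
  shows "eqW p r"
proof -
  have "spanned (p - r)" by (rule W_spanned[OF falg_on_diff[OF assms(1,2)]])
  then obtain A a where A: "finite A" "A \<subseteq> basis_index" "eqW (p - r) (\<Sum>x\<in>A. scal (a x) * basis_elem x)"
    unfolding spanned_def by blast
  have "phi (p - r) = phi p - phi r" by (simp only: phi_simps)
  then have "eqV (phi (p - r)) 0" using equ_diff_zero[THEN iffD1, OF assms(3)] by (simp only:)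
  then have "eqV (phi (\<Sum>x\<in>A. scal (a x) * basis_elem x)) 0"
    by (rule equ_trans[OF equ_sym[OF phi_equ[OF A(3)]]])
  then have "\<forall>x\<in>A. a x = 0" by (rule basis_independent[OF A(1,2)])
  then have "(\<Sum>x\<in>A. scal (a x) * basis_elem x) = (0 :: 'k klr)"
    by (intro sum.neutral ballI) (simp add: scal_0)
  then have "eqW (p - r) 0" using A(3) by (simp only:)
  then show ?thesis by (rule equ_diff_zero[THEN iffD2])
qed

lemma W_basis_eq: "W_basis n q \<beta> red = (\<lambda>x. cls G (W_rel n q \<beta>) (basis_elem x)) ` basis_index"
proof
  show "(\<lambda>x. cls G (W_rel n q \<beta>) (basis_elem x)) ` basis_index \<subseteq> W_basis n q \<beta> red"
  proof
    fix X assume "X \<in> (\<lambda>x. cls G (W_rel n q \<beta>) (basis_elem x)) ` basis_index"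
    then obtain w m i where "X = cls G (W_rel n q \<beta>) (ymonom m * psiword (red w) * ee i)"
      "w \<in> weyl genD n" "i \<in> \<beta>" by (auto simp: basis_index_def basis_elem_def)
    then show "X \<in> W_basis n q \<beta> red" unfolding W_basis_def ymonom_def by blast
  qed
  show "W_basis n q \<beta> red \<subseteq> (\<lambda>x. cls G (W_rel n q \<beta>) (basis_elem x)) ` basis_index"
  proof
    fix X assume "X \<in> W_basis n q \<beta> red"
    then obtain w m i where X: "X = cls G (W_rel n q \<beta>) (ymonom m * psiword (red w) * ee i)"
      "w \<in> weyl genD n" "i \<in> \<beta>" by (auto simp: W_basis_def ymonom_def)
    define m' where "m' j = (if j \<in> {1..n} then m j else 0)" for j
    have "map (\<lambda>j. yy j ^ m j) [1..<n + 1] = map (\<lambda>j. yy j ^ m' j :: 'k klr) [1..<n + 1]"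
      by (simp add: m'_def)
    then have "ymonom m = ymonom m'" by (simp only: ymonom_def)
    then have "X = cls G (W_rel n q \<beta>) (basis_elem (w, m', i))" using X by (simp add: basis_elem_def)
    moreover have "(w, m', i) \<in> basis_index" using X by (simp add: basis_index_def m'_def)
    ultimately show "X \<in> (\<lambda>x. cls G (W_rel n q \<beta>) (basis_elem x)) ` basis_index" by blast
  qed
qed

lemma W_basis: "vectorspace.basis class_ring (W_alg n q \<beta>) (W_basis n q \<beta> red)"
  unfolding W_alg_def W_basis_eq
proof (rule W.presented_basis)
  show "basis_elem x \<in> falg_on G" if "x \<in> basis_index" for x using that by (rule basis_elem_on)
  show "\<exists>A a. finite A \<and> A \<subseteq> basis_index \<and> eqW p (\<Sum>x\<in>A. scal (a x) * basis_elem x)"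
    if "p \<in> falg_on G" for p
    using W_spanned[OF that] unfolding spanned_def .
  show "\<forall>x\<in>A. a x = 0"
    if "finite A" "A \<subseteq> basis_index" "eqW (\<Sum>x\<in>A. scal (a x) * basis_elem x) 0" for A a
    using that by (rule basis_independent_W)
qed

lemma W_iso:
  "\<exists>\<phi>. \<phi> \<in> ring_iso (W_alg n q \<beta>) (V_fixed n q \<beta>)
    \<and> \<phi> \<in> LinearCombinations.module_hom class_ring (W_alg n q \<beta>) (V_fixed n q \<beta>)"
proof -
  let ?W = "cls G (W_rel n q \<beta>)" and ?V = "cls G (V_rel n q \<beta>)"
  (* the choice of a representative is immaterial because phi respects the relations *)
  define \<Phi> where "\<Phi> X = ?V (phi (SOME p. p \<in> falg_on G \<and> ?W p = X))" for X
  have \<Phi>: "\<Phi> (?W p) = ?V (phi p)" if p: "p \<in> falg_on G" for p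
  proof -
    let ?r = "SOME r. r \<in> falg_on G \<and> ?W r = ?W p"
    have "?r \<in> falg_on G \<and> ?W ?r = ?W p" by (rule someI[of _ p]) (simp add: p)
    then have "?r \<in> falg_on G" "eqW ?r p" using W.cls_eq_iff p by auto
    then show ?thesis unfolding \<Phi>_def using p by (simp add: V.cls_eq_iff phi_closed phi_equ)
  qed
  have W: "W_alg n q \<beta> = W.P" by (simp add: W_alg_def)
  have carrier_V: "carrier (V_fixed n q \<beta>) = ?V ` phi ` falg_on G"
  proof -
    have "carrier (V_fixed n q \<beta>) = {x \<in> ?V ` falg_on G. rho x = x}"
      by (simp add: V_fixed_def V_alg_def V.carrier_P)
    also have "\<dots> = ?V ` phi ` falg_on G"
    proof
      show "{x \<in> ?V ` falg_on G. rho x = x} \<subseteq> ?V ` phi ` falg_on G"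
      proof
        fix x assume "x \<in> {x \<in> ?V ` falg_on G. rho x = x}"
        then obtain p where p: "p \<in> falg_on G" "x = ?V p" "?V (rho_free p) = ?V p"
          using rho_cls by auto
        then have "eqV (rho_free p) p" using V.cls_eq_iff rho_free_closed by blast
        then obtain b where "b \<in> falg_on G" "eqV p (phi b)" using fixed_in_image[OF char2 p(1)] by blast
        then show "x \<in> ?V ` phi ` falg_on G" using p V.cls_eq_iff[OF p(1) phi_closed] by blast
      qed
      show "?V ` phi ` falg_on G \<subseteq> {x \<in> ?V ` falg_on G. rho x = x}"
        using rho_cls phi_closed by (auto simp: rho_free_phi)
    qed
    finally show ?thesis .
  qed
  have ops: "monoid.mult (V_fixed n q \<beta>) = monoid.mult V.P" "one (V_fixed n q \<beta>) = one V.P"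
    "add (V_fixed n q \<beta>) = add V.P" "smult (V_fixed n q \<beta>) = smult V.P"
    by (simp_all add: V_fixed_def V_alg_def)
  have "\<Phi> \<in> Ring.ring_hom W.P (V_fixed n q \<beta>)"
    by (rule ring_hom_memI)
      (auto simp: W.carrier_P carrier_V ops W.P_simps V.P_simps \<Phi> phi_closed falg_on_mult falg_on_add phi_simps)
  moreover have "bij_betw \<Phi> (carrier W.P) (carrier (V_fixed n q \<beta>))"
    unfolding bij_betw_def
  proof
    show "inj_on \<Phi> (carrier W.P)"
    proof (rule inj_onI)
      fix X X' assume "X \<in> carrier W.P" "X' \<in> carrier W.P" and eq: "\<Phi> X = \<Phi> X'"
      then obtain p p' where p: "p \<in> falg_on G" "X = ?W p" "p' \<in> falg_on G" "X' = ?W p'"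
        by (auto simp: W.carrier_P)
      then have "eqV (phi p) (phi p')" using eq by (simp add: \<Phi> V.cls_eq_iff phi_closed)
      then have "eqW p p'" using p phi_injective by blast
      then show "X = X'" using p by (simp add: W.cls_eq_iff)
    qed
    show "\<Phi> ` carrier W.P = carrier (V_fixed n q \<beta>)"
      unfolding W.carrier_P carrier_V image_image by (rule image_cong) (simp_all add: \<Phi>)
  qed
  moreover have "\<Phi> \<in> LinearCombinations.module_hom class_ring W.P (V_fixed n q \<beta>)"
    unfolding LinearCombinations.module_hom_def
    by (auto simp: W.carrier_P carrier_V ops W.P_simps V.P_simps \<Phi> phi_closed falg_on_mult falg_on_add phi_simps)
  ultimately show ?thesis unfolding W ring_iso_def by blast
qed

end


section \<open>Orbits of tuples\<close>

lemma orbitB_closed: "\<lbrakk>j \<in> orbitB n i; a < n\<rbrakk> \<Longrightarrow> actB a j \<in> orbitB n i"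
proof -
  assume "j \<in> orbitB n i" "a < n"
  then obtain ws where "set ws \<subseteq> {0..<n}" "j = foldr actB ws i" by (auto simp: orbitB_def)
  then have "actB a j = foldr actB (a # ws) i" "set (a # ws) \<subseteq> {0..<n}" using \<open>a < n\<close> by auto
  then show ?thesis unfolding orbitB_def by blast
qed

lemma orbitB_entries:
  assumes "i \<in> {1..n} \<rightarrow>\<^sub>E X" "\<And>x. x \<in> X \<Longrightarrow> inverse x \<in> X"
  shows "orbitB n i \<subseteq> {1..n} \<rightarrow>\<^sub>E X"
proof
  fix j assume "j \<in> orbitB n i"
  then obtain ws where ws: "set ws \<subseteq> {0..<n}" "j = foldr actB ws i" by (auto simp: orbitB_def)
  have step: "actB a j \<in> {1..n} \<rightarrow>\<^sub>E X" if j: "j \<in> {1..n} \<rightarrow>\<^sub>E X" and a: "a < n" for a j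
  proof (cases "a = 0")
    case True
    then show ?thesis using j a assms(2) by (auto simp: actB_def PiE_iff extensional_def)
  next
    case False
    then have "transpose a (a + 1) k \<in> {1..n} \<longleftrightarrow> k \<in> {1..n}" for k using a by (auto simp: transpose_def)
    then show ?thesis using False j by (auto simp: actB_def PiE_iff extensional_def)
  qed
  have "foldr actB ws i \<in> {1..n} \<rightarrow>\<^sub>E X" using ws(1) by (induction ws) (use assms(1) step in auto)
  then show "j \<in> {1..n} \<rightarrow>\<^sub>E X" using ws(2) by simp
qed

lemma finite_orbitB:
  assumes "i \<in> {1..n} \<rightarrow>\<^sub>E Z"
  shows "finite (orbitB n i)"
proof -
  let ?X = "i ` {1..n} \<union> inverse ` i ` {1..n}"
  have "orbitB n i \<subseteq> {1..n} \<rightarrow>\<^sub>E ?X"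
    using assms by (intro orbitB_entries) (auto simp: PiE_iff)
  moreover have "finite ({1..n} \<rightarrow>\<^sub>E ?X)" by (intro finite_PiE) auto
  ultimately show ?thesis by (rule finite_subset)
qed

theorem theorem3p7:
  fixes q :: "'k::field" and lams :: "'k list" and n :: nat
    and \<beta> :: "(nat \<Rightarrow> 'k) set" and red :: "(int \<Rightarrow> int) \<Rightarrow> nat list"
  assumes "CHAR('k) \<noteq> 2" and "q \<noteq> 0" and "q ^ 2 \<noteq> 1"
    and "\<And>a. a < length lams \<Longrightarrow> lams ! a \<noteq> 0"
    and "\<And>a b. \<lbrakk>a < length lams; b < length lams; a \<noteq> b\<rbrakk> \<Longrightarrow>
      I_set q (lams ! a) \<inter> I_set q (lams ! b) = {}"
    and "n \<ge> 2"
    and "\<exists>T. finite T \<and> T \<subseteq> ({1..n} \<rightarrow>\<^sub>E S_set q lams) \<and> \<beta> = (\<Union>i\<in>T. orbitB n i)"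
    and "\<And>w. w \<in> weyl genD n \<Longrightarrow> reduced_expr genD n w (red w)"
    and "\<And>w. w \<in> weyl genD n \<Longrightarrow> reduced_expr genB n w (D_to_B (red w))"
  shows "vectorspace.basis class_ring (W_alg n q \<beta>) (W_basis n q \<beta> red)
    \<and> (\<exists>\<phi>. \<phi> \<in> ring_iso (W_alg n q \<beta>) (V_fixed n q \<beta>)
          \<and> \<phi> \<in> LinearCombinations.module_hom class_ring (W_alg n q \<beta>) (V_fixed n q \<beta>))"
proof -
  obtain T where T: "finite T" "T \<subseteq> ({1..n} \<rightarrow>\<^sub>E S_set q lams)" "\<beta> = (\<Union>i\<in>T. orbitB n i)"
    using assms(7) by blast
  have S_nonzero: "0 \<notin> S_set q lams"
    using assms(2,4) by (auto simp: S_set_def I_set_def in_set_conv_nth)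
  have two: "(2 :: 'k) \<noteq> 0"
  proof
    assume "(2 :: 'k) = 0"
    then have "of_nat 2 = (0 :: 'k)" by simp
    then have "CHAR('k) dvd 2" by (simp only: of_nat_eq_0_iff_char_dvd)
    then have "CHAR('k) = 1 \<or> CHAR('k) = 2" using two_is_prime_nat prime_nat_iff by blast
    then show False using assms(1) of_nat_CHAR[where 'a = 'k] by auto
  qed
  interpret klr_full n q \<beta> red
  proof
    have "finite (orbitB n t)" if "t \<in> T" for t using finite_orbitB T(2) that by blast
    then show "finite \<beta>" using T by simp
    show "actB a i \<in> \<beta>" if "a < n" "i \<in> \<beta>" for a i using that orbitB_closed unfolding T(3) by blast
    show "i k \<noteq> 0" if i: "i \<in> \<beta>" and k: "k \<in> {1..n}" for i k
    proof -
      obtain j where j: "j \<in> T" "i \<in> orbitB n j" using i unfolding T(3) by blast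
      have "j \<in> {1..n} \<rightarrow>\<^sub>E S_set q lams" using j(1) T(2) by (rule set_rev_mp)
      moreover have "({1..n} \<rightarrow>\<^sub>E S_set q lams) \<subseteq> ({1..n} \<rightarrow>\<^sub>E - {0})"
        using S_nonzero by (intro PiE_mono) auto
      ultimately have "j \<in> {1..n} \<rightarrow>\<^sub>E - {0}" by (rule set_rev_mp)
      then have "orbitB n j \<subseteq> {1..n} \<rightarrow>\<^sub>E - {0}" by (rule orbitB_entries) simp
      then show ?thesis using j(2) k by (auto simp: PiE_iff)
    qed
  qed (use assms two in auto)
  show ?thesis using W_basis W_iso by blast
qed

end
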